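(* Suppose $1<\vec r<\vec r_1<\infty$ and $1<\vec{\tilde r}<\vec{\tilde r}_1<\infty$, where $\vec r=(r_1,\dots,r_m)$, $\vec{\tilde r}=(\tilde r_1,\dots,\tilde r_m)$, $\vec r_j=(r_{j1},\dots,r_{jm})$, $\vec{\tilde r}_j=(\tilde r_{j1},\dots,\tilde r_{jm})$ for $j=1,2$, and let $$\frac1{r_i}=\frac1{r_{1i}}+\frac1{r_{2i}},\qquad \frac1{\tilde r_i}=\frac1{\tilde r_{1i}}+\frac1{\tilde r_{2i}},\qquad i=1,\dots,m.$$ Let $$-\frac1{N_k}\sum_{i=1}^m\frac{N_{k^{(i)}}}{r_i}<\lambda,\qquad -\frac1{N_k}\sum_{i=1}^m\frac{N_{k^{(i)}}}{r_{1i}}<\lambda_1,\qquad 0<\lambda_2<\frac1{N_k},$$ and suppose that $\lambda=\lambda_1+\lambda_2$. Further suppose that $\varphi$ is a non-negative measurable function on $(0,1]$. Then the commutator $\mathcal{H}_\varphi^b$ is bounded from $\dot B^{\vec r_1,\vec{\tilde r}_1,\lambda_1}_k(\mathbb{R}^n)$ to $\dot B^{\vec r,\vec{\tilde r},\lambda}_k(\mathbb{R}^n)$ for all $b\in\mathrm{CMO}_{\vec r_2,\vec{\tilde r}_2,\lambda_2,k}(\mathbb{R}^n)$ if $$\int_0^1 t^{N_k\lambda_1}\varphi(t)\,\mathrm{d}t<\infty.$$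
   Context: Setting. Let $n\ge 2$, $\mathbb{R}^n=\mathbb{R}^{n_1}\times\cdots\times\mathbb{R}^{n_m}$ with $\sum_{i=1}^m n_i=n$, $n_i\ge1$. Let $k=(k_1,\dots,k_n)$ with all $k_j\ge 0$, split into blocks $k=(k^{(1)},\dots,k^{(m)})$ with $k^{(i)}=(k^{(i)}_1,\dots,k^{(i)}_{n_i})$. Put $N_{k^{(i)}}=n_i+2\sum_{v=1}^{n_i}k^{(i)}_v$ and $N_k=n+2\sum_{j=1}^n k_j=\sum_{i=1}^m N_{k^{(i)}}$. The Dunkl measure is $\mathrm{d}\mu_k(x)=\prod_{j=1}^n|x_j|^{2k_j}\,\mathrm{d}x$; write $|E|_k=\mu_k(E)$. $B(0,R)$ is the open Euclidean ball in $\mathbb{R}^n$ of center $0$ and radius $R$. On each unit sphere $\mathbb{S}^{n_i-1}\subset\mathbb{R}^{n_i}$ let $\mathrm{d}\sigma_{k^{(i)}}(\omega)=\prod_{v=1}^{n_i}|\omega_v|^{2k^{(i)}_v}\,\mathrm{d}\sigma(\omega)$, $\mathrm{d}\sigma$ the surface measure (counting measure on $\{\pm1\}$ if $n_i=1$). Vector inequalities are understood componentwise. Mixed-norm radial-angular Dunkl--Lebesgue space. For vectors $1<\vec u,\vec w<\infty$ in $\mathbb{R}^m$ and measurable $f:\mathbb{R}^n\to\mathbb{C}$, writing $x_i=\rho_i\omega_i\in\mathbb{R}^{n_i}$ in polar coordinates, $\|f\|_{L^{\vec u}_{\mathrm{rad},k}L^{\vec w}_{\mathrm{ang},k}(\mathbb{R}^n)}$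 is obtained by taking successively, for $i=1,2,\dots,m$ (block $1$ innermost), first the $L^{w_i}(\mathbb{S}^{n_i-1},\mathrm{d}\sigma_{k^{(i)}})$ norm in $\omega_i$ and then the $L^{u_i}((0,\infty),\rho_i^{N_{k^{(i)}}-1}\mathrm{d}\rho_i)$ norm in $\rho_i$; i.e. $$\|f\|=\Biggl(\int_0^\infty\Biggl(\int_{\mathbb{S}^{n_m-1}}\cdots\Biggl(\int_0^\infty\Biggl(\int_{\mathbb{S}^{n_1-1}}|f(\rho_1\omega_1,\dots,\rho_m\omega_m)|^{w_1}\mathrm{d}\sigma_{k^{(1)}}(\omega_1)\Biggr)^{\frac{u_1}{w_1}}\rho_1^{N_{k^{(1)}}-1}\mathrm{d}\rho_1\Biggr)^{\frac{w_2}{u_1}}\cdots\mathrm{d}\sigma_{k^{(m)}}(\omega_m)\Biggr)^{\frac{u_m}{w_m}}\rho_m^{N_{k^{(m)}}-1}\mathrm{d}\rho_m\Biggr)^{\frac1{u_m}}.$$ Mixed-norm radial-angular Dunkl $\lambda$-central Morrey space. For $\lambda\in\mathbb{R}$, $\dot B^{\vec u,\vec w,\lambda}_k(\mathbb{R}^n)$ is the set of measurable $f$ with $$\|f\|_{\dot B^{\vec u,\vec w,\lambda}_k(\mathbb{R}^n)}=\sup_{R>0}\frac{\|f\chi_{B(0,R)}\|_{L^{\vec u}_{\mathrm{rad},k}L^{\vec w}_{\mathrm{ang},k}(\mathbb{R}^n)}}{|B(0,R)|_k^{\lambda}\,\|\chi_{B(0,R)}\|_{L^{\vec u}_{\mathrm{rad},k}L^{\vec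 w}_{\mathrm{ang},k}(\mathbb{R}^n)}}<\infty.$$ Mixed-norm radial-angular Dunkl $\lambda$-central bounded mean oscillation space. With $b_{B(0,R),k}=\frac1{|B(0,R)|_k}\int_{B(0,R)}b\,\mathrm{d}\mu_k$ and $\lambda<1/N_k$, $\mathrm{CMO}_{\vec u,\vec w,\lambda,k}(\mathbb{R}^n)$ is the set of locally ($\mu_k$-)integrable $b$ with $$\|b\|_{\mathrm{CMO}_{\vec u,\vec w,\lambda,k}(\mathbb{R}^n)}=\sup_{R>0}\frac{\|(b-b_{B(0,R),k})\chi_{B(0,R)}\|_{L^{\vec u}_{\mathrm{rad},k}L^{\vec w}_{\mathrm{ang},k}(\mathbb{R}^n)}}{|B(0,R)|_k^{\lambda}\,\|\chi_{B(0,R)}\|_{L^{\vec u}_{\mathrm{rad},k}L^{\vec w}_{\mathrm{ang},k}(\mathbb{R}^n)}}<\infty.$$ Operators. $\mathcal{H}_\varphi f(x)=\int_0^1 f(tx)\varphi(t)\,\mathrm{d}t$ and $\mathcal{H}_\varphi^b f(x)=b(x)\mathcal{H}_\varphi f(x)-\mathcal{H}_\varphi(bf)(x)=\int_0^1(b(x)-b(tx))f(tx)\varphi(t)\,\mathrm{d}t$, whenever well defined. Bounded from $X$ to $Y$ means: $\mathcal{H}_\varphi^b f$ is defined almost everywhere for every $f\in X$ and $\|\mathcal{H}_\varphi^b f\|_Y\le C\|f\|_X$ with $C$ independent of $f$. *)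

theory Defs
  imports "HOL-Analysis.Analysis"
begin

text \<open>
  The space \<open>\<real>\<^sup>n\<close> is \<open>real ^ 'n\<close>.  Its splitting into blocks \<open>1, \<dots>, m\<close> is given by a function
  \<open>blk :: 'n \<Rightarrow> nat\<close> with range \<open>{1..m}\<close>: coordinate \<open>j\<close> belongs to block \<open>blk j\<close>, and \<open>n\<^sub>i\<close> is
  the number of coordinates in block \<open>i\<close>.
\<close>

definition block :: "('n \<Rightarrow> nat) \<Rightarrow> nat \<Rightarrow> 'n set" where
  "block blk i = {j. blk j = i}"

definition hom_dim :: "real ^ 'n \<Rightarrow> real" where
  "hom_dim k = real CARD('n) + 2 * (\<Sum>j\<in>UNIV. k $ j)"

definition block_dim :: "('n::finite \<Rightarrow> nat) \<Rightarrow> real ^ 'n \<Rightarrow> nat \<Rightarrow> real" where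
  "block_dim blk k i = real (card (block blk i)) + 2 * (\<Sum>v\<in>block blk i. k $ v)"

text \<open>
  As \<open>0 powr 0 = 0\<close>, the weights below vanish on the hyperplanes \<open>x\<^sub>j = 0\<close> even where \<open>k\<^sub>j = 0\<close>.
  This does not affect the measures: those hyperplanes are null sets (and in a
  one-dimensional block the sphere \<open>{1, -1}\<close> does not meet \<open>0\<close>).
\<close>

definition dunkl_measure :: "real ^ 'n \<Rightarrow> (real ^ 'n) measure" where
  "dunkl_measure k =
     density lebesgue (\<lambda>x. ennreal (\<Prod>j\<in>UNIV. \<bar>x $ j\<bar> powr (2 * k $ j)))"

text \<open>
  Surface measure of the Euclidean unit sphere of \<open>\<real>\<^sup>J\<close>, realised as a measure on \<open>\<real>\<^sup>J\<close>
  concentrated on the sphere: \<open>\<sigma>(A)\<close> is \<open>card J\<close> times the Lebesgue measure of the cone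
  \<open>{r\<omega> | 0 < r \<le> 1, \<omega> \<in> A}\<close>.  For \<open>card J = 1\<close> this is the counting measure on \<open>{1, -1}\<close>.
\<close>

definition surface_measure :: "'n set \<Rightarrow> ('n \<Rightarrow> real) measure" where
  "surface_measure J =
     distr
       (density (Pi\<^sub>M J (\<lambda>_. lborel))
          (\<lambda>x. ennreal (real (card J)) * indicator {y. 0 < L2_set y J \<and> L2_set y J \<le> 1} x))
       (Pi\<^sub>M J (\<lambda>_. lborel))
       (\<lambda>x. \<lambda>j\<in>J. x j / L2_set x J)"

definition dunkl_surface_measure :: "('n \<Rightarrow> nat) \<Rightarrow> real ^ 'n \<Rightarrow> nat \<Rightarrow> ('n \<Rightarrow> real) measure" where
  "dunkl_surface_measure blk k i =
     density (surface_measure (block blk i))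
       (\<lambda>\<omega>. ennreal (\<Prod>v\<in>block blk i. \<bar>\<omega> v\<bar> powr (2 * k $ v)))"

text \<open>The power \<open>a\<^sup>p\<close> on \<open>[0, \<infinity>]\<close>, for \<open>p > 0\<close>.\<close>

definition enn_powr :: "ennreal \<Rightarrow> real \<Rightarrow> ennreal" where
  "enn_powr a p = (if a = \<infinity> then \<infinity> else ennreal (enn2real a powr p))"

definition replace_block ::
    "('n \<Rightarrow> nat) \<Rightarrow> nat \<Rightarrow> real ^ 'n \<Rightarrow> real \<Rightarrow> ('n \<Rightarrow> real) \<Rightarrow> real ^ 'n" where
  "replace_block blk i x \<rho> \<omega> = (\<chi> j. if blk j = i then \<rho> * \<omega> j else x $ j)"

text \<open>
  The norm of \<open>g\<close> in the variables of block \<open>i\<close>: first \<open>L\<^sup>w\<close> in the angular, then \<open>L\<^sup>u\<close> in the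
  radial variable.  The result is a function of \<open>x\<close> that does not depend on block \<open>i\<close> of \<open>x\<close>.
\<close>

definition block_norm ::
    "('n::finite \<Rightarrow> nat) \<Rightarrow> real ^ 'n \<Rightarrow> nat \<Rightarrow> real \<Rightarrow> real \<Rightarrow>
     (real ^ 'n \<Rightarrow> ennreal) \<Rightarrow> real ^ 'n \<Rightarrow> ennreal" where
  "block_norm blk k i u w g x =
     enn_powr
       (\<integral>\<^sup>+\<rho>\<in>{0<..}.
          enn_powr
            (\<integral>\<^sup>+\<omega>. enn_powr (g (replace_block blk i x \<rho> \<omega>)) w \<partial>dunkl_surface_measure blk k i)
            (u / w)
          * ennreal (\<rho> powr (block_dim blk k i - 1)) \<partial>lborel)
       (1 / u)"

primrec iterated_norm ::
    "('n::finite \<Rightarrow> nat) \<Rightarrow> real ^ 'n \<Rightarrow> (nat \<Rightarrow> real) \<Rightarrow> (nat \<Rightarrow> real) \<Rightarrow>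
     (real ^ 'n \<Rightarrow> complex) \<Rightarrow> nat \<Rightarrow> real ^ 'n \<Rightarrow> ennreal" where
  "iterated_norm blk k u w f 0 = (\<lambda>x. ennreal (norm (f x)))"
| "iterated_norm blk k u w f (Suc i) =
     block_norm blk k (Suc i) (u (Suc i)) (w (Suc i)) (iterated_norm blk k u w f i)"

text \<open>
  After all \<open>m\<close> blocks have been integrated out the function is constant, so the point of
  evaluation is irrelevant.
\<close>

definition mixed_norm ::
    "('n::finite \<Rightarrow> nat) \<Rightarrow> real ^ 'n \<Rightarrow> nat \<Rightarrow> (nat \<Rightarrow> real) \<Rightarrow> (nat \<Rightarrow> real) \<Rightarrow>
     (real ^ 'n \<Rightarrow> complex) \<Rightarrow> ennreal" where
  "mixed_norm blk k m u w f = iterated_norm blk k u w f m 0"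

definition central_quotient ::
    "('n::finite \<Rightarrow> nat) \<Rightarrow> real ^ 'n \<Rightarrow> nat \<Rightarrow> (nat \<Rightarrow> real) \<Rightarrow> (nat \<Rightarrow> real) \<Rightarrow> real \<Rightarrow>
     (real ^ 'n \<Rightarrow> complex) \<Rightarrow> real \<Rightarrow> ennreal" where
  "central_quotient blk k m u w lam f R =
     mixed_norm blk k m u w (\<lambda>x. f x * indicator (ball 0 R) x) /
     (ennreal (measure (dunkl_measure k) (ball 0 R) powr lam)
        * mixed_norm blk k m u w (indicator (ball 0 R)))"

definition morrey_norm ::
    "('n::finite \<Rightarrow> nat) \<Rightarrow> real ^ 'n \<Rightarrow> nat \<Rightarrow> (nat \<Rightarrow> real) \<Rightarrow> (nat \<Rightarrow> real) \<Rightarrow> real \<Rightarrow>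
     (real ^ 'n \<Rightarrow> complex) \<Rightarrow> ennreal" where
  "morrey_norm blk k m u w lam f = (SUP R\<in>{0<..}. central_quotient blk k m u w lam f R)"

definition morrey_space ::
    "('n::finite \<Rightarrow> nat) \<Rightarrow> real ^ 'n \<Rightarrow> nat \<Rightarrow> (nat \<Rightarrow> real) \<Rightarrow> (nat \<Rightarrow> real) \<Rightarrow> real \<Rightarrow>
     (real ^ 'n \<Rightarrow> complex) set" where
  "morrey_space blk k m u w lam =
     {f. f \<in> borel_measurable lebesgue \<and> morrey_norm blk k m u w lam f < \<infinity>}"

definition ball_mean :: "real ^ 'n \<Rightarrow> (real ^ 'n \<Rightarrow> complex) \<Rightarrow> real \<Rightarrow> complex" where
  "ball_mean k b R =
     (LINT x:ball 0 R|dunkl_measure k. b x)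
       / complex_of_real (measure (dunkl_measure k) (ball 0 R))"

definition cmo_norm ::
    "('n::finite \<Rightarrow> nat) \<Rightarrow> real ^ 'n \<Rightarrow> nat \<Rightarrow> (nat \<Rightarrow> real) \<Rightarrow> (nat \<Rightarrow> real) \<Rightarrow> real \<Rightarrow>
     (real ^ 'n \<Rightarrow> complex) \<Rightarrow> ennreal" where
  "cmo_norm blk k m u w lam b =
     (SUP R\<in>{0<..}. central_quotient blk k m u w lam (\<lambda>x. b x - ball_mean k b R) R)"

definition cmo_space ::
    "('n::finite \<Rightarrow> nat) \<Rightarrow> real ^ 'n \<Rightarrow> nat \<Rightarrow> (nat \<Rightarrow> real) \<Rightarrow> (nat \<Rightarrow> real) \<Rightarrow> real \<Rightarrow>
     (real ^ 'n \<Rightarrow> complex) set" where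
  "cmo_space blk k m u w lam =
     {b. (\<forall>K. compact K \<longrightarrow> set_integrable (dunkl_measure k) K b)
         \<and> cmo_norm blk k m u w lam b < \<infinity>}"

definition hardy_defined :: "(real \<Rightarrow> real) \<Rightarrow> (real ^ 'n \<Rightarrow> complex) \<Rightarrow> real ^ 'n \<Rightarrow> bool" where
  "hardy_defined \<phi> f x \<longleftrightarrow>
     set_integrable lebesgue {0<..1} (\<lambda>t. f (t *\<^sub>R x) * complex_of_real (\<phi> t))"

definition hardy :: "(real \<Rightarrow> real) \<Rightarrow> (real ^ 'n \<Rightarrow> complex) \<Rightarrow> real ^ 'n \<Rightarrow> complex" where
  "hardy \<phi> f x = (LINT t:{0<..1}|lebesgue. f (t *\<^sub>R x) * complex_of_real (\<phi> t))"

definition commutator_defined ::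
    "(real \<Rightarrow> real) \<Rightarrow> (real ^ 'n \<Rightarrow> complex) \<Rightarrow> (real ^ 'n \<Rightarrow> complex) \<Rightarrow> real ^ 'n \<Rightarrow> bool" where
  "commutator_defined \<phi> b f x \<longleftrightarrow>
     hardy_defined \<phi> f x \<and> hardy_defined \<phi> (\<lambda>y. b y * f y) x"

definition commutator ::
    "(real \<Rightarrow> real) \<Rightarrow> (real ^ 'n \<Rightarrow> complex) \<Rightarrow> (real ^ 'n \<Rightarrow> complex) \<Rightarrow> real ^ 'n \<Rightarrow> complex" where
  "commutator \<phi> b f x = b x * hardy \<phi> f x - hardy \<phi> (\<lambda>y. b y * f y) x"

text \<open>
  Boundedness from \<open>X\<close> to \<open>Y\<close>, with norms \<open>nX\<close> and \<open>nY\<close>, of an operator \<open>T\<close> for which \<open>T f x\<close>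
  is meaningful only at those \<open>x\<close> with \<open>D f x\<close>.
\<close>

definition bounded_operator ::
    "((real ^ 'n \<Rightarrow> complex) \<Rightarrow> real ^ 'n \<Rightarrow> bool) \<Rightarrow>
     ((real ^ 'n \<Rightarrow> complex) \<Rightarrow> real ^ 'n \<Rightarrow> complex) \<Rightarrow>
     (real ^ 'n \<Rightarrow> complex) set \<Rightarrow> ((real ^ 'n \<Rightarrow> complex) \<Rightarrow> ennreal) \<Rightarrow>
     (real ^ 'n \<Rightarrow> complex) set \<Rightarrow> ((real ^ 'n \<Rightarrow> complex) \<Rightarrow> ennreal) \<Rightarrow> bool" where
  "bounded_operator D T X nX Y nY \<longleftrightarrow>
     (\<forall>f\<in>X. (AE x in lebesgue. D f x) \<and> T f \<in> Y) \<and>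
     (\<exists>C::real. \<forall>f\<in>X. nY (T f) \<le> ennreal C * nX f)"

end

theory Submission imports Defs
begin

text \<open>
  On a ball \<open>B = B(0,R)\<close> with mean \<open>b\<^sub>B\<close> the commutator is dominated by
  \<open>\<integral> (|b(x) - b\<^sub>B| + |b(tx) - b\<^sub>B|) |f(tx)| \<phi>(t) dt\<close>.  Minkowski's integral inequality moves the
  mixed norm inside the integral, Hoelder's inequality separates \<open>b\<close> from \<open>f\<close>, and dilation by \<open>t\<close>
  turns the norm of \<open>f(t\<cdot>)\<close> on \<open>B\<close> into that of \<open>f\<close> on \<open>tB\<close>, which yields the factor
  \<open>t^(N \<lambda>\<^sub>1)\<close>.  The remaining difference of means on \<open>tB\<close> and \<open>B\<close> is summed along dyadic balls, a
  geometric series because \<open>\<lambda>\<^sub>2 > 0\<close>.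

  Iterated norms of Lebesgue measurable functions are handled through Borel functions: a Borel
  function vanishing off a null set has mixed norm \<open>0\<close>, since by polar coordinates this is true
  for the exponents \<open>1\<close>, and whether an iterated norm vanishes does not depend on the exponents.
\<close>

section \<open>Weighted \<open>L\<^sup>p\<close> norms of extended nonnegative functions\<close>

text \<open>All estimates live in \<open>[0, top]\<close>, so no norm has to be known finite before
  it is bounded. The given \<open>b\<close> and \<open>f\<close> are only Lebesgue measurable, and
  an iterated norm sees sections on which measurability may fail. Hence Hoelder, Minkowski and
  dilation are applied to Borel functions only: Borel minorants replace the data in the hypotheses,
  a Borel majorant replaces the commutator in the conclusion, and monotonicity, valid for arbitrary
  functions, connects them.

  Scaling fixes every exponent. The indicator of \<open>B(0,R)\<close> has mixed norm
  \<open>R powr hdim u\<close> and measure \<open>R powr D\<close> up to constants, where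
  \<open>hdim u\<close> sums \<open>bdim i / u i\<close>. Dilating \<open>f\<close> costs
  \<open>t powr - hdim r1\<close>, the Morrey bound on \<open>tB\<close> supplies
  \<open>t powr (D * lam1 + hdim r1)\<close>, and the moment weight survives. For \<open>b\<close>
  the same cancellation leaves \<open>t powr (D * lam2)\<close>, which is at most 1, and the
  difference of means is bounded uniformly in \<open>t\<close>; so \<open>b\<close> adds no weight.
  The powers of \<open>R\<close> match because \<open>hdim r = hdim r1 + hdim r2\<close> and
  \<open>lam = lam1 + lam2\<close>.\<close>

lemma enn_powr_ennreal: "0 \<le> a \<Longrightarrow> enn_powr (ennreal a) p = ennreal (a powr p)"
  by (simp add: enn_powr_def)

text \<open>Both \<open>0\<close> and \<open>top\<close> are fixed by every exponent
  (\<open>0 powr p = 0\<close> even at \<open>p = 0\<close>), so the laws for products and iterated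
  powers carry no sign conditions, and zero sets survive any power.\<close>

lemma enn_powr_top [simp]: "enn_powr top p = top"
  by (simp add: enn_powr_def)

lemma enn_powr_0 [simp]: "enn_powr 0 p = 0"
  by (simp add: enn_powr_def)

lemma enn_powr_one_left [simp]: "enn_powr 1 p = 1"
  by (simp add: enn_powr_def)

lemma enn_powr_one [simp]: "enn_powr a 1 = a"
  by (cases a) (auto simp: enn_powr_def)

lemma enn_powr_eq_0_iff [simp]: "enn_powr a p = 0 \<longleftrightarrow> a = 0"
  by (cases a) (auto simp: enn_powr_def)

lemma enn_powr_eq_top_iff [simp]: "enn_powr a p = top \<longleftrightarrow> a = top"
  by (cases a) (auto simp: enn_powr_def)

lemma enn_powr_mono: "0 \<le> p \<Longrightarrow> a \<le> b \<Longrightarrow> enn_powr a p \<le> enn_powr b p"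
  by (cases a; cases b) (auto simp: enn_powr_ennreal powr_mono2 top_unique)

lemma enn_powr_mult: "enn_powr (a * b) p = enn_powr a p * enn_powr b p"
  by (cases a; cases b)
    (auto simp: enn_powr_ennreal powr_mult ennreal_mult_eq_top_iff ennreal_top_mult ennreal_mult_top
      simp flip: ennreal_mult)

lemma enn_powr_powr: "enn_powr (enn_powr a p) q = enn_powr a (p * q)"
  by (cases a) (auto simp: enn_powr_ennreal powr_powr)

lemma enn_powr_add: "a \<noteq> top \<Longrightarrow> enn_powr a (p + q) = enn_powr a p * enn_powr a q"
  by (cases a) (auto simp: enn_powr_ennreal powr_add ennreal_mult)

lemma measurable_enn_powr [measurable (raw)]:
  assumes [measurable]: "f \<in> borel_measurable M"
  shows "(\<lambda>x. enn_powr (f x) p) \<in> borel_measurable M"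
  unfolding enn_powr_def by measurable

section \<open>Hoelder and Minkowski inequalities on \<open>[0, top]\<close>\<close>

definition lp :: "'a measure \<Rightarrow> real \<Rightarrow> ('a \<Rightarrow> ennreal) \<Rightarrow> ennreal" where
  "lp M p F = enn_powr (\<integral>\<^sup>+x. enn_powr (F x) p \<partial>M) (1 / p)"

lemma lp_powr: "p > 0 \<Longrightarrow> enn_powr (lp M p F) p = (\<integral>\<^sup>+x. enn_powr (F x) p \<partial>M)"
  by (simp add: lp_def enn_powr_powr)

lemma lp_mono: "0 < p \<Longrightarrow> (\<And>x. F x \<le> G x) \<Longrightarrow> lp M p F \<le> lp M p G"
  unfolding lp_def by (intro enn_powr_mono nn_integral_mono) auto

lemma lp_eq_0_iff:
  assumes [measurable]: "F \<in> borel_measurable M"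
  shows "lp M p F = 0 \<longleftrightarrow> (AE x in M. F x = 0)"
  by (simp add: lp_def nn_integral_0_iff_AE)

lemma lp_cmult:
  assumes [measurable]: "F \<in> borel_measurable M" and "0 < p"
  shows "lp M p (\<lambda>x. c * F x) = c * lp M p F"
  using assms(2) by (simp add: lp_def enn_powr_mult nn_integral_cmult enn_powr_powr)

text \<open>Young's inequality after normalising both factors.\<close>

lemma nn_integral_Hoelder:
  assumes [measurable]: "F \<in> borel_measurable M" "G \<in> borel_measurable M"
    and p: "p > 1" and q: "q > 1" and pq: "1 / p + 1 / q = 1"
  shows "(\<integral>\<^sup>+x. F x * G x \<partial>M) \<le> lp M p F * lp M q G"
proof -
  consider "lp M p F = 0 \<or> lp M q G = 0" | "lp M p F * lp M q G = top"
    | a b where "lp M p F = ennreal a" "lp M q G = ennreal b" "a > 0" "b > 0"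
    by (cases "lp M p F"; cases "lp M q G")
      (auto simp: ennreal_mult_eq_top_iff less_le)
  then show ?thesis
  proof cases
    case 1
    then have "AE x in M. F x * G x = 0"
      by (auto simp: lp_eq_0_iff)
    then have "(\<integral>\<^sup>+x. F x * G x \<partial>M) = 0"
      by (subst nn_integral_0_iff_AE) auto
    then show ?thesis by simp
  next
    case 2
    then show ?thesis by simp
  next
    case (3 a b)
    \<comment> \<open>These are the coefficients in \<open>a * b\<close> times Young's inequality
      for \<open>f / a\<close> and \<open>g / b\<close>, with \<open>a\<close>, \<open>b\<close> the
      two norms; after integration they add up to \<open>a * b * (1 / p + 1 / q)\<close>.\<close>
    define \<alpha> where "\<alpha> = a * b / (p * a powr p)"
    define \<beta> where "\<beta> = a * b / (q * b powr q)"
    have nn: "\<alpha> > 0" "\<beta> > 0" using 3 p q by (auto simp: \<alpha>_def \<beta>_def)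
    have young: "F x * G x \<le> ennreal \<alpha> * enn_powr (F x) p + ennreal \<beta> * enn_powr (G x) q" for x
    proof (cases "F x = top \<or> G x = top")
      case True
      then show ?thesis using nn by (auto simp: ennreal_mult_top)
    next
      case False
      then obtain f g where fg: "F x = ennreal f" "G x = ennreal g" "f \<ge> 0" "g \<ge> 0"
        by (cases "F x"; cases "G x") auto
      have "f / a * (g / b) \<le> (f / a) powr p / p + (g / b) powr q / q"
        using Youngs_inequality[OF p q pq, of "f / a" "g / b"] fg 3 by simp
      then have "a * b * (f / a * (g / b)) \<le> a * b * ((f / a) powr p / p + (g / b) powr q / q)"
        using 3 by (intro mult_left_mono) auto
      also have "a * b * (f / a * (g / b)) = f * g"
        using 3 by simp
      also have "a * b * ((f / a) powr p / p + (g / b) powr q / q) = \<alpha> * f powr p + \<beta> * g powr q"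
        using 3 fg by (simp add: \<alpha>_def \<beta>_def powr_divide field_simps)
      finally have "ennreal (f * g) \<le> ennreal (\<alpha> * f powr p + \<beta> * g powr q)"
        by (rule ennreal_leI)
      then show ?thesis using fg nn p q by (simp add: enn_powr_ennreal ennreal_mult ennreal_plus)
    qed
    have "(\<integral>\<^sup>+x. F x * G x \<partial>M) \<le>
        (\<integral>\<^sup>+x. ennreal \<alpha> * enn_powr (F x) p + ennreal \<beta> * enn_powr (G x) q \<partial>M)"
      by (intro nn_integral_mono young)
    also have "\<dots> = ennreal \<alpha> * enn_powr (lp M p F) p + ennreal \<beta> * enn_powr (lp M q G) q"
      using p q by (simp add: nn_integral_add nn_integral_cmult lp_powr)
    also have "\<dots> = ennreal (\<alpha> * a powr p + \<beta> * b powr q)"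
      using 3 nn by (simp add: enn_powr_ennreal ennreal_mult ennreal_plus)
    also have "\<alpha> * a powr p + \<beta> * b powr q = a * b * (1 / p + 1 / q)"
      using 3 p q by (simp add: \<alpha>_def \<beta>_def field_simps)
    finally show ?thesis using 3 pq by (simp add: ennreal_mult)
  qed
qed

text \<open>Hoelder for the \<open>r\<close>-th powers of \<open>F\<close> and \<open>G\<close>: the
  exponents \<open>p / r\<close> and \<open>q / r\<close> are conjugate by the relation between
  \<open>r\<close>, \<open>p\<close> and \<open>q\<close>.\<close>

lemma lp_Hoelder:
  assumes [measurable]: "F \<in> borel_measurable M" "G \<in> borel_measurable M"
    and pos: "r > 0" "p > 0" "q > 0" and r: "1 / r = 1 / p + 1 / q"
  shows "lp M r (\<lambda>x. F x * G x) \<le> lp M p F * lp M q G"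
proof -
  have *: "p / r = 1 + p / q" "q / r = 1 + q / p"
    using r pos by (auto simp: field_simps)
  have "p / r > 1" "q / r > 1"
    using pos by (auto simp: *)
  moreover have "1 / (p / r) + 1 / (q / r) = r * (1 / p + 1 / q)"
    by (simp add: field_simps)
  then have "1 / (p / r) + 1 / (q / r) = 1"
    using pos by (simp flip: r)
  ultimately have "(\<integral>\<^sup>+x. enn_powr (F x) r * enn_powr (G x) r \<partial>M) \<le>
      lp M (p / r) (\<lambda>x. enn_powr (F x) r) * lp M (q / r) (\<lambda>x. enn_powr (G x) r)"
    by (intro nn_integral_Hoelder) auto
  also have "\<dots> = enn_powr (lp M p F * lp M q G) r"
    using pos by (simp add: lp_def enn_powr_powr enn_powr_mult)
  finally have "enn_powr (\<integral>\<^sup>+x. enn_powr (F x) r * enn_powr (G x) r \<partial>M) (1 / r) \<le>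
      enn_powr (enn_powr (lp M p F * lp M q G) r) (1 / r)"
    using pos by (intro enn_powr_mono) auto
  then show ?thesis using pos by (simp add: lp_def[of M r] enn_powr_mult enn_powr_powr)
qed

text \<open>The last step of the duality argument for Minkowski's inequality, where the norm of the
  test function is divided out; it is legitimate only for a finite norm.\<close>

lemma mult_cancel_ennreal_powr:
  assumes "a \<noteq> top" "enn_powr a p \<le> b * enn_powr a (p - 1)"
  shows "a \<le> b"
proof (cases "a = 0")
  case False
  have "a * enn_powr a (p - 1) = enn_powr a p"
    using assms(1) enn_powr_add[of a 1 "p - 1"] by simp
  then have "enn_powr a (p - 1) * a \<le> enn_powr a (p - 1) * b"
    using assms by (simp add: mult.commute)
  then show ?thesis
    using False assms(1)
    by (subst (asm) ennreal_mult_le_mult_iff) auto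
qed auto

text \<open>
  Testing \<open>G = \<integral>F\<^sub>t dt\<close> against the truncations \<open>H\<close> of \<open>G\<close>, which have finite norm, gives
  \<open>\<parallel>H\<parallel>\<^sup>p \<le> \<integral>G H\<^sup>p\<^sup>-\<^sup>1 \<le> \<parallel>H\<parallel>\<^sup>p\<^sup>-\<^sup>1 \<integral>\<parallel>F\<^sub>t\<parallel> dt\<close>.
\<close>

lemma lp_Minkowski_integral:
  assumes "sigma_finite_measure M" "sigma_finite_measure P"
    and F [measurable]: "case_prod F \<in> borel_measurable (P \<Otimes>\<^sub>M M)" and p: "p > 1"
  shows "lp M p (\<lambda>x. \<integral>\<^sup>+t. F t x \<partial>P) \<le> (\<integral>\<^sup>+t. lp M p (F t) \<partial>P)"
proof -
  interpret M: sigma_finite_measure M by fact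
  interpret P: sigma_finite_measure P by fact
  interpret MP: pair_sigma_finite P M ..
  define G where "G = (\<lambda>x. \<integral>\<^sup>+t. F t x \<partial>P)"
  have [measurable]: "G \<in> borel_measurable M" unfolding G_def by measurable
  obtain A where A: "range A \<subseteq> sets M" "(\<Union>i. A i) = space M"
    "\<And>i. emeasure M (A i) \<noteq> \<infinity>" "incseq A"
    using M.sigma_finite_incseq by blast
  have [measurable]: "A i \<in> sets M" for i using A by auto
  \<comment> \<open>Cutting at height \<open>n\<close> and to a set of finite measure keeps the norm
    of \<open>H n\<close> finite, while \<open>H n\<close> still increases to
    \<open>G\<close>.\<close>
  define H where "H = (\<lambda>n x. min (G x) (of_nat n) * indicator (A n) x)"
  have [measurable]: "H n \<in> borel_measurable M" for n unfolding H_def by measurable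
  define L where "L = (\<integral>\<^sup>+t. lp M p (F t) \<partial>P)"
  have step: "lp M p (H n) \<le> L" for n
  proof (rule mult_cancel_ennreal_powr)
    have "(\<integral>\<^sup>+x. enn_powr (H n x) p \<partial>M) \<le> (\<integral>\<^sup>+x. enn_powr (of_nat n) p * indicator (A n) x \<partial>M)"
      using p by (intro nn_integral_mono) (auto simp: H_def indicator_def intro!: enn_powr_mono)
    also have "\<dots> = enn_powr (of_nat n) p * emeasure M (A n)"
      by (simp add: nn_integral_cmult)
    also have "\<dots> < top"
      using A(3)[of n] by (simp add: less_top[symmetric] ennreal_mult_eq_top_iff)
    finally show "lp M p (H n) \<noteq> top"
      by (auto simp: lp_def less_top)
    have "enn_powr (lp M p (H n)) p = (\<integral>\<^sup>+x. enn_powr (H n x) p \<partial>M)"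
      using p by (simp add: lp_powr)
    also have "\<dots> \<le> (\<integral>\<^sup>+x. G x * enn_powr (H n x) (p - 1) \<partial>M)"
    proof (intro nn_integral_mono)
      fix x
      have "H n x \<noteq> top" by (auto simp: H_def indicator_def min_def top_unique)
      then have "enn_powr (H n x) p = H n x * enn_powr (H n x) (p - 1)"
        using enn_powr_add[of "H n x" 1 "p - 1"] by simp
      also have "\<dots> \<le> G x * enn_powr (H n x) (p - 1)"
        by (intro mult_right_mono) (auto simp: H_def indicator_def)
      finally show "enn_powr (H n x) p \<le> G x * enn_powr (H n x) (p - 1)" .
    qed
    also have "\<dots> = (\<integral>\<^sup>+x. (\<integral>\<^sup>+t. F t x * enn_powr (H n x) (p - 1) \<partial>P) \<partial>M)"
      by (intro nn_integral_cong) (simp add: G_def nn_integral_multc)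
    also have "\<dots> = (\<integral>\<^sup>+t. (\<integral>\<^sup>+x. F t x * enn_powr (H n x) (p - 1) \<partial>M) \<partial>P)"
      by (subst MP.Fubini') auto
    also have "\<dots> \<le> (\<integral>\<^sup>+t. lp M p (F t) * enn_powr (lp M p (H n)) (p - 1) \<partial>P)"
    proof (intro nn_integral_mono)
      fix t assume [measurable]: "t \<in> space P"
      \<comment> \<open>The conjugate exponent of \<open>p\<close>: since
        \<open>(p - 1) * ?q = p\<close>, the norm of the power of \<open>H n\<close> is a power of
        its \<open>p\<close>-norm.\<close>
      let ?q = "p / (p - 1)"
      have "(\<integral>\<^sup>+x. F t x * enn_powr (H n x) (p - 1) \<partial>M) \<le>
          lp M p (F t) * lp M ?q (\<lambda>x. enn_powr (H n x) (p - 1))"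
        using p by (intro nn_integral_Hoelder) (auto simp: field_simps)
      also have "lp M ?q (\<lambda>x. enn_powr (H n x) (p - 1)) = enn_powr (lp M p (H n)) (p - 1)"
        using p by (simp add: lp_def enn_powr_powr)
      finally show "(\<integral>\<^sup>+x. F t x * enn_powr (H n x) (p - 1) \<partial>M) \<le>
          lp M p (F t) * enn_powr (lp M p (H n)) (p - 1)" .
    qed
    also have "\<dots> = L * enn_powr (lp M p (H n)) (p - 1)"
      unfolding L_def by (rule nn_integral_multc) (simp add: lp_def)
    finally show "enn_powr (lp M p (H n)) p \<le> L * enn_powr (lp M p (H n)) (p - 1)" .
  qed
  have "(\<integral>\<^sup>+x. enn_powr (G x) p \<partial>M) = (\<integral>\<^sup>+x. (SUP n. enn_powr (H n x) p) \<partial>M)"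
  proof (intro nn_integral_cong antisym)
    fix x assume x: "x \<in> space M"
    then obtain j where j: "x \<in> A j" using A(2) by auto
    have xA: "x \<in> A (max i j)" for i using j incseqD[OF \<open>incseq A\<close>, of j "max i j"] by auto
    show "enn_powr (G x) p \<le> (SUP n. enn_powr (H n x) p)"
    proof (cases "G x = top")
      case True
      have *: "enn_powr (of_nat n) p \<le> (SUP n. enn_powr (H n x) p)" for n :: nat
        using xA[of n] p True
        by (intro SUP_upper2[of "max n j"] enn_powr_mono) (auto simp: H_def)
      \<comment> \<open>Where \<open>G\<close> is infinite the truncations eventually equal the
        height of the cut, and \<open>n <= n powr p\<close> for \<open>p > 1\<close> makes their
        powers unbounded.\<close>
      have "of_nat n \<le> (SUP n. enn_powr (H n x) p)" for n :: nat
      proof -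
        have "(of_nat n :: ennreal) \<le> enn_powr (of_nat n) p"
        proof (cases "n = 0")
          case False
          then have "real n powr 1 \<le> real n powr p" using p by (intro powr_mono) auto
          then show ?thesis
            using False enn_powr_ennreal[of "real n" p]
            by (simp add: ennreal_of_nat_eq_real_of_nat ennreal_leI)
        qed simp
        then show ?thesis using * order_trans by blast
      qed
      then have "(SUP n. enn_powr (H n x) p) = top"
        by (metis ennreal_SUP_of_nat_eq_top SUP_least top_unique)
      then show ?thesis by (metis top_greatest)
    next
      case False
      then obtain i :: nat where "G x \<le> of_nat i"
        by (metis ennreal_Ex_less_of_nat False less_top less_imp_le)
      moreover have "(of_nat i :: ennreal) \<le> of_nat (max i j)"
        by (rule of_nat_mono) simp
      ultimately have "G x \<le> of_nat (max i j)"
        by (rule order_trans)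
      then have "G x = H (max i j) x"
        using xA[of i] by (simp add: H_def min_absorb1)
      then show ?thesis by (intro SUP_upper2[of "max i j"]) auto
    qed
    show "(SUP n. enn_powr (H n x) p) \<le> enn_powr (G x) p"
      using p by (intro SUP_least enn_powr_mono) (auto simp: H_def indicator_def)
  qed
  also have "\<dots> = (SUP n. \<integral>\<^sup>+x. enn_powr (H n x) p \<partial>M)"
  proof (rule nn_integral_monotone_convergence_SUP)
    show "incseq (\<lambda>n x. enn_powr (H n x) p)"
      unfolding incseq_def le_fun_def
    proof (intro allI impI enn_powr_mono)
      fix a b :: nat and x assume "a \<le> b"
      then have "A a \<subseteq> A b" using A by (auto simp: incseq_def)
      then show "H a x \<le> H b x"
        using \<open>a \<le> b\<close> unfolding H_def
        by (intro mult_mono min.mono) (auto simp: indicator_def)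
    qed (use p in auto)
  qed measurable
  also have "\<dots> \<le> enn_powr L p"
  proof (rule SUP_least)
    fix n
    show "(\<integral>\<^sup>+x. enn_powr (H n x) p \<partial>M) \<le> enn_powr L p"
      using enn_powr_mono[OF _ step, of p n] p by (simp add: lp_powr)
  qed
  finally have "enn_powr (\<integral>\<^sup>+x. enn_powr (G x) p \<partial>M) (1 / p) \<le> enn_powr (enn_powr L p) (1 / p)"
    using p by (intro enn_powr_mono) auto
  then show ?thesis using p by (simp add: lp_def G_def L_def enn_powr_powr)
qed

lemma lp_mono_AE: "0 < p \<Longrightarrow> AE x in M. F x \<le> G x \<Longrightarrow> lp M p F \<le> lp M p G"
  unfolding lp_def by (intro enn_powr_mono nn_integral_mono_AE) (auto elim!: eventually_mono intro: enn_powr_mono)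

lemma lp_const: "0 < p \<Longrightarrow> lp M p (\<lambda>_. c) = c * enn_powr (emeasure M (space M)) (1 / p)"
  by (simp add: lp_def enn_powr_mult enn_powr_powr)

lemma measurable_lp:
  assumes "sigma_finite_measure M" and [measurable]: "case_prod F \<in> borel_measurable (N \<Otimes>\<^sub>M M)"
  shows "(\<lambda>x. lp M p (F x)) \<in> borel_measurable N"
proof -
  interpret sigma_finite_measure M by fact
  show ?thesis unfolding lp_def by measurable
qed

section \<open>Polar coordinates for the Dunkl measure\<close>

abbreviation lborelP :: "'n set \<Rightarrow> ('n \<Rightarrow> real) measure" where
  "lborelP J \<equiv> Pi\<^sub>M J (\<lambda>_. lborel)"

lemma product_sigma_finite_lborel: "product_sigma_finite (\<lambda>_. lborel :: real measure)"
  by standard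

lemma sigma_finite_lborelP: "finite J \<Longrightarrow> sigma_finite_measure (lborelP J)"
  by (intro product_sigma_finite.sigma_finite product_sigma_finite_lborel)

lemma measurable_L2_set [measurable]: "(\<lambda>x. L2_set x J) \<in> borel_measurable (lborelP J)"
  unfolding L2_set_def by measurable

lemma L2_set_scale: "0 \<le> c \<Longrightarrow> L2_set (\<lambda>i\<in>J. c * x i) J = c * L2_set x J"
proof -
  assume c: "0 \<le> c"
  have "L2_set (\<lambda>i\<in>J. c * x i) J = L2_set (\<lambda>i. c * x i) J"
    by (intro L2_set_cong) auto
  then show ?thesis using c by (simp add: L2_set_right_distrib)
qed

text \<open>Product measures are determined by boxes, and on a box the rescaled image measure
  \<open>D\<close> factors into one-dimensional changes of variables, each giving one factor
  \<open>c\<close>.\<close>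

lemma nn_integral_lborelP_scale:
  fixes F :: "('n \<Rightarrow> real) \<Rightarrow> ennreal"
  assumes J: "finite J" and c: "0 < c" and F [measurable]: "F \<in> borel_measurable (lborelP J)"
  shows "(\<integral>\<^sup>+x. F x \<partial>lborelP J) = ennreal (c powr card J) * (\<integral>\<^sup>+x. F (\<lambda>i\<in>J. c * x i) \<partial>lborelP J)"
proof -
  interpret product_sigma_finite "\<lambda>_::'n. lborel :: real measure"
    by (rule product_sigma_finite_lborel)
  define D where "D = density (distr (lborelP J) (lborelP J) (\<lambda>x. \<lambda>i\<in>J. c * x i)) (\<lambda>_. ennreal (c powr card J))"
  have "D = lborelP J"
  proof (rule PiM_eqI)
    fix A :: "'n \<Rightarrow> real set" assume A: "\<And>i. i \<in> J \<Longrightarrow> A i \<in> sets lborel"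
    then have A' [measurable]: "\<And>i. i \<in> J \<Longrightarrow> A i \<in> sets borel" by simp
    let ?B = "\<lambda>i. (\<lambda>x. c * x) -` A i"
    have B: "?B i \<in> sets borel" if "i \<in> J" for i
      using measurable_sets[of "\<lambda>x. c * x" borel borel "A i"] A'[OF that] by simp
    have "(\<lambda>x. \<lambda>i\<in>J. c * x i) -` (Pi\<^sub>E J A) \<inter> space (lborelP J) = Pi\<^sub>E J ?B"
      by (auto simp: space_PiM PiE_iff extensional_def)
    then have "emeasure D (Pi\<^sub>E J A) = ennreal (c powr card J) * emeasure (lborelP J) (Pi\<^sub>E J ?B)"
      unfolding D_def using J A
      by (subst emeasure_density_const) (auto simp: emeasure_distr sets_PiM_I_finite)
    also have "emeasure (lborelP J) (Pi\<^sub>E J ?B) = (\<Prod>i\<in>J. emeasure lborel (?B i))"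
      using J B by (intro emeasure_PiM) auto
    also have "ennreal (c powr card J) * \<dots> = (\<Prod>i\<in>J. ennreal c * emeasure lborel (?B i))"
      using c by (simp add: prod.distrib powr_realpow ennreal_power)
    also have "\<dots> = (\<Prod>i\<in>J. emeasure lborel (A i))"
    proof (intro prod.cong refl)
      fix i assume "i \<in> J"
      then have [measurable]: "A i \<in> sets borel" by simp
      have "emeasure lborel (A i) = emeasure (density (distr lborel borel (\<lambda>x. 0 + c * x)) (\<lambda>_. ennreal \<bar>c\<bar>)) (A i)"
        using c lborel_real_affine[of c 0] by simp
      also have "\<dots> = ennreal c * emeasure lborel (?B i)"
        using c by (subst emeasure_density_const) (auto simp: emeasure_distr)
      finally show "ennreal c * emeasure lborel (?B i) = emeasure lborel (A i)" by simp
    qed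
    finally show "emeasure D (Pi\<^sub>E J A) = (\<Prod>i\<in>J. emeasure lborel (A i))" .
  qed (use J in \<open>auto simp: D_def\<close>)
  then have "(\<integral>\<^sup>+x. F x \<partial>lborelP J) = (\<integral>\<^sup>+x. F x \<partial>D)" by simp
  also have "\<dots> = ennreal (c powr card J) * (\<integral>\<^sup>+x. F (\<lambda>i\<in>J. c * x i) \<partial>lborelP J)"
    unfolding D_def by (simp add: nn_integral_density nn_integral_distr nn_integral_cmult)
  finally show ?thesis .
qed

text \<open>Used twice: one nonzero coordinate keeps a point away from the origin in polar
  coordinates, and all coordinates together make the Dunkl weight positive almost
  everywhere.\<close>

lemma AE_lborelP_component_nonzero:
  fixes J :: "'n set"
  assumes J: "finite J" "j \<in> J"
  shows "AE x in lborelP J. x j \<noteq> 0"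
proof -
  interpret product_sigma_finite "\<lambda>_::'n. lborel :: real measure"
    by (rule product_sigma_finite_lborel)
  have "emeasure (lborelP J) (Pi\<^sub>E J (\<lambda>i. if i = j then {0} else UNIV)) =
      (\<Prod>i\<in>J. emeasure lborel (if i = j then {0} else UNIV :: real set))"
    using J by (intro emeasure_PiM) auto
  also have "\<dots> = 0" using J by (intro prod_zero) (auto intro!: bexI[of _ j])
  finally have "Pi\<^sub>E J (\<lambda>i. if i = j then {0} else UNIV) \<in> null_sets (lborelP J)"
    using J by (auto intro!: null_setsI sets_PiM_I_finite)
  then show ?thesis
    by (rule AE_I') (use J in \<open>auto simp: space_PiM PiE_iff extensional_def split: if_splits\<close>)
qed

lemma sets_surface_measure [measurable_cong, simp]: "sets (surface_measure J) = sets (lborelP J)"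
  by (simp add: surface_measure_def)

lemma sets_dunkl_surface_measure [measurable_cong, simp]:
  "sets (dunkl_surface_measure blk k i) = sets (lborelP (block blk i))"
  by (simp add: dunkl_surface_measure_def)

lemma nn_integral_surface_measure:
  assumes [measurable]: "G \<in> borel_measurable (lborelP J)"
  shows "(\<integral>\<^sup>+\<omega>. G \<omega> \<partial>surface_measure J) =
    (\<integral>\<^sup>+x. of_nat (card J) * indicator {y. 0 < L2_set y J \<and> L2_set y J \<le> 1} x *
       G (\<lambda>j\<in>J. x j / L2_set x J) \<partial>lborelP J)"
  unfolding surface_measure_def
  by (simp add: nn_integral_distr nn_integral_density ennreal_of_nat_eq_real_of_nat)

lemma nn_integral_powr_tail:
  assumes "0 < a" "0 < n"
  shows "(\<integral>\<^sup>+s. ennreal (n * s powr (- n - 1)) * indicator {a..} s \<partial>lborel) = ennreal (a powr (- n))"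
proof -
  have "((\<lambda>s. - (s powr (- n))) \<longlongrightarrow> - 0) at_top"
    using assms by (intro tendsto_minus tendsto_neg_powr filterlim_ident) auto
  then have "(\<integral>\<^sup>+s. ennreal (n * s powr (- n - 1)) * indicator {a..} s \<partial>lborel) =
      ennreal (0 - - (a powr (- n)))"
    using assms
    by (intro nn_integral_FTC_atLeast) (auto intro!: derivative_eq_intros)
  then show ?thesis by simp
qed

text \<open>
  The cone definition of \<open>\<sigma>\<close> makes the right-hand side an integral over \<open>\<rho> > 0\<close> and \<open>0 < |x| \<le> 1\<close>.
  Substituting \<open>\<rho> = |x| s\<close> and then \<open>y = s x\<close>, the factor in front of \<open>F y\<close> becomes
  \<open>\<integral>\<^bsub>|y|\<^esub>\<^sup>\<infinity> n |y|\<^sup>n s\<^sup>-\<^sup>n\<^sup>-\<^sup>1 ds = 1\<close>.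
\<close>

lemma nn_integral_polar:
  fixes F :: "('n \<Rightarrow> real) \<Rightarrow> ennreal"
  assumes J: "finite J" "J \<noteq> {}" and F [measurable]: "F \<in> borel_measurable (lborelP J)"
  shows "(\<integral>\<^sup>+\<rho>. ennreal (\<rho> powr (real (card J) - 1)) * indicator {0<..} \<rho> *
      (\<integral>\<^sup>+\<omega>. F (\<lambda>j\<in>J. \<rho> * \<omega> j) \<partial>surface_measure J) \<partial>lborel) = (\<integral>\<^sup>+x. F x \<partial>lborelP J)"
proof -
  define n where "n = real (card J)"
  have n: "n > 0" using J by (simp add: n_def card_gt_0_iff)
  define U where "U = {y :: 'n \<Rightarrow> real. 0 < L2_set y J \<and> L2_set y J \<le> 1}"
  have [measurable]: "Measurable.pred (lborelP J) (\<lambda>y. y \<in> U)"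
    unfolding U_def by measurable
  interpret PJ: sigma_finite_measure "lborelP J" by (rule sigma_finite_lborelP) fact
  interpret pair_sigma_finite lborel "lborelP J" ..
  have card: "of_nat (card J) = ennreal n"
    by (simp add: n_def ennreal_of_nat_eq_real_of_nat)
  have "(\<integral>\<^sup>+\<rho>. ennreal (\<rho> powr (n - 1)) * indicator {0<..} \<rho> *
      (\<integral>\<^sup>+\<omega>. F (\<lambda>j\<in>J. \<rho> * \<omega> j) \<partial>surface_measure J) \<partial>lborel) =
    (\<integral>\<^sup>+\<rho>. (\<integral>\<^sup>+x. ennreal (\<rho> powr (n - 1)) * indicator {0<..} \<rho> *
      (ennreal n * indicator U x * F (\<lambda>j\<in>J. \<rho> * (x j / L2_set x J))) \<partial>lborelP J) \<partial>lborel)"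
    by (intro nn_integral_cong)
      (simp add: nn_integral_surface_measure card nn_integral_cmult U_def cong: restrict_cong)
  also have "\<dots> = (\<integral>\<^sup>+x. (\<integral>\<^sup>+\<rho>. ennreal (\<rho> powr (n - 1)) * indicator {0<..} \<rho> *
      (ennreal n * indicator U x * F (\<lambda>j\<in>J. \<rho> * (x j / L2_set x J))) \<partial>lborel) \<partial>lborelP J)"
    by (subst Fubini') auto
  also have "\<dots> = (\<integral>\<^sup>+x. (\<integral>\<^sup>+s. ennreal (s powr (n - 1)) * indicator {0<..} s *
      (ennreal n * indicator U x * ennreal (L2_set x J powr n) * F (\<lambda>j\<in>J. s * x j)) \<partial>lborel) \<partial>lborelP J)"
  proof (rule nn_integral_cong)
    fix x assume [simp]: "x \<in> space (lborelP J)"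
    show "(\<integral>\<^sup>+\<rho>. ennreal (\<rho> powr (n - 1)) * indicator {0<..} \<rho> *
          (ennreal n * indicator U x * F (\<lambda>j\<in>J. \<rho> * (x j / L2_set x J))) \<partial>lborel) =
        (\<integral>\<^sup>+s. ennreal (s powr (n - 1)) * indicator {0<..} s *
          (ennreal n * indicator U x * ennreal (L2_set x J powr n) * F (\<lambda>j\<in>J. s * x j)) \<partial>lborel)"
    proof (cases "x \<in> U")
      case True
      define a where "a = L2_set x J"
      have a: "a > 0" using True by (simp add: U_def a_def)
      have "(\<integral>\<^sup>+\<rho>. ennreal (\<rho> powr (n - 1)) * indicator {0<..} \<rho> *
          (ennreal n * indicator U x * F (\<lambda>j\<in>J. \<rho> * (x j / L2_set x J))) \<partial>lborel) =
          ennreal \<bar>a\<bar> * (\<integral>\<^sup>+s. ennreal ((0 + a * s) powr (n - 1)) * indicator {0<..} (0 + a * s) *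
          (ennreal n * indicator U x * F (\<lambda>j\<in>J. (0 + a * s) * (x j / L2_set x J))) \<partial>lborel)"
        using a by (intro nn_integral_real_affine) auto
      also have "\<dots> = (\<integral>\<^sup>+s. ennreal a * (ennreal ((0 + a * s) powr (n - 1)) * indicator {0<..} (0 + a * s) *
          (ennreal n * indicator U x * F (\<lambda>j\<in>J. (0 + a * s) * (x j / L2_set x J)))) \<partial>lborel)"
        using a by (subst nn_integral_cmult) auto
      also have "\<dots> = (\<integral>\<^sup>+s. ennreal (s powr (n - 1)) * indicator {0<..} s *
          (ennreal n * indicator U x * ennreal (L2_set x J powr n) * F (\<lambda>j\<in>J. s * x j)) \<partial>lborel)"
      proof (rule nn_integral_cong)
        fix s
        have "a * (a * s) powr (n - 1) = s powr (n - 1) * a powr n" if "s > 0"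
          using that a by (simp add: powr_mult powr_diff)
        then have *: "ennreal a * ennreal ((a * s) powr (n - 1)) = ennreal (s powr (n - 1)) * ennreal (a powr n)" if "s > 0"
          using that a by (simp flip: ennreal_mult)
        have F: "F (\<lambda>j\<in>J. a * s * (x j / a)) = F (\<lambda>j\<in>J. s * x j)"
          using a by (intro arg_cong[where f=F]) (auto simp: fun_eq_iff)
        show "ennreal a * (ennreal ((0 + a * s) powr (n - 1)) * indicator {0<..} (0 + a * s) *
          (ennreal n * indicator U x * F (\<lambda>j\<in>J. (0 + a * s) * (x j / L2_set x J)))) =
          ennreal (s powr (n - 1)) * indicator {0<..} s *
          (ennreal n * indicator U x * ennreal (L2_set x J powr n) * F (\<lambda>j\<in>J. s * x j))"
          using a * F by (auto simp: a_def[symmetric] indicator_def zero_less_mult_iff mult_ac)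
            (metis mult.assoc mult.commute)
      qed
      finally show ?thesis .
    qed simp
  qed
  also have "\<dots> = (\<integral>\<^sup>+s. (\<integral>\<^sup>+x. ennreal (s powr (n - 1)) * indicator {0<..} s *
      (ennreal n * indicator U x * ennreal (L2_set x J powr n) * F (\<lambda>j\<in>J. s * x j)) \<partial>lborelP J) \<partial>lborel)"
    by (subst Fubini') auto
  also have "\<dots> = (\<integral>\<^sup>+s. (\<integral>\<^sup>+y. ennreal (n * s powr (- n - 1)) * indicator {0<..} s *
      indicator {0<..s} (L2_set y J) * ennreal (L2_set y J powr n) * F y \<partial>lborelP J) \<partial>lborel)"
  proof (rule nn_integral_cong)
    fix s :: real
    show "(\<integral>\<^sup>+x. ennreal (s powr (n - 1)) * indicator {0<..} s *
      (ennreal n * indicator U x * ennreal (L2_set x J powr n) * F (\<lambda>j\<in>J. s * x j)) \<partial>lborelP J) =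
      (\<integral>\<^sup>+y. ennreal (n * s powr (- n - 1)) * indicator {0<..} s *
      indicator {0<..s} (L2_set y J) * ennreal (L2_set y J powr n) * F y \<partial>lborelP J)"
    proof (cases "s > 0")
      case True
      have "(\<integral>\<^sup>+y. ennreal (n * s powr (- n - 1)) * indicator {0<..} s *
          indicator {0<..s} (L2_set y J) * ennreal (L2_set y J powr n) * F y \<partial>lborelP J) =
        ennreal (s powr card J) * (\<integral>\<^sup>+x. ennreal (n * s powr (- n - 1)) * indicator {0<..} s *
          indicator {0<..s} (L2_set (\<lambda>j\<in>J. s * x j) J) * ennreal (L2_set (\<lambda>j\<in>J. s * x j) J powr n) *
          F (\<lambda>j\<in>J. s * x j) \<partial>lborelP J)"
        using True J by (intro nn_integral_lborelP_scale) auto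
      also have "\<dots> = (\<integral>\<^sup>+x. ennreal (s powr card J) * (ennreal (n * s powr (- n - 1)) * indicator {0<..} s *
          indicator {0<..s} (L2_set (\<lambda>j\<in>J. s * x j) J) * ennreal (L2_set (\<lambda>j\<in>J. s * x j) J powr n) *
          F (\<lambda>j\<in>J. s * x j)) \<partial>lborelP J)"
        by (subst nn_integral_cmult) auto
      also have "\<dots> = (\<integral>\<^sup>+x. ennreal (s powr (n - 1)) * indicator {0<..} s *
          (ennreal n * indicator U x * ennreal (L2_set x J powr n) * F (\<lambda>j\<in>J. s * x j)) \<partial>lborelP J)"
      proof (rule nn_integral_cong)
        fix x :: "'n \<Rightarrow> real"
        define a where "a = L2_set x J"
        have a: "a \<ge> 0" by (simp add: a_def L2_set_nonneg)
        have "s powr n * (n * s powr (- n - 1)) * (s * a) powr n = s powr (n - 1) * (n * a powr n)"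
          using True a by (simp add: powr_mult powr_diff powr_minus field_simps)
        then have *: "ennreal (s powr n) * ennreal (n * s powr (- n - 1)) * ennreal ((s * a) powr n) =
            ennreal (s powr (n - 1)) * (ennreal n * ennreal (a powr n))"
          using n by (simp flip: ennreal_mult)
        have ind: "indicator {0<..s} (s * a) = (indicator U x :: ennreal)"
          using True by (auto simp: U_def indicator_def a_def zero_less_mult_iff)
        have L: "L2_set (\<lambda>j\<in>J. s * x j) J = s * a"
          using True by (simp add: a_def L2_set_scale)
        have "ennreal (s powr card J) * (ennreal (n * s powr (- n - 1)) * indicator {0<..} s *
            indicator {0<..s} (L2_set (\<lambda>j\<in>J. s * x j) J) * ennreal (L2_set (\<lambda>j\<in>J. s * x j) J powr n) *
            F (\<lambda>j\<in>J. s * x j)) =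
            (ennreal (s powr n) * ennreal (n * s powr (- n - 1)) * ennreal ((s * a) powr n)) *
            (indicator U x * indicator {0<..} s * F (\<lambda>j\<in>J. s * x j))"
          unfolding L ind by (simp add: n_def mult_ac)
        also have "\<dots> = ennreal (s powr (n - 1)) * indicator {0<..} s *
          (ennreal n * indicator U x * ennreal (a powr n) * F (\<lambda>j\<in>J. s * x j))"
          unfolding * by (simp add: mult_ac)
        finally show "ennreal (s powr card J) * (ennreal (n * s powr (- n - 1)) * indicator {0<..} s *
            indicator {0<..s} (L2_set (\<lambda>j\<in>J. s * x j) J) * ennreal (L2_set (\<lambda>j\<in>J. s * x j) J powr n) *
            F (\<lambda>j\<in>J. s * x j)) = ennreal (s powr (n - 1)) * indicator {0<..} s *
          (ennreal n * indicator U x * ennreal (L2_set x J powr n) * F (\<lambda>j\<in>J. s * x j))"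
          by (simp add: a_def)
      qed
      finally show ?thesis ..
    qed simp
  qed
  also have "\<dots> = (\<integral>\<^sup>+y. (\<integral>\<^sup>+s. ennreal (n * s powr (- n - 1)) * indicator {0<..} s *
      indicator {0<..s} (L2_set y J) * ennreal (L2_set y J powr n) * F y \<partial>lborel) \<partial>lborelP J)"
  proof (rule Fubini'[symmetric])
    \<comment> \<open>The interval moves with \<open>s\<close>; written as two inequalities its
      indicator is jointly measurable.\<close>
    have "(\<lambda>x. indicator {0<..fst x} (L2_set (snd x) J) :: ennreal) =
        (\<lambda>x. if 0 < L2_set (snd x) J \<and> L2_set (snd x) J \<le> fst x then 1 else 0)"
      by (auto simp: indicator_def)
    then have [measurable]: "(\<lambda>x. indicator {0<..fst x} (L2_set (snd x) J) :: ennreal)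
        \<in> borel_measurable (lborel \<Otimes>\<^sub>M lborelP J)"
      by simp
    show "(\<lambda>(s, y). ennreal (n * s powr (- n - 1)) * indicator {0<..} s *
      indicator {0<..s} (L2_set y J) * ennreal (L2_set y J powr n) * F y) \<in>
        borel_measurable (lborel \<Otimes>\<^sub>M lborelP J)"
      unfolding split_beta by measurable
  qed
  also have "\<dots> = (\<integral>\<^sup>+y. F y \<partial>lborelP J)"
  proof (rule nn_integral_cong_AE)
    obtain j where j: "j \<in> J" using J by auto
    show "AE y in lborelP J. (\<integral>\<^sup>+s. ennreal (n * s powr (- n - 1)) * indicator {0<..} s *
      indicator {0<..s} (L2_set y J) * ennreal (L2_set y J powr n) * F y \<partial>lborel) = F y"
      using AE_lborelP_component_nonzero[OF J(1) j]
    proof eventually_elim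
      case (elim y)
      define a where "a = L2_set y J"
      have "a \<noteq> 0" using elim j J by (simp add: a_def L2_set_eq_0_iff) blast
      then have a: "a > 0" using L2_set_nonneg[of y J] by (simp add: a_def less_le)
      have "(\<integral>\<^sup>+s. ennreal (n * s powr (- n - 1)) * indicator {0<..} s *
          indicator {0<..s} (L2_set y J) * ennreal (L2_set y J powr n) * F y \<partial>lborel) =
          (\<integral>\<^sup>+s. ennreal (n * s powr (- n - 1)) * indicator {a..} s * (ennreal (a powr n) * F y) \<partial>lborel)"
        using a by (intro nn_integral_cong) (auto simp: a_def[symmetric] indicator_def mult_ac)
      also have "\<dots> = ennreal (a powr (- n)) * (ennreal (a powr n) * F y)"
        using a n by (subst nn_integral_multc) (auto simp: nn_integral_powr_tail)
      also have "\<dots> = ennreal (a powr (- n) * a powr n) * F y"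
        by (simp add: ennreal_mult mult_ac)
      also have "a powr (- n) * a powr n = 1"
        using a by (simp add: powr_minus)
      finally show ?case by simp
    qed
  qed
  finally show ?thesis by (simp add: n_def)
qed

lemma AE_surface_measure:
  fixes J :: "'n set"
  assumes "finite J"
  shows "AE \<omega> in surface_measure J. L2_set \<omega> J = 1"
proof -
  have "L2_set (\<lambda>j\<in>J. x j / L2_set x J) J = 1" if "0 < L2_set x J" for x :: "'n \<Rightarrow> real"
    using L2_set_scale[of "1 / L2_set x J" x J] that by simp
  then show ?thesis
    unfolding surface_measure_def by (subst AE_distr_iff) (auto simp: AE_density indicator_def intro!: AE_I2)
qed

lemma L2_set_component_le: "finite J \<Longrightarrow> j \<in> J \<Longrightarrow> \<bar>x j\<bar> \<le> L2_set x J"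
  using member_le_L2_set[of J j "\<lambda>i. \<bar>x i\<bar>"] by (simp add: L2_set_def)

text \<open>The punctured unit ball behind the cone construction lies in the cube with sides
  \<open>{-1..1}\<close>.\<close>

lemma emeasure_surface_measure_finite:
  assumes "finite (J :: 'n set)"
  shows "emeasure (surface_measure J) (space (surface_measure J)) < \<infinity>"
proof -
  interpret product_sigma_finite "\<lambda>_::'n. lborel :: real measure"
    by (rule product_sigma_finite_lborel)
  let ?B = "Pi\<^sub>E J (\<lambda>_. {-1..1::real})"
  have [measurable]: "?B \<in> sets (lborelP J)"
    using assms by (intro sets_PiM_I_finite) auto
  have "emeasure (surface_measure J) (space (surface_measure J)) = (\<integral>\<^sup>+\<omega>. 1 \<partial>surface_measure J)"
    by simp
  also have "\<dots> \<le> (\<integral>\<^sup>+x. of_nat (card J) * indicator ?B x \<partial>lborelP J)"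
  proof (subst nn_integral_surface_measure)
    show "(\<integral>\<^sup>+x. of_nat (card J) * indicator {y. 0 < L2_set y J \<and> L2_set y J \<le> 1} x * 1 \<partial>lborelP J) \<le>
        (\<integral>\<^sup>+x. of_nat (card J) * indicator ?B x \<partial>lborelP J)"
    proof (rule nn_integral_mono)
      fix x assume x: "x \<in> space (lborelP J)"
      have "x \<in> ?B" if "L2_set x J \<le> 1"
        using that x order_trans[OF L2_set_component_le[OF assms] that]
        by (auto simp: space_PiM PiE_iff abs_le_iff)
      then show "of_nat (card J) * indicator {y. 0 < L2_set y J \<and> L2_set y J \<le> 1} x * 1 \<le>
          (of_nat (card J) * indicator ?B x :: ennreal)"
        by (auto simp: indicator_def)
    qed
  qed simp
  also have "\<dots> = of_nat (card J) * (\<Prod>i\<in>J. emeasure lborel {-1..1::real})"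
    using assms by (simp add: nn_integral_cmult emeasure_PiM)
  also have "\<dots> < \<infinity>"
    by (simp add: ennreal_mult_less_top of_nat_less_top power_less_top_ennreal)
  finally show ?thesis .
qed

lemma AE_dunkl_surface_measure:
  fixes blk :: "'n::finite \<Rightarrow> nat"
  shows "AE \<omega> in dunkl_surface_measure blk k i. L2_set \<omega> (block blk i) = 1"
  using AE_surface_measure[of "block blk i"]
  unfolding dunkl_surface_measure_def by (subst AE_density) auto

text \<open>Coordinates on the unit sphere are at most 1 in modulus, so with nonnegative
  \<open>k\<close> the weight only decreases the surface measure.\<close>

lemma finite_dunkl_surface_measure:
  fixes blk :: "'n::finite \<Rightarrow> nat" and k :: "real ^ 'n"
  assumes k: "\<And>j. 0 \<le> k $ j"
  shows "finite_measure (dunkl_surface_measure blk k i)"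
proof (rule finite_measureI)
  let ?J = "block blk i"
  have "emeasure (dunkl_surface_measure blk k i) (space (dunkl_surface_measure blk k i)) =
      (\<integral>\<^sup>+\<omega>. 1 \<partial>dunkl_surface_measure blk k i)"
    by simp
  also have "\<dots> = (\<integral>\<^sup>+\<omega>. ennreal (\<Prod>v\<in>?J. \<bar>\<omega> v\<bar> powr (2 * k $ v)) \<partial>surface_measure ?J)"
    unfolding dunkl_surface_measure_def by (subst nn_integral_density) auto
  also have "\<dots> \<le> (\<integral>\<^sup>+\<omega>. 1 \<partial>surface_measure ?J)"
  proof (rule nn_integral_mono_AE)
    show "AE \<omega> in surface_measure ?J. ennreal (\<Prod>v\<in>?J. \<bar>\<omega> v\<bar> powr (2 * k $ v)) \<le> 1"
      using AE_surface_measure[of ?J, OF finite]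
    proof eventually_elim
      case (elim \<omega>)
      have "\<bar>\<omega> v\<bar> \<le> 1" if "v \<in> ?J" for v
        using L2_set_component_le[of ?J v \<omega>] that elim by simp
      then have "(\<Prod>v\<in>?J. \<bar>\<omega> v\<bar> powr (2 * k $ v)) \<le> 1"
        using k by (intro prod_le_1 conjI powr_le1) auto
      then show ?case by simp
    qed
  qed
  also have "\<dots> < \<infinity>"
    using emeasure_surface_measure_finite[of ?J] by simp
  finally show "emeasure (dunkl_surface_measure blk k i) (space (dunkl_surface_measure blk k i)) \<noteq> \<infinity>"
    by simp
qed

text \<open>The weight is homogeneous of degree twice the sum of \<open>k\<close> over the block;
  pulling out that power of \<open>\<rho>\<close> turns the radial exponent
  \<open>card J - 1\<close> into \<open>block_dim blk k i - 1\<close>.\<close>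

lemma nn_integral_dunkl_polar:
  fixes blk :: "'n::finite \<Rightarrow> nat" and F :: "('n \<Rightarrow> real) \<Rightarrow> ennreal"
  assumes J: "J = block blk i" "J \<noteq> {}" and F [measurable]: "F \<in> borel_measurable (lborelP J)"
  shows "(\<integral>\<^sup>+\<rho>. ennreal (\<rho> powr (block_dim blk k i - 1)) * indicator {0<..} \<rho> *
      (\<integral>\<^sup>+\<omega>. F (\<lambda>j\<in>J. \<rho> * \<omega> j) \<partial>dunkl_surface_measure blk k i) \<partial>lborel) =
    (\<integral>\<^sup>+x. ennreal (\<Prod>v\<in>J. \<bar>x v\<bar> powr (2 * k $ v)) * F x \<partial>lborelP J)"
proof -
  let ?w = "\<lambda>x :: 'n \<Rightarrow> real. \<Prod>v\<in>J. \<bar>x v\<bar> powr (2 * k $ v)"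
  have [measurable]: "?w \<in> borel_measurable (lborelP J)"
    by (rule borel_measurable_prod) measurable
  have "(\<integral>\<^sup>+\<rho>. ennreal (\<rho> powr (block_dim blk k i - 1)) * indicator {0<..} \<rho> *
      (\<integral>\<^sup>+\<omega>. F (\<lambda>j\<in>J. \<rho> * \<omega> j) \<partial>dunkl_surface_measure blk k i) \<partial>lborel) =
    (\<integral>\<^sup>+\<rho>. ennreal (\<rho> powr (real (card J) - 1)) * indicator {0<..} \<rho> *
      (\<integral>\<^sup>+\<omega>. ennreal (?w (\<lambda>j\<in>J. \<rho> * \<omega> j)) * F (\<lambda>j\<in>J. \<rho> * \<omega> j) \<partial>surface_measure J) \<partial>lborel)"
  proof (rule nn_integral_cong)
    fix \<rho> :: real
    show "ennreal (\<rho> powr (block_dim blk k i - 1)) * indicator {0<..} \<rho> *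
        (\<integral>\<^sup>+\<omega>. F (\<lambda>j\<in>J. \<rho> * \<omega> j) \<partial>dunkl_surface_measure blk k i) =
      ennreal (\<rho> powr (real (card J) - 1)) * indicator {0<..} \<rho> *
        (\<integral>\<^sup>+\<omega>. ennreal (?w (\<lambda>j\<in>J. \<rho> * \<omega> j)) * F (\<lambda>j\<in>J. \<rho> * \<omega> j) \<partial>surface_measure J)"
    proof (cases "\<rho> > 0")
      case True
      let ?K = "2 * (\<Sum>v\<in>J. k $ v)"
      have w: "?w (\<lambda>j\<in>J. \<rho> * \<omega> j) = \<rho> powr ?K * ?w \<omega>" for \<omega>
        using True by (simp add: abs_mult powr_mult prod.distrib powr_sum sum_distrib_left cong: prod.cong)
      have "(\<integral>\<^sup>+\<omega>. ennreal (?w (\<lambda>j\<in>J. \<rho> * \<omega> j)) * F (\<lambda>j\<in>J. \<rho> * \<omega> j) \<partial>surface_measure J) =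
          ennreal (\<rho> powr ?K) * (\<integral>\<^sup>+\<omega>. ennreal (?w \<omega>) * F (\<lambda>j\<in>J. \<rho> * \<omega> j) \<partial>surface_measure J)"
        unfolding w by (subst nn_integral_cmult[symmetric]) (auto simp: ennreal_mult prod_nonneg mult.assoc)
      also have "(\<integral>\<^sup>+\<omega>. ennreal (?w \<omega>) * F (\<lambda>j\<in>J. \<rho> * \<omega> j) \<partial>surface_measure J) =
          (\<integral>\<^sup>+\<omega>. F (\<lambda>j\<in>J. \<rho> * \<omega> j) \<partial>dunkl_surface_measure blk k i)"
        unfolding dunkl_surface_measure_def J(1)[symmetric] by (subst nn_integral_density) auto
      moreover have "ennreal (\<rho> powr (real (card J) - 1)) * ennreal (\<rho> powr ?K) =
          ennreal (\<rho> powr (block_dim blk k i - 1))"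
        unfolding block_dim_def J(1)[symmetric]
        by (simp flip: ennreal_mult powr_add add: algebra_simps)
      ultimately show ?thesis using True by (simp add: mult.assoc[symmetric])
    qed simp
  qed
  also have "\<dots> = (\<integral>\<^sup>+x. ennreal (?w x) * F x \<partial>lborelP J)"
    using J(2) by (intro nn_integral_polar) auto
  finally show ?thesis .
qed

section \<open>Lebesgue measure on vectors as a product measure\<close>

lemma measurable_vecI:
  fixes f :: "'a \<Rightarrow> real ^ 'n::finite"
  assumes "\<And>j. (\<lambda>x. f x $ j) \<in> borel_measurable M"
  shows "f \<in> borel_measurable M"
  using assms by (subst borel_measurable_euclidean_space) (auto simp: Basis_vec_def inner_axis)

lemma measurable_vec_nth [measurable (raw)]:
  fixes f :: "'a \<Rightarrow> real ^ 'n::finite"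
  assumes "f \<in> borel_measurable M"
  shows "(\<lambda>x. f x $ j) \<in> borel_measurable M"
  using borel_measurable_inner[OF assms, of "\<lambda>_. axis j 1"] by (simp add: inner_axis)

lemma measurable_vec_lambda_lborelP: "(\<lambda>y. \<chi> j. y j) \<in> measurable (lborelP (UNIV :: 'n::finite set)) borel"
  by (rule measurable_vecI) simp

lemma lborel_eq_distr_lborelP:
  "(lborel :: (real ^ 'n::finite) measure) = distr (lborelP UNIV) borel (\<lambda>y. \<chi> j. y j)"
proof (rule lborel_eqI)
  interpret product_sigma_finite "\<lambda>_::'n. lborel :: real measure"
    by (rule product_sigma_finite_lborel)
  fix l u :: "real ^ 'n" assume lu: "\<And>b. b \<in> Basis \<Longrightarrow> l \<bullet> b \<le> u \<bullet> b"
  have le: "l $ j \<le> u $ j" for j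
    using lu[of "axis j 1"] by (auto simp: inner_axis Basis_vec_def)
  have eq: "(\<lambda>y. \<chi> j. y j) -` box l u \<inter> space (lborelP UNIV) = Pi\<^sub>E UNIV (\<lambda>j. {l $ j <..< u $ j})"
    by (auto simp: mem_box_cart space_PiM PiE_iff)
  have "emeasure (distr (lborelP UNIV) borel (\<lambda>y. \<chi> j. y j)) (box l u) = (\<Prod>j\<in>UNIV. emeasure lborel {l $ j <..< u $ j})"
    by (subst emeasure_distr) (auto simp: measurable_vec_lambda_lborelP eq emeasure_PiM simp del: emeasure_lborel_Ioo)
  also have "\<dots> = ennreal (\<Prod>j\<in>UNIV. u $ j - l $ j)"
    using le by (simp add: prod_ennreal)
  also have "(\<Prod>j\<in>UNIV. u $ j - l $ j) = (\<Prod>b\<in>Basis. (u - l) \<bullet> b)"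
    unfolding Basis_vec_def
    by (subst prod.UNION_disjoint) (auto simp: inner_axis axis_eq_axis)
  finally show "emeasure (distr (lborelP UNIV) borel (\<lambda>y. \<chi> j. y j)) (box l u) = (\<Prod>b\<in>Basis. (u - l) \<bullet> b)" .
qed simp

lemma nn_integral_lborel_vec:
  fixes F :: "real ^ 'n::finite \<Rightarrow> ennreal"
  assumes [measurable]: "F \<in> borel_measurable borel"
  shows "(\<integral>\<^sup>+x. F x \<partial>lborel) = (\<integral>\<^sup>+y. F (\<chi> j. y j) \<partial>lborelP UNIV)"
  by (subst lborel_eq_distr_lborelP) (simp add: nn_integral_distr measurable_vec_lambda_lborelP)

lemma AE_lborel_component_nonzero: "AE x in lborel. (x :: real ^ 'n::finite) $ j \<noteq> 0"
proof (subst lborel_eq_distr_lborelP, subst AE_distr_iff)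
  show "AE y in lborelP UNIV. (\<chi> j. y j) $ j \<noteq> 0"
    using AE_lborelP_component_nonzero[of UNIV j] by simp
qed (auto intro: measurable_vec_lambda_lborelP)

section \<open>The norm in one block of variables\<close>

lemma measurable_replace_block [measurable (raw)]:
  fixes f :: "'a \<Rightarrow> real ^ 'n::finite"
  assumes f [measurable]: "f \<in> borel_measurable M" and r [measurable]: "r \<in> borel_measurable M"
    and w: "w \<in> measurable M (lborelP (block blk i))"
  shows "(\<lambda>t. replace_block blk i (f t) (r t) (w t)) \<in> borel_measurable M"
proof (rule measurable_vecI)
  fix j
  show "(\<lambda>t. replace_block blk i (f t) (r t) (w t) $ j) \<in> borel_measurable M"
  proof (cases "blk j = i")
    case True
    then have [measurable]: "(\<lambda>t. w t j) \<in> borel_measurable M"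
      using measurable_compose[OF w measurable_component_singleton[of j "block blk i"]]
      by (simp add: block_def)
    show ?thesis using True by (simp add: replace_block_def)
  qed (simp add: replace_block_def)
qed

text \<open>The recursion of \<open>iterated_norm\<close> started from a
  \<open>[0, top]\<close>-valued function, so that products, integrals over a parameter and the
  value \<open>top\<close> can be fed in.\<close>

primrec inorm ::
    "('n::finite \<Rightarrow> nat) \<Rightarrow> real ^ 'n \<Rightarrow> (nat \<Rightarrow> real) \<Rightarrow> (nat \<Rightarrow> real) \<Rightarrow>
     (real ^ 'n \<Rightarrow> ennreal) \<Rightarrow> nat \<Rightarrow> real ^ 'n \<Rightarrow> ennreal" where
  "inorm blk k u w F 0 = F"
| "inorm blk k u w F (Suc i) = block_norm blk k (Suc i) (u (Suc i)) (w (Suc i)) (inorm blk k u w F i)"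

lemma iterated_norm_eq_inorm:
  "iterated_norm blk k u w f i = inorm blk k u w (\<lambda>x. ennreal (norm (f x))) i"
  by (induction i) auto

lemma block_norm_mono:
  assumes "0 < u" "0 < w" "\<And>x. f x \<le> g x"
  shows "block_norm blk k i u w f x \<le> block_norm blk k i u w g x"
  unfolding block_norm_def using assms
  by (intro enn_powr_mono nn_integral_mono mult_mono) auto

section \<open>The one-block norm on Borel functions\<close>

locale dunkl_blocks =
  fixes blk :: "'n::finite \<Rightarrow> nat" and k :: "real ^ 'n" and m :: nat
  assumes blk: "range blk = {1..m}" and k_nonneg: "\<And>j. 0 \<le> k $ j"
begin

abbreviation "ang i \<equiv> dunkl_surface_measure blk k i"
abbreviation "bdim i \<equiv> block_dim blk k i"

text \<open>Radial weight and domain are absorbed into a measure, so that a block norm becomes an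
  \<open>lp\<close> norm of \<open>lp\<close> norms and inherits their inequalities.\<close>

definition rad :: "nat \<Rightarrow> real measure" where
  "rad i = density lborel (\<lambda>\<rho>. ennreal (\<rho> powr (bdim i - 1)) * indicator {0<..} \<rho>)"

lemma sets_rad [measurable_cong, simp]: "sets (rad i) = sets borel"
  by (simp add: rad_def)

lemma sigma_finite_rad: "sigma_finite_measure (rad i)"
  unfolding rad_def
  by (subst sigma_finite_measure.sigma_finite_iff_density_finite[OF sigma_finite_lborel]) (auto simp: indicator_def)

lemma sigma_finite_ang: "sigma_finite_measure (ang i)"
  using finite_dunkl_surface_measure[OF k_nonneg] by (rule finite_measure.axioms)

lemma nn_integral_rad:
  "H \<in> borel_measurable borel \<Longrightarrow>
    (\<integral>\<^sup>+\<rho>. H \<rho> \<partial>rad i) = (\<integral>\<^sup>+\<rho>. H \<rho> * ennreal (\<rho> powr (bdim i - 1)) * indicator {0<..} \<rho> \<partial>lborel)"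
  unfolding rad_def by (simp add: nn_integral_density mult_ac)

lemma block_nonempty: "i \<in> {1..m} \<Longrightarrow> block blk i \<noteq> {}"
  unfolding blk[symmetric] by (auto simp: block_def)

text \<open>Makes the exponent of the radial weight nonnegative, hence that weight bounded near the
  origin.\<close>

lemma bdim_ge_1: "i \<in> {1..m} \<Longrightarrow> 1 \<le> bdim i"
proof -
  assume "i \<in> {1..m}"
  then have "1 \<le> card (block blk i)"
    using block_nonempty[of i] by (simp add: Suc_le_eq card_gt_0_iff)
  then show ?thesis
    using k_nonneg by (simp add: block_dim_def add_increasing2 sum_nonneg)
qed

lemma measurable_ang_slice:
  assumes [measurable]: "g \<in> borel_measurable borel"
  shows "(\<lambda>\<omega>. g (replace_block blk i x \<rho> \<omega>)) \<in> borel_measurable (ang i)"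
  by measurable

lemma measurable_rad_slice:
  assumes [measurable]: "g \<in> borel_measurable borel"
  shows "(\<lambda>\<rho>. lp (ang i) w (\<lambda>\<omega>. g (replace_block blk i x \<rho> \<omega>))) \<in> borel_measurable borel"
  by (rule measurable_lp[OF sigma_finite_ang]) measurable

text \<open>The exponent \<open>u / w\<close> combines the root \<open>1 / w\<close> of the inner
  norm with the power \<open>u\<close> of the outer one.\<close>

lemma block_norm_eq_lp:
  assumes g [measurable]: "g \<in> borel_measurable borel" and "0 < w"
  shows "block_norm blk k i u w g x =
    lp (rad i) u (\<lambda>\<rho>. lp (ang i) w (\<lambda>\<omega>. g (replace_block blk i x \<rho> \<omega>)))"
proof -
  interpret S: sigma_finite_measure "ang i" by (rule sigma_finite_ang)
  have [measurable]: "(\<lambda>\<rho>. enn_powr (lp (ang i) w (\<lambda>\<omega>. g (replace_block blk i x \<rho> \<omega>))) u) \<in> borel_measurable borel"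
    using measurable_rad_slice[OF g] by measurable
  show ?thesis
    unfolding lp_def[of "rad i"] block_norm_def
    by (subst nn_integral_rad) (auto simp: lp_def enn_powr_powr)
qed

text \<open>Joint measurability in \<open>t\<close> and \<open>x\<close> has to pass through every
  block, because Minkowski's inequality is applied again to the norms already taken of
  \<open>g t\<close>.\<close>

lemma measurable_block_norm_param:
  assumes [measurable]: "case_prod g \<in> borel_measurable (P \<Otimes>\<^sub>M borel)"
  shows "(\<lambda>(t, x). block_norm blk k i u w (g t) x) \<in> borel_measurable (P \<Otimes>\<^sub>M borel)"
proof -
  interpret S: sigma_finite_measure "ang i" by (rule sigma_finite_ang)
  show ?thesis unfolding block_norm_def split_beta by measurable
qed

lemma measurable_inorm_param:
  assumes "case_prod g \<in> borel_measurable (P \<Otimes>\<^sub>M borel)"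
  shows "(\<lambda>(t, x). inorm blk k u w (g t) i x) \<in> borel_measurable (P \<Otimes>\<^sub>M borel)"
proof (induction i)
  case (Suc i)
  show ?case using measurable_block_norm_param[OF Suc] by simp
qed (use assms in simp)

lemma measurable_inorm:
  assumes [measurable]: "g \<in> borel_measurable borel"
  shows "inorm blk k u w g i \<in> borel_measurable borel"
proof -
  \<comment> \<open>A dummy parameter reduces the claim to the parametrised version.\<close>
  have "(\<lambda>(t :: real, x). g x) \<in> borel_measurable (borel \<Otimes>\<^sub>M borel)" by measurable
  from measurable_inorm_param[OF this] have
    "(\<lambda>(t :: real, x). inorm blk k u w g i x) \<in> borel_measurable (borel \<Otimes>\<^sub>M borel)" .
  from measurable_compose[OF measurable_Pair1'[of 0 borel borel] this] show ?thesis by simp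
qed

lemma block_norm_cmult:
  assumes g [measurable]: "g \<in> borel_measurable borel" and u: "0 < u" "0 < w"
  shows "block_norm blk k i u w (\<lambda>x. c * g x) x = c * block_norm blk k i u w g x"
  using u measurable_rad_slice[OF g]
  by (simp add: block_norm_eq_lp lp_cmult measurable_ang_slice)

lemma block_norm_Hoelder:
  assumes f [measurable]: "f \<in> borel_measurable borel" and g [measurable]: "g \<in> borel_measurable borel"
    and u: "0 < u" "0 < u1" "0 < u2" "1 / u = 1 / u1 + 1 / u2"
    and w: "0 < w" "0 < w1" "0 < w2" "1 / w = 1 / w1 + 1 / w2"
  shows "block_norm blk k i u w (\<lambda>x. f x * g x) x \<le>
    block_norm blk k i u1 w1 f x * block_norm blk k i u2 w2 g x"
proof -
  have "block_norm blk k i u w (\<lambda>x. f x * g x) x =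
      lp (rad i) u (\<lambda>\<rho>. lp (ang i) w (\<lambda>\<omega>. f (replace_block blk i x \<rho> \<omega>) * g (replace_block blk i x \<rho> \<omega>)))"
    using u w by (intro block_norm_eq_lp) auto
  also have "\<dots> \<le> lp (rad i) u (\<lambda>\<rho>. lp (ang i) w1 (\<lambda>\<omega>. f (replace_block blk i x \<rho> \<omega>)) *
      lp (ang i) w2 (\<lambda>\<omega>. g (replace_block blk i x \<rho> \<omega>)))"
    using u w by (intro lp_mono lp_Hoelder measurable_ang_slice) auto
  also have "\<dots> \<le> block_norm blk k i u1 w1 f x * block_norm blk k i u2 w2 g x"
    using u w measurable_rad_slice[OF f] measurable_rad_slice[OF g]
    by (subst (1 2) block_norm_eq_lp) (auto intro!: lp_Hoelder)
  finally show ?thesis .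
qed

lemma block_norm_Minkowski:
  assumes P: "sigma_finite_measure P"
    and F [measurable]: "case_prod F \<in> borel_measurable (P \<Otimes>\<^sub>M borel)" and u: "1 < u" "1 < w"
  shows "block_norm blk k i u w (\<lambda>x. \<integral>\<^sup>+t. F t x \<partial>P) x \<le> (\<integral>\<^sup>+t. block_norm blk k i u w (F t) x \<partial>P)"
proof -
  interpret P: sigma_finite_measure P by fact
  interpret S: sigma_finite_measure "ang i" by (rule sigma_finite_ang)
  have [measurable]: "(\<lambda>(t, \<rho>). lp (ang i) w (\<lambda>\<omega>. F t (replace_block blk i x \<rho> \<omega>))) \<in> borel_measurable (P \<Otimes>\<^sub>M borel)"
    unfolding lp_def split_beta by measurable
  have "block_norm blk k i u w (\<lambda>x. \<integral>\<^sup>+t. F t x \<partial>P) x =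
      lp (rad i) u (\<lambda>\<rho>. lp (ang i) w (\<lambda>\<omega>. \<integral>\<^sup>+t. F t (replace_block blk i x \<rho> \<omega>) \<partial>P))"
    using u by (intro block_norm_eq_lp) auto
  also have "\<dots> \<le> lp (rad i) u (\<lambda>\<rho>. \<integral>\<^sup>+t. lp (ang i) w (\<lambda>\<omega>. F t (replace_block blk i x \<rho> \<omega>)) \<partial>P)"
    using u P by (intro lp_mono lp_Minkowski_integral sigma_finite_ang) auto
  also have "\<dots> \<le> (\<integral>\<^sup>+t. lp (rad i) u (\<lambda>\<rho>. lp (ang i) w (\<lambda>\<omega>. F t (replace_block blk i x \<rho> \<omega>))) \<partial>P)"
    using u P by (intro lp_Minkowski_integral sigma_finite_rad) auto
  also have "\<dots> = (\<integral>\<^sup>+t. block_norm blk k i u w (F t) x \<partial>P)"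
    using u by (intro nn_integral_cong, subst block_norm_eq_lp) auto
  finally show ?thesis .
qed

text \<open>Only the radius is dilated; the angular variable is unchanged. Substituting
  \<open>c * \<rho>\<close> for \<open>\<rho>\<close> yields \<open>c powr bdim i\<close> under the
  root \<open>1 / u\<close>. The point of evaluation is scaled too, because the other blocks are
  still free variables.\<close>

lemma block_norm_scale:
  assumes g [measurable]: "g \<in> borel_measurable borel" and c: "0 < c" and u: "0 < u" "0 < w"
  shows "block_norm blk k i u w g (c *\<^sub>R x) =
    ennreal (c powr (bdim i / u)) * block_norm blk k i u w (\<lambda>x. g (c *\<^sub>R x)) x"
proof -
  define H where "H = (\<lambda>\<rho>. lp (ang i) w (\<lambda>\<omega>. g (replace_block blk i (c *\<^sub>R x) \<rho> \<omega>)))"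
  have [measurable]: "H \<in> borel_measurable borel"
    unfolding H_def by (rule measurable_rad_slice) fact
  have "c *\<^sub>R replace_block blk i x \<rho> \<omega> = replace_block blk i (c *\<^sub>R x) (c * \<rho>) \<omega>" for \<rho> \<omega>
    by (auto simp: replace_block_def vec_eq_iff)
  then have rhs: "block_norm blk k i u w (\<lambda>x. g (c *\<^sub>R x)) x = lp (rad i) u (\<lambda>\<rho>. H (c * \<rho>))"
    using u by (subst block_norm_eq_lp) (auto simp: H_def)
  have "(\<integral>\<^sup>+\<rho>. enn_powr (H \<rho>) u \<partial>rad i) =
      (\<integral>\<^sup>+\<rho>. enn_powr (H \<rho>) u * ennreal (\<rho> powr (bdim i - 1)) * indicator {0<..} \<rho> \<partial>lborel)"
    by (simp add: nn_integral_rad)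
  also have "\<dots> = ennreal \<bar>c\<bar> * (\<integral>\<^sup>+\<rho>. enn_powr (H (0 + c * \<rho>)) u * ennreal ((0 + c * \<rho>) powr (bdim i - 1)) *
      indicator {0<..} (0 + c * \<rho>) \<partial>lborel)"
    using c by (intro nn_integral_real_affine) auto
  also have "\<dots> = (\<integral>\<^sup>+\<rho>. ennreal (c powr bdim i) * (enn_powr (H (c * \<rho>)) u * ennreal (\<rho> powr (bdim i - 1)) *
      indicator {0<..} \<rho>) \<partial>lborel)"
  proof (subst nn_integral_cmult[symmetric], measurable, rule nn_integral_cong)
    fix \<rho> :: real
    show "ennreal \<bar>c\<bar> * (enn_powr (H (0 + c * \<rho>)) u * ennreal ((0 + c * \<rho>) powr (bdim i - 1)) *
        indicator {0<..} (0 + c * \<rho>)) =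
      ennreal (c powr bdim i) * (enn_powr (H (c * \<rho>)) u * ennreal (\<rho> powr (bdim i - 1)) * indicator {0<..} \<rho>)"
    proof (cases "\<rho> > 0")
      case True
      have "c * (c * \<rho>) powr (bdim i - 1) = c powr bdim i * \<rho> powr (bdim i - 1)"
        using c True by (simp add: powr_mult powr_diff)
      then have *: "ennreal c * ennreal ((c * \<rho>) powr (bdim i - 1)) = ennreal (c powr bdim i) * ennreal (\<rho> powr (bdim i - 1))"
        using c by (simp flip: ennreal_mult)
      show ?thesis
        using True c by (simp add: mult.left_commute[of _ "enn_powr _ _"] *)
    qed (use c in \<open>simp add: zero_less_mult_iff\<close>)
  qed
  also have "\<dots> = ennreal (c powr bdim i) * (\<integral>\<^sup>+\<rho>. enn_powr (H (c * \<rho>)) u \<partial>rad i)"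
    by (simp add: nn_integral_cmult nn_integral_rad)
  finally have "lp (rad i) u H = ennreal (c powr (bdim i / u)) * lp (rad i) u (\<lambda>\<rho>. H (c * \<rho>))"
    by (simp add: lp_def enn_powr_mult enn_powr_ennreal powr_powr)
  then show ?thesis
    unfolding rhs using u by (subst block_norm_eq_lp) (auto simp: H_def)
qed

text \<open>The right-hand side no longer mentions the exponents.\<close>

lemma block_norm_eq_0_iff:
  assumes g [measurable]: "g \<in> borel_measurable borel" and u: "0 < u" "0 < w"
  shows "block_norm blk k i u w g x = 0 \<longleftrightarrow>
    (AE \<rho> in rad i. AE \<omega> in ang i. g (replace_block blk i x \<rho> \<omega>) = 0)"
  using u measurable_rad_slice[OF g]
  by (simp add: block_norm_eq_lp lp_eq_0_iff measurable_ang_slice)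

text \<open>At exponents 1 all powers disappear, and what is left is the polar form of an integral
  over the block.\<close>

lemma block_norm_one_one:
  assumes i: "i \<in> {1..m}" and g [measurable]: "g \<in> borel_measurable borel"
  shows "block_norm blk k i 1 1 g x = (\<integral>\<^sup>+y. ennreal (\<Prod>v\<in>block blk i. \<bar>y v\<bar> powr (2 * k $ v)) *
    g (\<chi> j. if j \<in> block blk i then y j else x $ j) \<partial>lborelP (block blk i))"
proof -
  let ?J = "block blk i"
  let ?F = "\<lambda>y. g (\<chi> j. if j \<in> ?J then y j else x $ j)"
  have [measurable]: "(\<lambda>y. \<chi> j. if j \<in> ?J then y j else x $ j) \<in> borel_measurable (lborelP ?J)"
  proof (rule measurable_vecI)
    show "(\<lambda>y. (\<chi> j. if j \<in> ?J then y j else x $ j) $ j) \<in> borel_measurable (lborelP ?J)" for j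
      by (cases "j \<in> ?J") auto
  qed
  have "block_norm blk k i 1 1 g x = (\<integral>\<^sup>+\<rho>. ennreal (\<rho> powr (bdim i - 1)) * indicator {0<..} \<rho> *
      (\<integral>\<^sup>+\<omega>. ?F (\<lambda>j\<in>?J. \<rho> * \<omega> j) \<partial>ang i) \<partial>lborel)"
    unfolding block_norm_def
    by (auto simp: replace_block_def block_def mult_ac intro!: nn_integral_cong
        arg_cong[where f=g] vec_eq_iff[THEN iffD2] arg_cong2[where f="(*)"])
  also have "\<dots> = (\<integral>\<^sup>+y. ennreal (\<Prod>v\<in>?J. \<bar>y v\<bar> powr (2 * k $ v)) * ?F y \<partial>lborelP ?J)"
    using block_nonempty[OF i] by (intro nn_integral_dunkl_polar) auto
  finally show ?thesis .
qed

end

section \<open>The mixed norm\<close>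

lemma borel_measurable_indicator_ball [measurable, simp]:
  "indicator (ball a R) \<in> borel_measurable borel"
  by (intro borel_measurable_indicator borel_open) auto

context dunkl_blocks
begin

lemma inorm_mono:
  assumes "i \<le> m" "\<And>i. i \<in> {1..m} \<Longrightarrow> 0 < u i \<and> 0 < w i" "\<And>x. F x \<le> G x"
  shows "inorm blk k u w F i x \<le> inorm blk k u w G i x"
  using assms(1) by (induction i arbitrary: x) (auto intro!: block_norm_mono simp: assms(2,3))

lemma inorm_cmult:
  assumes "i \<le> m" "\<And>i. i \<in> {1..m} \<Longrightarrow> 0 < u i \<and> 0 < w i" and [measurable]: "F \<in> borel_measurable borel"
  shows "inorm blk k u w (\<lambda>x. c * F x) i x = c * inorm blk k u w F i x"
  using assms(1)
proof (induction i arbitrary: x)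
  case (Suc i)
  then have "inorm blk k u w (\<lambda>x. c * F x) i = (\<lambda>x. c * inorm blk k u w F i x)"
    by (simp add: fun_eq_iff)
  then show ?case
    using Suc.prems assms by (simp add: block_norm_cmult measurable_inorm)
qed simp

lemma inorm_Hoelder:
  assumes "i \<le> m" and [measurable]: "F \<in> borel_measurable borel" "G \<in> borel_measurable borel"
    and u: "\<And>i. i \<in> {1..m} \<Longrightarrow> 0 < u i \<and> 0 < u1 i \<and> 0 < u2 i \<and> 1 / u i = 1 / u1 i + 1 / u2 i"
    and w: "\<And>i. i \<in> {1..m} \<Longrightarrow> 0 < w i \<and> 0 < w1 i \<and> 0 < w2 i \<and> 1 / w i = 1 / w1 i + 1 / w2 i"
  shows "inorm blk k u w (\<lambda>x. F x * G x) i x \<le> inorm blk k u1 w1 F i x * inorm blk k u2 w2 G i x"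
  using assms(1)
proof (induction i arbitrary: x)
  case (Suc i)
  have i: "Suc i \<in> {1..m}" using Suc.prems by simp
  have "inorm blk k u w (\<lambda>x. F x * G x) (Suc i) x \<le> block_norm blk k (Suc i) (u (Suc i)) (w (Suc i))
      (\<lambda>x. inorm blk k u1 w1 F i x * inorm blk k u2 w2 G i x) x"
    using u[OF i] w[OF i] Suc by (auto intro!: block_norm_mono)
  also have "\<dots> \<le> inorm blk k u1 w1 F (Suc i) x * inorm blk k u2 w2 G (Suc i) x"
    using u[OF i] w[OF i] by (auto intro!: block_norm_Hoelder measurable_inorm)
  finally show ?case .
qed simp

lemma inorm_Minkowski:
  assumes P: "sigma_finite_measure P" and "i \<le> m"
    and F [measurable]: "case_prod F \<in> borel_measurable (P \<Otimes>\<^sub>M borel)"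
    and u: "\<And>i. i \<in> {1..m} \<Longrightarrow> 1 < u i \<and> 1 < w i"
  shows "inorm blk k u w (\<lambda>x. \<integral>\<^sup>+t. F t x \<partial>P) i x \<le> (\<integral>\<^sup>+t. inorm blk k u w (F t) i x \<partial>P)"
  using assms(2)
proof (induction i arbitrary: x)
  case (Suc i)
  have i: "Suc i \<in> {1..m}" using Suc.prems by simp
  have "inorm blk k u w (\<lambda>x. \<integral>\<^sup>+t. F t x \<partial>P) (Suc i) x \<le> block_norm blk k (Suc i) (u (Suc i)) (w (Suc i))
      (\<lambda>x. \<integral>\<^sup>+t. inorm blk k u w (F t) i x \<partial>P) x"
    using u[OF i] Suc by (auto intro!: block_norm_mono)
  also have "\<dots> \<le> (\<integral>\<^sup>+t. inorm blk k u w (F t) (Suc i) x \<partial>P)"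
    using u[OF i] P by (auto intro!: block_norm_Minkowski measurable_inorm_param F)
  finally show ?case .
qed simp

lemma inorm_scale:
  assumes "i \<le> m" and [measurable]: "F \<in> borel_measurable borel" and c: "0 < c"
    and u: "\<And>i. i \<in> {1..m} \<Longrightarrow> 0 < u i \<and> 0 < w i"
  shows "inorm blk k u w F i (c *\<^sub>R x) =
    ennreal (c powr (\<Sum>i=1..i. bdim i / u i)) * inorm blk k u w (\<lambda>x. F (c *\<^sub>R x)) i x"
  using assms(1)
proof (induction i arbitrary: x)
  case 0
  then show ?case using c by simp
next
  case (Suc i)
  have i: "Suc i \<in> {1..m}" using Suc.prems by simp
  have IH: "(\<lambda>x. inorm blk k u w F i (c *\<^sub>R x)) =
      (\<lambda>x. ennreal (c powr (\<Sum>i=1..i. bdim i / u i)) * inorm blk k u w (\<lambda>x. F (c *\<^sub>R x)) i x)"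
    using Suc by (simp add: fun_eq_iff)
  have "inorm blk k u w F (Suc i) (c *\<^sub>R x) = ennreal (c powr (bdim (Suc i) / u (Suc i))) *
      block_norm blk k (Suc i) (u (Suc i)) (w (Suc i)) (\<lambda>x. inorm blk k u w F i (c *\<^sub>R x)) x"
    using u[OF i] c by (simp add: block_norm_scale measurable_inorm)
  also have "\<dots> = ennreal (c powr (bdim (Suc i) / u (Suc i))) * (ennreal (c powr (\<Sum>i=1..i. bdim i / u i)) *
      inorm blk k u w (\<lambda>x. F (c *\<^sub>R x)) (Suc i) x)"
    unfolding IH using u[OF i] by (simp add: block_norm_cmult measurable_inorm)
  also have "\<dots> = ennreal (c powr (\<Sum>i=1..Suc i. bdim i / u i)) * inorm blk k u w (\<lambda>x. F (c *\<^sub>R x)) (Suc i) x"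
    using c by (simp add: powr_add ennreal_mult mult_ac)
  finally show ?case .
qed

text \<open>Vanishing of a block norm depends only on the zero set of its argument, and by induction
  these zero sets agree for both choices of exponents.\<close>

lemma inorm_eq_0_exponents:
  assumes "i \<le> m" and [measurable]: "F \<in> borel_measurable borel"
    and u: "\<And>i. i \<in> {1..m} \<Longrightarrow> 0 < u i \<and> 0 < w i" and u': "\<And>i. i \<in> {1..m} \<Longrightarrow> 0 < u' i \<and> 0 < w' i"
  shows "inorm blk k u w F i x = 0 \<longleftrightarrow> inorm blk k u' w' F i x = 0"
  using assms(1)
proof (induction i arbitrary: x)
  case (Suc i)
  have i: "Suc i \<in> {1..m}" using Suc.prems by simp
  show ?case
    using u[OF i] u'[OF i] Suc by (simp add: block_norm_eq_0_iff measurable_inorm)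
qed simp

lemma blk_ge_1: "1 \<le> blk j" and blk_le_m: "blk j \<le> m"
  using blk by auto

text \<open>By Tonelli the integral over a new block and the one over the earlier blocks form a
  single integral; \<open>merge\<close> glues the two groups of coordinates.\<close>

lemma inorm_one_one:
  assumes "i \<le> m" and F [measurable]: "F \<in> borel_measurable borel"
  shows "inorm blk k (\<lambda>_. 1) (\<lambda>_. 1) F i x =
    (\<integral>\<^sup>+y. ennreal (\<Prod>v | blk v \<le> i. \<bar>y v\<bar> powr (2 * k $ v)) *
      F (\<chi> j. if blk j \<le> i then y j else x $ j) \<partial>lborelP {j. blk j \<le> i})"
  using assms(1)
proof (induction i arbitrary: x)
  interpret product_sigma_finite "\<lambda>_::'n. lborel :: real measure"
    by (rule product_sigma_finite_lborel)
  case 0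
  \<comment> \<open>Blocks are numbered from 1, so the base case integrates over a one-point
    space.\<close>
  have pos: "blk j \<le> 0 \<longleftrightarrow> False" for j using blk_ge_1[of j] by simp
  show ?case unfolding pos by (simp add: PiM_empty)
next
  interpret product_sigma_finite "\<lambda>_::'n. lborel :: real measure"
    by (rule product_sigma_finite_lborel)
  case (Suc i)
  let ?I = "block blk (Suc i)" and ?J = "{j. blk j \<le> i}"
  let ?w = "\<lambda>A y. \<Prod>v\<in>A. \<bar>y v\<bar> powr (2 * k $ v)"
  have i: "Suc i \<in> {1..m}" using Suc.prems by simp
  have IJ: "{j. blk j \<le> Suc i} = ?I \<union> ?J" "?I \<inter> ?J = {}"
    by (auto simp: block_def)
  have IH: "inorm blk k (\<lambda>_. 1) (\<lambda>_. 1) F i = (\<lambda>x. \<integral>\<^sup>+y. ennreal (?w ?J y) *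
      F (\<chi> j. if blk j \<le> i then y j else x $ j) \<partial>lborelP ?J)"
    using Suc by (simp add: fun_eq_iff)
  have vec [measurable]: "(\<lambda>y. \<chi> j. if blk j \<le> l then y j else x $ j) \<in> borel_measurable (lborelP {j. blk j \<le> l})" for l x
  proof (rule measurable_vecI)
    show "(\<lambda>y. (\<chi> j. if blk j \<le> l then y j else x $ j) $ j) \<in> borel_measurable (lborelP {j. blk j \<le> l})" for j
      by (cases "blk j \<le> l") auto
  qed
  have w [measurable]: "?w A \<in> borel_measurable (lborelP A)" for A
    by (rule borel_measurable_prod) measurable
  have "inorm blk k (\<lambda>_. 1) (\<lambda>_. 1) F (Suc i) x =
      (\<integral>\<^sup>+z. ennreal (?w ?I z) * (\<integral>\<^sup>+y. ennreal (?w ?J y) *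
        F (\<chi> j. if blk j \<le> i then y j else (\<chi> j. if j \<in> ?I then z j else x $ j) $ j) \<partial>lborelP ?J) \<partial>lborelP ?I)"
    using block_norm_one_one[OF i measurable_inorm[OF F], of "\<lambda>_. 1" "\<lambda>_. 1" i x]
    unfolding IH by (simp add: IH)
  also have "\<dots> = (\<integral>\<^sup>+z. (\<integral>\<^sup>+y. ennreal (?w ?I z) * (ennreal (?w ?J y) *
        F (\<chi> j. if blk j \<le> i then y j else (\<chi> j. if j \<in> ?I then z j else x $ j) $ j)) \<partial>lborelP ?J) \<partial>lborelP ?I)"
    by (intro nn_integral_cong, subst nn_integral_cmult) measurable
  also have "\<dots> = (\<integral>\<^sup>+z. (\<integral>\<^sup>+y. ennreal (?w (?I \<union> ?J) (merge ?I ?J (z, y))) *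
        F (\<chi> j. if blk j \<le> Suc i then merge ?I ?J (z, y) j else x $ j) \<partial>lborelP ?J) \<partial>lborelP ?I)"
  proof (intro nn_integral_cong)
    fix z y
    have "?w (?I \<union> ?J) (merge ?I ?J (z, y)) = ?w ?I (merge ?I ?J (z, y)) * ?w ?J (merge ?I ?J (z, y))"
      using IJ by (intro prod.union_disjoint) auto
    also have "?w ?I (merge ?I ?J (z, y)) = ?w ?I z"
      by (intro prod.cong) (auto simp: merge_def)
    also have "?w ?J (merge ?I ?J (z, y)) = ?w ?J y"
      using IJ by (intro prod.cong) (auto simp: merge_def)
    finally have w: "ennreal (?w (?I \<union> ?J) (merge ?I ?J (z, y))) = ennreal (?w ?I z) * ennreal (?w ?J y)"
      by (simp add: ennreal_mult prod_nonneg)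
    have v: "(\<chi> j. if blk j \<le> i then y j else (\<chi> j. if j \<in> ?I then z j else x $ j) $ j) =
        (\<chi> j. if blk j \<le> Suc i then merge ?I ?J (z, y) j else x $ j)"
      by (auto simp: vec_eq_iff merge_def block_def)
    show "ennreal (?w ?I z) * (ennreal (?w ?J y) *
        F (\<chi> j. if blk j \<le> i then y j else (\<chi> j. if j \<in> ?I then z j else x $ j) $ j)) =
      ennreal (?w (?I \<union> ?J) (merge ?I ?J (z, y))) *
        F (\<chi> j. if blk j \<le> Suc i then merge ?I ?J (z, y) j else x $ j)"
      unfolding w v by (simp add: mult.assoc)
  qed
  also have "\<dots> = (\<integral>\<^sup>+y. ennreal (?w (?I \<union> ?J) y) * F (\<chi> j. if blk j \<le> Suc i then y j else x $ j)
      \<partial>lborelP (?I \<union> ?J))"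
    unfolding IJ(1)[symmetric]
    by (subst product_nn_integral_fold[of ?I ?J, folded IJ(1)]) (use IJ in \<open>auto simp: IJ(1)[symmetric]\<close>)
  finally show ?case unfolding IJ(1) .
qed

section \<open>The norm over all blocks: null sets, inequalities, balls\<close>

definition mixed :: "(nat \<Rightarrow> real) \<Rightarrow> (nat \<Rightarrow> real) \<Rightarrow> (real ^ 'n \<Rightarrow> ennreal) \<Rightarrow> ennreal" where
  "mixed u w F = inorm blk k u w F m 0"

definition weight :: "real ^ 'n \<Rightarrow> ennreal" where
  "weight x = ennreal (\<Prod>j\<in>UNIV. \<bar>x $ j\<bar> powr (2 * k $ j))"

text \<open>The degree of homogeneity of the mixed norm under dilation; at exponents 1 it is the
  homogeneous dimension.\<close>

definition hdim :: "(nat \<Rightarrow> real) \<Rightarrow> real" where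
  "hdim u = (\<Sum>i=1..m. bdim i / u i)"

lemma mixed_norm_eq_mixed: "mixed_norm blk k m u w f = mixed u w (\<lambda>x. ennreal (norm (f x)))"
  by (simp add: mixed_norm_def mixed_def iterated_norm_eq_inorm)

lemma weight_measurable [measurable]: "weight \<in> borel_measurable borel"
  unfolding weight_def by measurable

lemma AE_weight_pos: "AE x in lborel. weight x \<noteq> 0"
proof -
  have "AE x in lborel. \<forall>j. (x :: real ^ 'n) $ j \<noteq> 0"
    by (simp add: AE_all_countable AE_lborel_component_nonzero)
  then show ?thesis
    by eventually_elim (auto simp: weight_def prod_pos powr_gt_zero less_imp_neq[symmetric])
qed

lemma mixed_one_one:
  assumes [measurable]: "F \<in> borel_measurable borel"
  shows "mixed (\<lambda>_. 1) (\<lambda>_. 1) F = (\<integral>\<^sup>+x. weight x * F x \<partial>lborel)"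
proof -
  have "{j. blk j \<le> m} = UNIV" using blk_le_m by auto
  then show ?thesis
    by (simp add: mixed_def inorm_one_one nn_integral_lborel_vec weight_def blk_le_m)
qed

lemma nn_integral_dunkl_measure:
  assumes [measurable]: "F \<in> borel_measurable borel"
  shows "(\<integral>\<^sup>+x. F x \<partial>dunkl_measure k) = (\<integral>\<^sup>+x. weight x * F x \<partial>lborel)"
proof -
  have "weight \<in> borel_measurable lebesgue" "F \<in> borel_measurable lebesgue"
    by (auto intro: measurable_completion)
  then have "(\<integral>\<^sup>+x. F x \<partial>dunkl_measure k) = (\<integral>\<^sup>+x. weight x * F x \<partial>lebesgue)"
    unfolding dunkl_measure_def weight_def[symmetric] by (subst nn_integral_density) auto
  then show ?thesis by (simp add: nn_integral_completion)
qed

text \<open>With exponents 1 the mixed norm is the integral against \<open>weight\<close>, and as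
  \<open>weight\<close> is positive almost everywhere, Dunkl null sets are Lebesgue null
  sets.\<close>

lemma mixed_eq_0_iff:
  assumes [measurable]: "F \<in> borel_measurable borel" and u: "\<And>i. i \<in> {1..m} \<Longrightarrow> 0 < u i \<and> 0 < w i"
  shows "mixed u w F = 0 \<longleftrightarrow> (AE x in lborel. F x = 0)"
proof -
  have "mixed u w F = 0 \<longleftrightarrow> mixed (\<lambda>_. 1) (\<lambda>_. 1) F = 0"
    unfolding mixed_def using u by (intro inorm_eq_0_exponents) auto
  also have "\<dots> \<longleftrightarrow> (AE x in lborel. weight x * F x = 0)"
    by (simp add: mixed_one_one nn_integral_0_iff_AE)
  also have "\<dots> \<longleftrightarrow> (AE x in lborel. F x = 0)"
    using AE_weight_pos by (intro eventually_subst, eventually_elim) auto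
  finally show ?thesis .
qed

text \<open>Holds for arbitrary functions; this is how Lebesgue measurable functions are compared
  with their Borel bounds.\<close>

lemma mixed_mono:
  assumes "\<And>i. i \<in> {1..m} \<Longrightarrow> 0 < u i \<and> 0 < w i" "\<And>x. F x \<le> G x"
  shows "mixed u w F \<le> mixed u w G"
  unfolding mixed_def using assms by (intro inorm_mono) auto

lemma mixed_cmult:
  assumes "\<And>i. i \<in> {1..m} \<Longrightarrow> 0 < u i \<and> 0 < w i" and "F \<in> borel_measurable borel"
  shows "mixed u w (\<lambda>x. c * F x) = c * mixed u w F"
  unfolding mixed_def using assms by (intro inorm_cmult) auto

lemma mixed_Hoelder:
  assumes "F \<in> borel_measurable borel" "G \<in> borel_measurable borel"
    and "\<And>i. i \<in> {1..m} \<Longrightarrow> 0 < u i \<and> 0 < u1 i \<and> 0 < u2 i \<and> 1 / u i = 1 / u1 i + 1 / u2 i"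
    and "\<And>i. i \<in> {1..m} \<Longrightarrow> 0 < w i \<and> 0 < w1 i \<and> 0 < w2 i \<and> 1 / w i = 1 / w1 i + 1 / w2 i"
  shows "mixed u w (\<lambda>x. F x * G x) \<le> mixed u1 w1 F * mixed u2 w2 G"
  unfolding mixed_def using assms by (intro inorm_Hoelder) auto

lemma mixed_Minkowski:
  assumes "sigma_finite_measure P" "case_prod F \<in> borel_measurable (P \<Otimes>\<^sub>M borel)"
    and "\<And>i. i \<in> {1..m} \<Longrightarrow> 1 < u i \<and> 1 < w i"
  shows "mixed u w (\<lambda>x. \<integral>\<^sup>+t. F t x \<partial>P) \<le> (\<integral>\<^sup>+t. mixed u w (F t) \<partial>P)"
  unfolding mixed_def using assms by (intro inorm_Minkowski) auto

text \<open>The integral inequality of Minkowski for counting measure on two points.\<close>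

lemma mixed_add:
  assumes [measurable]: "F \<in> borel_measurable borel" "G \<in> borel_measurable borel"
    and u: "\<And>i. i \<in> {1..m} \<Longrightarrow> 1 < u i \<and> 1 < w i"
  shows "mixed u w (\<lambda>x. F x + G x) \<le> mixed u w F + mixed u w G"
proof -
  let ?P = "count_space (UNIV :: bool set)"
  let ?F = "\<lambda>b. if b then F else G"
  have "mixed u w (\<lambda>x. \<integral>\<^sup>+b. ?F b x \<partial>?P) \<le> (\<integral>\<^sup>+b. mixed u w (?F b) \<partial>?P)"
  proof (rule mixed_Minkowski)
    show "sigma_finite_measure ?P"
      by (intro finite_measure.axioms finite_measure_count_space) auto
    show "case_prod ?F \<in> borel_measurable (?P \<Otimes>\<^sub>M borel)"
      by (intro measurable_pair_measure_countable1) auto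
  qed (use u in auto)
  then show ?thesis
    by (simp add: nn_integral_count_space_finite UNIV_bool add.commute)
qed

lemma mixed_scale:
  assumes "F \<in> borel_measurable borel" "0 < c" "\<And>i. i \<in> {1..m} \<Longrightarrow> 0 < u i \<and> 0 < w i"
  shows "mixed u w F = ennreal (c powr hdim u) * mixed u w (\<lambda>x. F (c *\<^sub>R x))"
  unfolding mixed_def hdim_def using inorm_scale[of m F c u w 0] assms by simp

text \<open>\<open>F\<close> dominates \<open>top\<close> times the indicator of the set where it is
  infinite, and by homogeneity that multiple has norm \<open>0\<close> or
  \<open>top\<close>.\<close>

lemma mixed_less_top_AE:
  assumes [measurable]: "F \<in> borel_measurable borel" and u: "\<And>i. i \<in> {1..m} \<Longrightarrow> 0 < u i \<and> 0 < w i"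
    and "mixed u w F < \<infinity>"
  shows "AE x in lborel. F x < \<infinity>"
proof -
  let ?A = "{x. F x = top}"
  have [measurable]: "?A \<in> sets borel" by measurable
  have "top * mixed u w (indicator ?A) = mixed u w (\<lambda>x. top * indicator ?A x)"
    by (rule mixed_cmult[symmetric, OF u]) auto
  also have "\<dots> \<le> mixed u w F"
    using u by (intro mixed_mono) (auto simp: indicator_def)
  also have "\<dots> < top" using assms(3) by simp
  finally have "mixed u w (indicator ?A) = 0"
    by (auto simp: ennreal_top_mult split: if_splits)
  then have "AE x in lborel. indicator ?A x = (0 :: ennreal)"
    using u by (subst (asm) mixed_eq_0_iff) auto
  then show ?thesis
    by eventually_elim (auto simp: indicator_def less_top split: if_splits)
qed

text \<open>The cylinder constrains only the blocks not yet integrated out. On the unit sphere of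
  block \<open>Suc i\<close> its inequality says that the square of \<open>\<rho>\<close> plus the
  remaining squares is below that of \<open>R\<close>, which bounds \<open>\<rho>\<close> and leaves
  the next cylinder. The constant is the angular norm of 1 times the radial norm of an
  interval.\<close>

lemma block_norm_slab_finite:
  assumes i: "Suc i \<in> {1..m}" and u: "0 < u" "0 < w" and R: "0 < R"
  shows "\<exists>C<\<infinity>. \<forall>x. block_norm blk k (Suc i) u w (indicator {x. (\<Sum>j | i < blk j. (x $ j)\<^sup>2) < R\<^sup>2}) x \<le>
    C * indicator {x. (\<Sum>j | Suc i < blk j. (x $ j)\<^sup>2) < R\<^sup>2} x"
proof -
  let ?I = "Suc i"
  define E where "E = (\<lambda>i. indicator {x :: real ^ 'n. (\<Sum>j | i < blk j. (x $ j)\<^sup>2) < R\<^sup>2} :: _ \<Rightarrow> ennreal)"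
  have E [measurable]: "E i \<in> borel_measurable borel" for i
    unfolding E_def by measurable
  interpret S: finite_measure "ang ?I" using finite_dunkl_surface_measure[OF k_nonneg] .
  define A where "A = enn_powr (emeasure (ang ?I) (space (ang ?I))) (1 / w)"
  define B where "B = lp (rad ?I) u (indicator {-R<..<R})"
  have "A < \<infinity>"
    using S.emeasure_finite[of "space (ang ?I)"] by (auto simp: A_def less_top[symmetric])
  have "(\<integral>\<^sup>+\<rho>. enn_powr (indicator {-R<..<R} \<rho>) u \<partial>rad ?I) \<le>
      (\<integral>\<^sup>+\<rho>. ennreal (R powr (bdim ?I - 1)) * indicator {0..R} \<rho> \<partial>lborel)"
  proof (subst nn_integral_rad)
    show "(\<integral>\<^sup>+\<rho>. enn_powr (indicator {-R<..<R} \<rho>) u * ennreal (\<rho> powr (bdim ?I - 1)) * indicator {0<..} \<rho> \<partial>lborel) \<le>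
      (\<integral>\<^sup>+\<rho>. ennreal (R powr (bdim ?I - 1)) * indicator {0..R} \<rho> \<partial>lborel)"
      using bdim_ge_1[OF i] by (intro nn_integral_mono) (auto simp: indicator_def intro!: ennreal_leI powr_mono2)
  qed measurable
  also have "\<dots> < \<infinity>"
    using R by (simp add: nn_integral_cmult ennreal_mult_less_top)
  finally have "B < \<infinity>"
    by (auto simp: B_def lp_def less_top[symmetric])
  have ang: "lp (ang ?I) w (\<lambda>\<omega>. E i (replace_block blk ?I x \<rho> \<omega>)) \<le> (A * E ?I x) * indicator {-R<..<R} \<rho>" for x \<rho>
  proof -
    have "lp (ang ?I) w (\<lambda>\<omega>. E i (replace_block blk ?I x \<rho> \<omega>)) \<le> lp (ang ?I) w (\<lambda>\<omega>. E ?I x * indicator {-R<..<R} \<rho>)"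
    proof (rule lp_mono_AE)
      show "AE \<omega> in ang ?I. E i (replace_block blk ?I x \<rho> \<omega>) \<le> E ?I x * indicator {-R<..<R} \<rho>"
        using AE_dunkl_surface_measure[where blk = blk and k = k and i = ?I]
      proof eventually_elim
        case (elim \<omega>)
        let ?x = "replace_block blk ?I x \<rho> \<omega>"
        have "{j. i < blk j} = block blk ?I \<union> {j. ?I < blk j}"
          by (auto simp: block_def)
        then have "(\<Sum>j | i < blk j. (?x $ j)\<^sup>2) =
            (\<Sum>j\<in>block blk ?I. (?x $ j)\<^sup>2) + (\<Sum>j | ?I < blk j. (?x $ j)\<^sup>2)"
          by (simp only:) (rule sum.union_disjoint, auto simp: block_def)
        also have "(\<Sum>j\<in>block blk ?I. (?x $ j)\<^sup>2) = (\<Sum>j\<in>block blk ?I. \<rho>\<^sup>2 * (\<omega> j)\<^sup>2)"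
          by (intro sum.cong) (auto simp: replace_block_def block_def power_mult_distrib)
        also have "\<dots> = \<rho>\<^sup>2 * (L2_set \<omega> (block blk ?I))\<^sup>2"
          by (simp add: sum_distrib_left[symmetric] L2_set_def sum_nonneg)
        also have "\<dots> = \<rho>\<^sup>2" using elim by simp
        also have "(\<Sum>j | ?I < blk j. (?x $ j)\<^sup>2) = (\<Sum>j | ?I < blk j. (x $ j)\<^sup>2)"
          by (intro sum.cong) (auto simp: replace_block_def)
        finally have eq: "(\<Sum>j | i < blk j. (?x $ j)\<^sup>2) = \<rho>\<^sup>2 + (\<Sum>j | ?I < blk j. (x $ j)\<^sup>2)" .
        have "0 \<le> (\<Sum>j | ?I < blk j. (x $ j)\<^sup>2)" by (intro sum_nonneg) auto
        moreover have "\<rho>\<^sup>2 < R\<^sup>2 \<Longrightarrow> -R < \<rho> \<and> \<rho> < R"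
          using R by (smt (verit) power2_le_imp_le power2_minus)
        moreover have "0 \<le> \<rho>\<^sup>2" by simp
        ultimately show ?case
          by (simp add: E_def eq indicator_def) (smt (verit) zero_le_power2)
      qed
    qed (use u in auto)
    also have "\<dots> = (A * E ?I x) * indicator {-R<..<R} \<rho>"
      using u by (simp add: lp_const A_def mult_ac)
    finally show ?thesis .
  qed
  have "block_norm blk k ?I u w (E i) x \<le> (A * B) * E ?I x" for x
  proof -
    have "block_norm blk k ?I u w (E i) x \<le> lp (rad ?I) u (\<lambda>\<rho>. (A * E ?I x) * indicator {-R<..<R} \<rho>)"
      using u ang by (subst block_norm_eq_lp) (auto intro!: lp_mono)
    also have "\<dots> = (A * B) * E ?I x"
      using u by (subst lp_cmult) (auto simp: B_def mult_ac)
    finally show ?thesis .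
  qed
  then show ?thesis
    using \<open>A < \<infinity>\<close> \<open>B < \<infinity>\<close> unfolding E_def
    by (intro exI[of _ "A * B"]) (auto simp: ennreal_mult_less_top)
qed

text \<open>The invariant bounds the iterated norm by a multiple of a cylinder indicator: before the
  first block the cylinder is the ball itself, after the last one its inequality is an empty sum
  below the square of \<open>R\<close>.\<close>

lemma mixed_ball_finite:
  assumes u: "\<And>i. i \<in> {1..m} \<Longrightarrow> 0 < u i \<and> 0 < w i" and R: "0 < R"
  shows "mixed u w (indicator (ball 0 R)) < \<infinity>"
proof -
  have "\<exists>C<\<infinity>. \<forall>x. inorm blk k u w (indicator (ball 0 R)) i x \<le>
      C * indicator {x. (\<Sum>j | i < blk j. (x $ j)\<^sup>2) < R\<^sup>2} x" if "i \<le> m" for i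
    using that
  proof (induction i)
    case 0
    have "{j. 0 < blk j} = UNIV" using blk_ge_1 by (auto simp: Suc_le_eq)
    moreover have "(\<Sum>j\<in>UNIV. (x $ j)\<^sup>2) < R\<^sup>2" if "norm x < R" for x :: "real ^ 'n"
    proof -
      have "(\<Sum>j\<in>UNIV. (x $ j)\<^sup>2) = (norm x)\<^sup>2"
        by (simp add: norm_vec_def L2_set_def sum_nonneg)
      also have "\<dots> < R\<^sup>2" using that by (intro power_strict_mono) auto
      finally show ?thesis .
    qed
    ultimately show ?case
      by (intro exI[of _ 1]) (auto simp: indicator_def)
  next
    case (Suc i)
    let ?E = "\<lambda>i. indicator {x :: real ^ 'n. (\<Sum>j | i < blk j. (x $ j)\<^sup>2) < R\<^sup>2} :: _ \<Rightarrow> ennreal"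
    have E [measurable]: "?E i \<in> borel_measurable borel" for i by measurable
    have i: "Suc i \<in> {1..m}" using Suc.prems by simp
    obtain C where C: "C < \<infinity>" "\<And>x. inorm blk k u w (indicator (ball 0 R)) i x \<le> C * ?E i x"
      using Suc by auto
    obtain D where D: "D < \<infinity>" "\<And>x. block_norm blk k (Suc i) (u (Suc i)) (w (Suc i)) (?E i) x \<le> D * ?E (Suc i) x"
      using block_norm_slab_finite[OF i _ _ R] u[OF i] by blast
    have "inorm blk k u w (indicator (ball 0 R)) (Suc i) x \<le> (C * D) * ?E (Suc i) x" for x
    proof -
      have "inorm blk k u w (indicator (ball 0 R)) (Suc i) x \<le>
          block_norm blk k (Suc i) (u (Suc i)) (w (Suc i)) (\<lambda>x. C * ?E i x) x"
        using C(2) u[OF i] by (auto intro!: block_norm_mono)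
      also have "\<dots> = C * block_norm blk k (Suc i) (u (Suc i)) (w (Suc i)) (?E i) x"
        using u[OF i] by (simp add: block_norm_cmult)
      also have "\<dots> \<le> C * (D * ?E (Suc i) x)"
        using D(2) by (intro mult_left_mono) auto
      finally show ?thesis by (simp add: mult.assoc)
    qed
    then show ?case
      using C(1) D(1) by (intro exI[of _ "C * D"]) (auto simp: ennreal_mult_less_top)
  qed
  from this[of m] obtain C where C: "C < \<infinity>" "inorm blk k u w (indicator (ball 0 R)) m 0 \<le> C * indicator {x. (\<Sum>j | m < blk j. (x $ j)\<^sup>2) < R\<^sup>2} 0"
    by auto
  have "mixed u w (indicator (ball 0 R)) \<le> C * indicator {x. (\<Sum>j | m < blk j. (x $ j)\<^sup>2) < R\<^sup>2} 0"
    using C(2) by (simp add: mixed_def)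
  also have "\<dots> < \<infinity>"
    using C(1) by (auto simp: indicator_def)
  finally show ?thesis .
qed

lemma mixed_ball_pos:
  assumes u: "\<And>i. i \<in> {1..m} \<Longrightarrow> 0 < u i \<and> 0 < w i" and R: "0 < R"
  shows "mixed u w (indicator (ball 0 R)) \<noteq> 0"
proof
  assume "mixed u w (indicator (ball 0 R)) = 0"
  then have "AE x :: real ^ 'n in lborel. indicator (ball 0 R) x = (0 :: ennreal)"
    using u by (subst (asm) mixed_eq_0_iff) auto
  then have "AE x in lborel. (x :: real ^ 'n) \<notin> ball 0 R"
    by (simp add: indicator_eq_0_iff)
  then have "(ball 0 R :: (real ^ 'n) set) \<in> null_sets lborel"
    by (simp only: AE_iff_null_sets sets_lborel borel_open open_ball)
  then have "negligible (ball 0 R :: (real ^ 'n) set)"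
    by (simp add: negligible_iff_null_sets null_sets_completionI)
  then show False using R open_not_negligible[OF open_ball, of "0 :: real ^ 'n" R] by simp
qed

lemma mixed_ball_scale:
  assumes u: "\<And>i. i \<in> {1..m} \<Longrightarrow> 0 < u i \<and> 0 < w i" and R: "0 < R"
  shows "mixed u w (indicator (ball 0 R)) = ennreal (R powr hdim u) * mixed u w (indicator (ball 0 1))"
proof -
  have "(\<lambda>x :: real ^ 'n. indicator (ball 0 R) (R *\<^sub>R x)) = (indicator (ball 0 1) :: _ \<Rightarrow> ennreal)"
    using R by (auto simp: indicator_def fun_eq_iff)
  moreover have "mixed u w (indicator (ball 0 R)) =
      ennreal (R powr hdim u) * mixed u w (\<lambda>x. indicator (ball 0 R) (R *\<^sub>R x))"
    using R u by (intro mixed_scale) auto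
  ultimately show ?thesis by simp
qed

lemma hdim_one: "hdim (\<lambda>_. 1) = hom_dim k"
proof -
  have "hdim (\<lambda>_. 1) = (\<Sum>i=1..m. \<Sum>v\<in>{v \<in> UNIV. blk v = i}. 1 + 2 * k $ v)"
    by (simp add: hdim_def block_dim_def block_def sum.distrib sum_distrib_left)
  also have "\<dots> = (\<Sum>v\<in>UNIV. 1 + 2 * k $ v)"
    by (rule sum.group) (use blk in auto)
  finally show ?thesis by (simp add: hom_dim_def sum.distrib sum_distrib_left)
qed

lemma hom_dim_pos: "0 < hom_dim k"
  using k_nonneg by (simp add: hom_dim_def add_pos_nonneg sum_nonneg)

lemma emeasure_dunkl_ball: "emeasure (dunkl_measure k) (ball 0 R) = mixed (\<lambda>_. 1) (\<lambda>_. 1) (indicator (ball 0 R))"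
proof -
  have "emeasure (dunkl_measure k) (ball 0 R) = (\<integral>\<^sup>+x. indicator (ball 0 R) x \<partial>dunkl_measure k)"
    by (simp add: dunkl_measure_def)
  then show ?thesis by (simp add: nn_integral_dunkl_measure mixed_one_one)
qed

text \<open>The measure of a ball is its mixed norm at exponents 1, so finiteness, positivity and
  scaling all come from the mixed norm.\<close>

lemma measure_dunkl_ball:
  obtains v where "0 < v" "\<And>R. 0 < R \<Longrightarrow> measure (dunkl_measure k) (ball 0 R) = v * R powr hom_dim k"
    "\<And>R. 0 < R \<Longrightarrow> emeasure (dunkl_measure k) (ball 0 R) = ennreal (v * R powr hom_dim k)"
proof -
  let ?M = "mixed (\<lambda>_. 1) (\<lambda>_. 1) (indicator (ball 0 1))"
  have "?M < \<infinity>" "?M \<noteq> 0"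
    by (rule mixed_ball_finite mixed_ball_pos; simp)+
  then obtain v where v: "?M = ennreal v" "v > 0"
    by (cases ?M) (auto simp: less_le)
  have "emeasure (dunkl_measure k) (ball 0 R) = ennreal (v * R powr hom_dim k)" if "0 < R" for R
    using that v by (simp add: emeasure_dunkl_ball mixed_ball_scale[of _ _ R] hdim_one ennreal_mult mult.commute)
  then show ?thesis
    using v by (intro that[of v]) (auto simp: measure_def)
qed

end

section \<open>Functions of central bounded mean oscillation\<close>

lemma ennreal_divide_le_iff:
  fixes a d K :: ennreal
  assumes "d \<noteq> 0" "d \<noteq> top"
  shows "a / d \<le> K \<longleftrightarrow> a \<le> K * d"
proof
  assume "a / d \<le> K"
  then have "a / d * d \<le> K * d" by (rule mult_right_mono) simp
  then show "a \<le> K * d"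
    using assms by (simp add: ennreal_divide_times less_top)
next
  assume "a \<le> K * d"
  then show "a / d \<le> K"
    using assms by (intro divide_le_posI_ennreal) (auto simp: mult.commute zero_less_iff_neq_zero)
qed

lemma ennreal_le_divideI:
  assumes "0 < d" "x * d \<le> a" "ennreal a \<le> K * ennreal e" "0 \<le> e"
  shows "ennreal x \<le> K * ennreal (e / d)"
proof -
  have "ennreal x \<le> ennreal (a / d)"
    using assms by (intro ennreal_leI) (simp add: field_simps)
  also have "\<dots> = ennreal (1 / d) * ennreal a"
    using assms(1) by (simp flip: ennreal_mult')
  also have "\<dots> \<le> ennreal (1 / d) * (K * ennreal e)"
    using assms(3) by (rule mult_left_mono) simp
  also have "\<dots> = K * ennreal (e / d)"
    using assms(1,4) by (simp add: mult.left_commute flip: ennreal_mult)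
  finally show ?thesis .
qed

context dunkl_blocks
begin

section \<open>Normalising constants of balls and almost every ray\<close>

definition ball_const :: "(nat \<Rightarrow> real) \<Rightarrow> (nat \<Rightarrow> real) \<Rightarrow> real" where
  "ball_const u w = enn2real (mixed u w (indicator (ball 0 1)))"

definition vol :: real where
  "vol = measure (dunkl_measure k) (ball 0 1)"

lemma AE_dunkl_measureI:
  assumes "AE x in lborel. P x"
  shows "AE x in dunkl_measure k. P x"
proof -
  have "weight \<in> borel_measurable lebesgue"
    by (rule measurable_completion) simp
  moreover have "AE x in lebesgue. P x"
    using assms by (rule AE_completion)
  ultimately show ?thesis
    unfolding dunkl_measure_def weight_def[symmetric] by (subst AE_density) auto
qed

lemma ball_const_nonneg [simp]: "0 \<le> ball_const u w"
  by (simp add: ball_const_def)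

lemma ball_const_pos:
  assumes "\<forall>i\<in>{1..m}. 0 < u i \<and> 0 < w i"
  shows "0 < ball_const u w"
  unfolding ball_const_def enn2real_positive_iff
  using mixed_ball_finite[of u w 1] mixed_ball_pos[of u w 1] assms
  by (simp add: zero_less_iff_neq_zero)

lemma mixed_ball:
  assumes "\<forall>i\<in>{1..m}. 0 < u i \<and> 0 < w i" and R: "0 < R"
  shows "mixed u w (indicator (ball 0 R)) = ennreal (ball_const u w * R powr hdim u)"
  using mixed_ball_finite[of u w 1] mixed_ball_scale[of u w R] assms
  by (simp add: ball_const_def ennreal_mult mult.commute)

lemma vol_pos: "0 < vol"
  and measure_ball: "0 < R \<Longrightarrow> measure (dunkl_measure k) (ball 0 R) = vol * R powr hom_dim k"
  and emeasure_ball: "0 < R \<Longrightarrow> emeasure (dunkl_measure k) (ball 0 R) = ennreal (vol * R powr hom_dim k)"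
proof -
  obtain v where v: "0 < v" "\<And>R. 0 < R \<Longrightarrow> measure (dunkl_measure k) (ball 0 R) = v * R powr hom_dim k"
    "\<And>R. 0 < R \<Longrightarrow> emeasure (dunkl_measure k) (ball 0 R) = ennreal (v * R powr hom_dim k)"
    by (rule measure_dunkl_ball) blast
  have "vol = v" using v(2)[of 1] by (simp add: vol_def)
  with v show "0 < vol" "0 < R \<Longrightarrow> measure (dunkl_measure k) (ball 0 R) = vol * R powr hom_dim k"
    "0 < R \<Longrightarrow> emeasure (dunkl_measure k) (ball 0 R) = ennreal (vol * R powr hom_dim k)" by auto
qed

text \<open>Both factors of the denominator are constants times powers of \<open>R\<close>, so a
  Morrey or oscillation bound becomes an estimate with an explicit power of \<open>R\<close> and no
  division.\<close>

lemma central_quotient_le_iff: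
  assumes u: "\<forall>i\<in>{1..m}. 0 < u i \<and> 0 < w i" and R: "0 < R"
  shows "central_quotient blk k m u w lam f R \<le> K \<longleftrightarrow>
    mixed u w (\<lambda>x. ennreal (norm (f x)) * indicator (ball 0 R) x) \<le>
    K * ennreal (vol powr lam * ball_const u w * R powr (hom_dim k * lam + hdim u))"
proof -
  have f: "mixed_norm blk k m u w (\<lambda>x. f x * indicator (ball 0 R) x) =
      mixed u w (\<lambda>x. ennreal (norm (f x)) * indicator (ball 0 R) x)"
    unfolding mixed_norm_eq_mixed
    by (intro arg_cong[where f = "mixed u w"] ext) (simp add: indicator_def)
  have chi: "mixed_norm blk k m u w (indicator (ball 0 R)) = mixed u w (indicator (ball 0 R))"
    unfolding mixed_norm_eq_mixed
    by (intro arg_cong[where f = "mixed u w"] ext) (simp add: indicator_def)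
  have "ennreal (measure (dunkl_measure k) (ball 0 R) powr lam) * mixed_norm blk k m u w (indicator (ball 0 R)) =
      ennreal ((vol * R powr hom_dim k) powr lam * (ball_const u w * R powr hdim u))"
    using R ball_const_pos[OF u] by (simp add: chi mixed_ball[OF u R] measure_ball ennreal_mult)
  also have "(vol * R powr hom_dim k) powr lam * (ball_const u w * R powr hdim u) =
      vol powr lam * ball_const u w * R powr (hom_dim k * lam + hdim u)"
    using R vol_pos by (simp add: powr_mult powr_powr powr_add)
  finally show ?thesis
    unfolding central_quotient_def f
    using R ball_const_pos[OF u] vol_pos by (subst ennreal_divide_le_iff) (auto simp: ennreal_eq_0_iff not_le)
qed

lemma morrey_norm_le_iff:
  assumes u: "\<forall>i\<in>{1..m}. 0 < u i \<and> 0 < w i"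
  shows "morrey_norm blk k m u w lam f \<le> K \<longleftrightarrow>
    (\<forall>R>0. mixed u w (\<lambda>x. ennreal (norm (f x)) * indicator (ball 0 R) x) \<le>
      K * ennreal (vol powr lam * ball_const u w * R powr (hom_dim k * lam + hdim u)))"
  unfolding morrey_norm_def SUP_le_iff using central_quotient_le_iff[OF u] by auto

lemma mixed_dilate:
  assumes F: "F \<in> borel_measurable borel" and c: "0 < c" and u: "\<forall>i\<in>{1..m}. 0 < u i \<and> 0 < w i"
  shows "mixed u w (\<lambda>x. F (c *\<^sub>R x)) = ennreal (c powr - hdim u) * mixed u w F"
proof -
  have "c powr - hdim u * c powr hdim u = 1"
    using c by (simp add: powr_minus)
  moreover have "mixed u w F = ennreal (c powr hdim u) * mixed u w (\<lambda>x. F (c *\<^sub>R x))"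
    using F c u by (intro mixed_scale) auto
  ultimately show ?thesis
    using c by (simp add: mult.assoc[symmetric] flip: ennreal_mult)
qed

text \<open>Along almost every ray the exceptional set of a Borel version is met only for a null set
  of \<open>t\<close>. By Minkowski the norm of the integral over \<open>t\<close> is at most an
  integral of norms of dilates of a null set, which vanish. The exponent 2 stands for any exponent
  above 1.\<close>

lemma AE_dilate_notin:
  assumes N: "N \<in> null_sets lborel"
  shows "AE x :: real ^ 'n in lborel. AE t in lborel. t \<in> {0<..1} \<longrightarrow> t *\<^sub>R x \<notin> N"
proof -
  have [measurable]: "N \<in> sets borel" using N by auto
  let ?F = "\<lambda>(t :: real) x. indicator {0<..1} t * indicator N (t *\<^sub>R x) :: ennreal"
  let ?two = "\<lambda>_. 2 :: real"
  have zero: "mixed ?two ?two (?F t) = 0" for t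
  proof (cases "t \<in> {0<..1}")
    case True
    have "mixed ?two ?two (indicator N) = 0"
      using N by (subst mixed_eq_0_iff) (auto dest: AE_not_in simp: indicator_eq_0_iff)
    then have "mixed ?two ?two (\<lambda>x. indicator N (t *\<^sub>R x)) = 0"
      using True by (subst mixed_dilate) auto
    then show ?thesis using True by simp
  next
    case False
    then show ?thesis by (subst mixed_eq_0_iff) auto
  qed
  have "mixed ?two ?two (\<lambda>x. \<integral>\<^sup>+t. ?F t x \<partial>lborel) \<le> (\<integral>\<^sup>+t. mixed ?two ?two (?F t) \<partial>lborel)"
    by (intro mixed_Minkowski sigma_finite_lborel) auto
  also have "\<dots> = 0" by (simp add: zero)
  finally have "AE x in lborel. (\<integral>\<^sup>+t. ?F t x \<partial>lborel) = 0"
    by (subst (asm) le_zero_eq, subst (asm) mixed_eq_0_iff) auto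
  then show ?thesis
  proof eventually_elim
    case (elim x)
    then have "AE t in lborel. ?F t x = 0"
      by (subst (asm) nn_integral_0_iff_AE) auto
    then show ?case by eventually_elim (auto simp: indicator_def split: if_splits)
  qed
qed

end

section \<open>Oscillation of a fixed function \<open>b\<close> and comparison of its means\<close>

locale cmo_function = dunkl_blocks +
  fixes u w :: "nat \<Rightarrow> real" and lam :: real and b :: "real ^ 'a \<Rightarrow> complex" and N :: "(real ^ 'a) set"
  assumes u: "\<And>i. i \<in> {1..m} \<Longrightarrow> 1 < u i \<and> 1 < w i" and lam_pos: "0 < lam"
    and b: "b \<in> cmo_space blk k m u w lam"
    and N: "N \<in> null_sets lborel"
    and b_borel: "(\<lambda>x. if x \<in> N then 0 else b x) \<in> borel_measurable borel"
begin

text \<open>Vanishing on \<open>N\<close> makes \<open>osc c\<close> Borel and everywhere at most \<open>|b - c|\<close>.\<close>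

definition osc :: "complex \<Rightarrow> real ^ 'a \<Rightarrow> ennreal" where
  "osc c x = ennreal (norm (b x - c)) * indicator (- N) x"

definition K :: ennreal where
  "K = cmo_norm blk k m u w lam b"

abbreviation "D \<equiv> hom_dim k"

lemma u_pos: "\<forall>i\<in>{1..m}. 0 < u i \<and> 0 < w i"
  using u by fastforce

lemma N_borel [measurable]: "N \<in> sets borel"
  using N by auto

lemma osc_measurable [measurable]: "osc c \<in> borel_measurable borel"
proof -
  have "osc c = (\<lambda>x. ennreal (norm ((if x \<in> N then 0 else b x) - c)) * indicator (- N) x)"
    by (auto simp: osc_def fun_eq_iff)
  also have "\<dots> \<in> borel_measurable borel"
    using b_borel by measurable
  finally show ?thesis .
qed

lemma K_finite: "K < \<infinity>"
  using b by (simp add: K_def cmo_space_def)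

lemma osc_triangle: "osc c x \<le> osc d x + ennreal (norm (d - c))"
  using norm_triangle_ineq[of "b x - d" "d - c"]
  by (auto simp: osc_def indicator_def simp flip: ennreal_plus intro!: ennreal_leI)

definition osc_const :: real where
  "osc_const = vol powr lam * ball_const u w"

lemma osc_const_nonneg: "0 \<le> osc_const"
  using ball_const_pos[OF u_pos] by (simp add: osc_const_def)

lemma mixed_osc_ball:
  assumes R: "0 < R"
  shows "mixed u w (\<lambda>x. osc (ball_mean k b R) x * indicator (ball 0 R) x) \<le>
    K * ennreal (osc_const * R powr (D * lam + hdim u))"
proof -
  have "central_quotient blk k m u w lam (\<lambda>x. b x - ball_mean k b R) R \<le> K"
    unfolding K_def cmo_norm_def using R by (intro SUP_upper) auto
  then have "mixed u w (\<lambda>x. ennreal (norm (b x - ball_mean k b R)) * indicator (ball 0 R) x) \<le>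
      K * ennreal (osc_const * R powr (D * lam + hdim u))"
    unfolding osc_const_def using central_quotient_le_iff[OF u_pos R] by auto
  moreover have "mixed u w (\<lambda>x. osc (ball_mean k b R) x * indicator (ball 0 R) x) \<le>
      mixed u w (\<lambda>x. ennreal (norm (b x - ball_mean k b R)) * indicator (ball 0 R) x)"
    using u_pos by (intro mixed_mono) (auto simp: osc_def indicator_def)
  ultimately show ?thesis by (rule order_trans[rotated])
qed

definition dual :: "(nat \<Rightarrow> real) \<Rightarrow> nat \<Rightarrow> real" where
  "dual p i = p i / (p i - 1)"

lemma dual: "1 < p i \<Longrightarrow> 0 < dual p i \<and> 1 = 1 / p i + 1 / dual p i"
  by (simp add: dual_def field_simps)

text \<open>The powers of \<open>R\<close> from the oscillation and from the dual norm of the ball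
  thereby combine to \<open>R powr D\<close>, which the volume cancels.\<close>

lemma hdim_dual: "hdim u + hdim (dual u) = D"
proof -
  have "hdim u + hdim (dual u) = (\<Sum>i=1..m. bdim i * (1 / u i + 1 / dual u i))"
    by (simp add: hdim_def sum.distrib[symmetric] algebra_simps)
  also have "\<dots> = (\<Sum>i=1..m. bdim i / 1)"
    using u dual by (intro sum.cong) (auto simp flip: dual)
  finally show ?thesis by (simp add: hdim_one[symmetric] hdim_def)
qed

text \<open>The oscillation constant times the dual norm of the unit ball, divided by the measure
  \<open>vol * 2 powr - D\<close> of the ball of radius \<open>1 / 2\<close>.\<close>

definition mean_const :: real where
  "mean_const = osc_const * ball_const (dual u) (dual w) * 2 powr D / vol"

lemma mean_const_nonneg: "0 \<le> mean_const"
  using osc_const_nonneg vol_pos by (simp add: mean_const_def ball_const_def)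

lemma set_integrable_ball: "set_integrable (dunkl_measure k) (ball 0 R) b"
proof (rule set_integrable_subset)
  show "set_integrable (dunkl_measure k) (cball 0 R) b"
    using b by (simp add: cmo_space_def)
qed (auto simp: dunkl_measure_def)

text \<open>The difference is the mean of \<open>b - ball_mean k b R\<close> over the smaller ball.
  Hoelder with dual exponents bounds the integral over the larger ball, and
  \<open>s >= 1 / 2\<close> bounds the volume of the smaller one from below.\<close>

lemma ball_mean_step:
  assumes R: "0 < R" and s: "1 / 2 \<le> s" "s \<le> 1"
  shows "ennreal (norm (ball_mean k b (s * R) - ball_mean k b R)) \<le> K * ennreal (mean_const * R powr (D * lam))"
proof -
  let ?M = "dunkl_measure k" and ?B = "ball 0 (s * R) :: (real ^ 'a) set"
  define c where "c = ball_mean k b R"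
  have sR: "0 < s * R" using R s by simp
  have B: "?B \<in> sets ?M" "emeasure ?M ?B < \<infinity>"
    using emeasure_ball[OF sR] by (auto simp: dunkl_measure_def)
  define V where "V = measure ?M ?B"
  have V: "V = vol * (s * R) powr D" "V > 0"
    using measure_ball[OF sR] vol_pos R s by (auto simp: V_def intro!: mult_pos_pos)
  have const: "set_integrable ?M ?B (\<lambda>_. c)"
    using B unfolding set_integrable_def by (intro integrable_scaleR_left integrable_real_indicator) auto
  have int: "set_integrable ?M ?B (\<lambda>x. b x - c)"
    using set_integrable_ball const by (rule set_integral_diff)
  have "(LINT x:?B|?M. b x - c) = (LINT x:?B|?M. b x) - (LINT x:?B|?M. c)"
    using set_integrable_ball const by (rule set_integral_diff)
  also have "(LINT x:?B|?M. c) = complex_of_real V * c"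
    using B by (simp add: set_lebesgue_integral_def V_def scaleR_conv_of_real)
  also have "(LINT x:?B|?M. b x) = complex_of_real V * ball_mean k b (s * R)"
    using V(2) by (simp add: ball_mean_def V_def)
  finally have diff: "(LINT x:?B|?M. b x - c) = complex_of_real V * (ball_mean k b (s * R) - c)"
    by (simp add: algebra_simps)
  have "ennreal (norm (LINT x:?B|?M. b x - c)) \<le> (\<integral>\<^sup>+x. norm (indicator ?B x *\<^sub>R (b x - c)) \<partial>?M)"
    using int unfolding set_integrable_def set_lebesgue_integral_def by (rule integral_norm_bound_ennreal)
  \<comment> \<open>The indicator is doubled so that each of the two Hoelder factors keeps one
    copy.\<close>
  also have "\<dots> \<le> (\<integral>\<^sup>+x. osc c x * indicator (ball 0 R) x * indicator (ball 0 R) x \<partial>?M)"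
  proof (rule nn_integral_mono_AE)
    have "AE x in ?M. x \<notin> N"
      using N by (rule AE_dunkl_measureI[OF AE_not_in])
    then show "AE x in ?M. ennreal (norm (indicator ?B x *\<^sub>R (b x - c))) \<le>
        osc c x * indicator (ball 0 R) x * indicator (ball 0 R) x"
    proof eventually_elim
      case (elim x)
      have "s * R \<le> R" using s R by simp
      then show ?case using elim by (auto simp: osc_def indicator_def)
    qed
  qed
  also have "\<dots> = mixed (\<lambda>_. 1) (\<lambda>_. 1) (\<lambda>x. osc c x * indicator (ball 0 R) x * indicator (ball 0 R) x)"
    by (simp add: nn_integral_dunkl_measure mixed_one_one)
  also have "\<dots> \<le> mixed u w (\<lambda>x. osc c x * indicator (ball 0 R) x) *
      mixed (dual u) (dual w) (indicator (ball 0 R))"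
    using u_pos dual u by (intro mixed_Hoelder) auto
  also have "\<dots> \<le> (K * ennreal (osc_const * R powr (D * lam + hdim u))) *
      ennreal (ball_const (dual u) (dual w) * R powr hdim (dual u))"
    using dual u R mixed_osc_ball[OF R] by (subst mixed_ball) (auto simp: c_def intro!: mult_right_mono)
  also have "\<dots> = K * ennreal (osc_const * ball_const (dual u) (dual w) * R powr (D * lam + D))"
  proof -
    have eq: "(osc_const * R powr (D * lam + hdim u)) * (ball_const (dual u) (dual w) * R powr hdim (dual u)) =
        osc_const * ball_const (dual u) (dual w) * R powr (D * lam + D)"
      by (simp add: add.assoc hdim_dual flip: powr_add)
    show ?thesis
      unfolding eq[symmetric] using osc_const_nonneg
      by (simp add: mult.assoc[of K] ennreal_mult ball_const_nonneg)
  qed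
  finally have le: "ennreal (norm (LINT x:?B|?M. b x - c)) \<le>
      K * ennreal (osc_const * ball_const (dual u) (dual w) * R powr (D * lam + D))" .
  have VR: "vol * R powr D * 2 powr - D \<le> V"
  proof -
    have "(R / 2) powr D \<le> (s * R) powr D"
      using R s hom_dim_pos by (intro powr_mono2) auto
    also have "(R / 2) powr D = R powr D * 2 powr - D"
      using R by (simp add: powr_divide powr_minus_divide)
    finally have "vol * (R powr D * 2 powr - D) \<le> vol * (s * R) powr D"
      using vol_pos by (intro mult_left_mono) auto
    then show ?thesis
      by (simp only: V(1) mult.assoc)
  qed
  have "ennreal (norm (ball_mean k b (s * R) - c)) \<le>
      K * ennreal ((osc_const * ball_const (dual u) (dual w) * R powr (D * lam + D)) / (vol * R powr D * 2 powr - D))"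
  proof (rule ennreal_le_divideI[OF _ _ le])
    show "norm (ball_mean k b (s * R) - c) * (vol * R powr D * 2 powr - D) \<le> norm (LINT x:?B|?M. b x - c)"
    proof -
      have "norm (LINT x:?B|?M. b x - c) = norm (ball_mean k b (s * R) - c) * V"
        unfolding diff norm_mult using V(2) by simp
      then show ?thesis using mult_left_mono[OF VR norm_ge_zero] by simp
    qed
    show "0 < vol * R powr D * 2 powr - D" using R vol_pos by simp
    show "0 \<le> osc_const * ball_const (dual u) (dual w) * R powr (D * lam + D)"
      using osc_const_nonneg by (simp add: ball_const_def)
  qed
  also have "(osc_const * ball_const (dual u) (dual w) * R powr (D * lam + D)) / (vol * R powr D * 2 powr - D) =
      mean_const * R powr (D * lam)"
    unfolding mean_const_def powr_add using R by (simp add: powr_minus_divide)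
  finally show ?thesis by (simp add: c_def)
qed

text \<open>The sum of the geometric series with first term \<open>mean_const\<close> and ratio
  \<open>2 powr - (D * lam)\<close>; being a fixed point of one further halving, it closes the
  induction below.\<close>

definition tele_const :: real where
  "tele_const = mean_const / (1 - 2 powr - (D * lam))"

lemma tele_factor: "2 powr - (D * lam) < 1"
  using powr_less_mono[of "- (D * lam)" 0 2] lam_pos hom_dim_pos by simp

lemma tele_const: "tele_const * 2 powr - (D * lam) + mean_const = tele_const" "mean_const \<le> tele_const"
proof -
  let ?q = "2 powr - (D * lam)"
  have eq: "tele_const * (1 - ?q) = mean_const"
    using tele_factor lam_pos hom_dim_pos by (simp add: tele_const_def)
  then show "tele_const * ?q + mean_const = tele_const"
    by (simp add: algebra_simps)
  have "0 \<le> tele_const"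
    using tele_factor mean_const_nonneg by (simp add: tele_const_def)
  then have "0 \<le> tele_const * ?q" by simp
  with eq show "mean_const \<le> tele_const" by (simp add: algebra_simps)
qed

lemma tele_const_nonneg: "0 \<le> tele_const"
  using tele_const(2) mean_const_nonneg by simp

text \<open>Halving the radius until \<open>t R\<close> is reached produces a geometric series, as \<open>lam > 0\<close>.\<close>

lemma ball_mean_dilate:
  assumes "0 < R" "0 < t" "t \<le> 1"
  shows "ennreal (norm (ball_mean k b (t * R) - ball_mean k b R)) \<le> K * ennreal (tele_const * R powr (D * lam))"
proof -
  \<comment> \<open>\<open>j\<close> bounds the number of halvings; \<open>j = 0\<close> contradicts
    \<open>t \<le> 1\<close>.\<close>
  obtain j :: nat where "(1 / 2) ^ j < t"
    using real_arch_pow_inv[of t "1 / 2"] assms by auto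
  then show ?thesis using assms
  proof (induction j arbitrary: t R)
    case 0
    then show ?case by simp
  next
    case (Suc j)
    show ?case
    proof (cases "1 / 2 \<le> t")
      case True
      have "ennreal (norm (ball_mean k b (t * R) - ball_mean k b R)) \<le> K * ennreal (mean_const * R powr (D * lam))"
        using Suc True by (intro ball_mean_step) auto
      also have "\<dots> \<le> K * ennreal (tele_const * R powr (D * lam))"
        using tele_const(2) by (intro mult_left_mono ennreal_leI mult_right_mono) auto
      finally show ?thesis .
    next
      case False
      \<comment> \<open>Passing to \<open>2 * t\<close> and \<open>R / 2\<close> leaves the inner
        radius \<open>t * R\<close> unchanged and lowers \<open>j\<close> by one.\<close>
      have "norm (ball_mean k b (t * R) - ball_mean k b R) \<le>
          norm (ball_mean k b ((2 * t) * (R / 2)) - ball_mean k b (R / 2)) +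
          norm (ball_mean k b (1 / 2 * R) - ball_mean k b R)"
        using norm_triangle_ineq[of "ball_mean k b (t * R) - ball_mean k b (R / 2)" "ball_mean k b (R / 2) - ball_mean k b R"]
        by simp
      then have "ennreal (norm (ball_mean k b (t * R) - ball_mean k b R)) \<le>
          ennreal (norm (ball_mean k b ((2 * t) * (R / 2)) - ball_mean k b (R / 2))) +
          ennreal (norm (ball_mean k b (1 / 2 * R) - ball_mean k b R))"
        by (simp flip: ennreal_plus add: ennreal_leI)
      also have "\<dots> \<le> K * ennreal (tele_const * (R / 2) powr (D * lam)) + K * ennreal (mean_const * R powr (D * lam))"
        using Suc False by (intro add_mono Suc.IH ball_mean_step) auto
      also have "\<dots> = K * ennreal (tele_const * (R / 2) powr (D * lam) + mean_const * R powr (D * lam))"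
        using tele_const_nonneg mean_const_nonneg by (simp add: distrib_left ennreal_plus)
      also have "tele_const * (R / 2) powr (D * lam) + mean_const * R powr (D * lam) =
          (tele_const * 2 powr - (D * lam) + mean_const) * R powr (D * lam)"
        using Suc.prems by (simp add: powr_divide powr_minus field_simps)
      finally show ?thesis by (simp only: tele_const)
    qed
  qed
qed

text \<open>The first summand is for the oscillation about the mean of the dilated ball, the second
  for the difference of means times the norm of that ball.\<close>

definition total_const :: real where
  "total_const = osc_const + tele_const * ball_const u w"

lemma total_const_nonneg: "0 \<le> total_const"
  using osc_const_nonneg tele_const_nonneg by (simp add: total_const_def ball_const_def)

text \<open>After dilation to \<open>tB\<close> the mean of \<open>tB\<close> is inserted. The
  factor \<open>t powr - hdim u\<close> cancels against the norm of \<open>tB\<close> in the term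
  with the means, and leaves \<open>t powr (D * lam)\<close>, at most 1, in the other; the bound is
  therefore uniform in \<open>t\<close>.\<close>

lemma mixed_osc_dilate:
  assumes R: "0 < R" and t: "0 < t" "t \<le> 1"
  shows "mixed u w (\<lambda>x. osc (ball_mean k b R) (t *\<^sub>R x) * indicator (ball 0 R) x) \<le>
    K * ennreal (total_const * R powr (D * lam + hdim u))"
proof -
  let ?B = "ball 0 (t * R) :: (real ^ 'a) set"
  define c where "c = ball_mean k b R"
  define d where "d = ball_mean k b (t * R)"
  have tR: "0 < t * R" using R t by simp
  have "(\<lambda>x. osc c (t *\<^sub>R x) * indicator (ball 0 R) x) = (\<lambda>x. osc c (t *\<^sub>R x) * indicator ?B (t *\<^sub>R x))"
    using t by (auto simp: indicator_def fun_eq_iff)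
  then have "mixed u w (\<lambda>x. osc c (t *\<^sub>R x) * indicator (ball 0 R) x) =
      ennreal (t powr - hdim u) * mixed u w (\<lambda>x. osc c x * indicator ?B x)"
    using t u_pos mixed_dilate[of "\<lambda>x. osc c x * indicator ?B x" t u w] by simp
  also have "mixed u w (\<lambda>x. osc c x * indicator ?B x) \<le>
      mixed u w (\<lambda>x. osc d x * indicator ?B x + ennreal (norm (d - c)) * indicator ?B x)"
    using osc_triangle[of c _ d] u_pos by (intro mixed_mono) (auto simp: indicator_def)
  also have "\<dots> \<le> mixed u w (\<lambda>x. osc d x * indicator ?B x) + mixed u w (\<lambda>x. ennreal (norm (d - c)) * indicator ?B x)"
    using u by (intro mixed_add) auto
  also have "mixed u w (\<lambda>x. ennreal (norm (d - c)) * indicator ?B x) = ennreal (norm (d - c)) * mixed u w (indicator ?B)"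
    using u_pos by (intro mixed_cmult) auto
  also have "mixed u w (\<lambda>x. osc d x * indicator ?B x) + ennreal (norm (d - c)) * mixed u w (indicator ?B) \<le>
      K * ennreal (osc_const * (t * R) powr (D * lam + hdim u)) +
      (K * ennreal (tele_const * R powr (D * lam))) * ennreal (ball_const u w * (t * R) powr hdim u)"
    unfolding mixed_ball[OF u_pos tR] d_def c_def
    by (intro add_mono mult_mono mixed_osc_ball ball_mean_dilate R t tR) auto
  also have "\<dots> = K * ennreal (osc_const * (t * R) powr (D * lam + hdim u) +
      tele_const * R powr (D * lam) * (ball_const u w * (t * R) powr hdim u))"
    using osc_const_nonneg tele_const_nonneg
    by (simp add: distrib_left ennreal_plus ball_const_def ennreal_mult mult.assoc)
  finally have "mixed u w (\<lambda>x. osc c (t *\<^sub>R x) * indicator (ball 0 R) x) \<le>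
      ennreal (t powr - hdim u) * (K * ennreal (osc_const * (t * R) powr (D * lam + hdim u) +
      tele_const * R powr (D * lam) * (ball_const u w * (t * R) powr hdim u)))"
    by (simp add: mult_left_mono)
  also have "\<dots> = K * ennreal (t powr - hdim u * (osc_const * (t * R) powr (D * lam + hdim u) +
      tele_const * R powr (D * lam) * (ball_const u w * (t * R) powr hdim u)))"
    by (simp add: mult.left_commute ennreal_mult')
  also have "\<dots> \<le> K * ennreal (total_const * R powr (D * lam + hdim u))"
  proof (intro mult_left_mono ennreal_leI)
    have "t powr - hdim u * (osc_const * (t * R) powr (D * lam + hdim u) +
        tele_const * R powr (D * lam) * (ball_const u w * (t * R) powr hdim u)) =
      osc_const * R powr (D * lam + hdim u) * t powr (D * lam) + tele_const * ball_const u w * R powr (D * lam + hdim u)"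
      using t R by (simp add: powr_mult powr_add powr_minus field_simps)
    also have "\<dots> \<le> osc_const * R powr (D * lam + hdim u) * 1 + tele_const * ball_const u w * R powr (D * lam + hdim u)"
      using t osc_const_nonneg lam_pos hom_dim_pos by (intro add_right_mono mult_left_mono powr_le1) auto
    also have "\<dots> = total_const * R powr (D * lam + hdim u)"
      by (simp add: total_const_def algebra_simps)
    finally show "t powr - hdim u * (osc_const * (t * R) powr (D * lam + hdim u) +
        tele_const * R powr (D * lam) * (ball_const u w * (t * R) powr hdim u)) \<le>
        total_const * R powr (D * lam + hdim u)" .
  qed simp
  finally show ?thesis by (simp add: c_def)
qed

end

section \<open>The commutator\<close>

lemma AE_lborel_null_setE:
  assumes "AE x in lborel. P x"
  obtains N where "N \<in> null_sets lborel" "\<And>x. x \<notin> N \<Longrightarrow> P x"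
proof -
  from assms obtain N where N: "{x \<in> space lborel. \<not> P x} \<subseteq> N" "emeasure lborel N = 0" "N \<in> sets lborel"
    by (rule AE_E)
  from N(2,3) have "N \<in> null_sets lborel" by (rule null_setsI)
  moreover have "P x" if "x \<notin> N" for x using N(1) that by auto
  ultimately show ?thesis by (rule that)
qed

lemma borel_version_complex:
  fixes f :: "'a::euclidean_space \<Rightarrow> complex"
  assumes f: "f \<in> borel_measurable lebesgue"
  obtains N where "N \<in> null_sets lborel" "(\<lambda>x. if x \<in> N then 0 else f x) \<in> borel_measurable borel"
proof -
  have "(\<lambda>x. Re (f x)) \<in> borel_measurable lebesgue" "(\<lambda>x. Im (f x)) \<in> borel_measurable lebesgue"
    using f by simp_all
  from this[THEN completion_ex_borel_measurable_real] obtain g h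
    where [measurable]: "g \<in> borel_measurable lborel" "h \<in> borel_measurable lborel"
      and "AE x in lborel. Re (f x) = g x" "AE x in lborel. Im (f x) = h x"
    by blast
  then have "AE x in lborel. f x = Complex (g x) (h x)"
    by (auto simp: complex_eq_iff)
  then obtain N where N: "N \<in> null_sets lborel" "\<And>x. x \<notin> N \<Longrightarrow> f x = Complex (g x) (h x)"
    by (rule AE_lborel_null_setE) blast
  have [measurable]: "N \<in> sets borel" using N by auto
  have "(\<lambda>x. if x \<in> N then 0 else f x) =
      (\<lambda>x. if x \<in> N then 0 else complex_of_real (g x) + \<i> * complex_of_real (h x))"
    using N(2) by (auto simp: fun_eq_iff Complex_eq)
  also have "\<dots> \<in> borel_measurable borel"
    by measurable
  finally show ?thesis using N that by blast
qed

text \<open>Making the version nonnegative everywhere and zero off \<open>S\<close> allows integrals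
  over \<open>S\<close> to be written over the whole line without a restriction.\<close>

lemma borel_version_nonneg_real:
  fixes \<phi> :: "real \<Rightarrow> real"
  assumes \<phi>: "\<phi> \<in> borel_measurable (lebesgue_on S)" and S [measurable]: "S \<in> sets borel"
    and nonneg: "\<forall>t\<in>S. 0 \<le> \<phi> t"
  obtains \<psi> where "\<psi> \<in> borel_measurable borel" "\<forall>t. 0 \<le> \<psi> t" "\<forall>t. t \<notin> S \<longrightarrow> \<psi> t = 0"
    "AE t in lborel. t \<in> S \<longrightarrow> \<phi> t = \<psi> t"
proof -
  have "S \<in> sets lebesgue" by (simp add: sets_completionI_sets)
  then have "(\<lambda>t. indicator S t *\<^sub>R \<phi> t) \<in> borel_measurable lebesgue"
    using \<phi> by (subst (asm) borel_measurable_restrict_space_iff) auto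
  then obtain g where [measurable]: "g \<in> borel_measurable lborel" and g: "AE t in lborel. indicator S t *\<^sub>R \<phi> t = g t"
    using completion_ex_borel_measurable_real by blast
  show ?thesis
  proof (rule that[of "\<lambda>t. if t \<in> S then max 0 (g t) else 0"])
    show "AE t in lborel. t \<in> S \<longrightarrow> \<phi> t = (if t \<in> S then max 0 (g t) else 0)"
      using g
    proof eventually_elim
      case (elim t)
      then show ?case using nonneg by (auto simp: indicator_def)
    qed
  qed auto
qed

text \<open>\<open>b\<close> is the pointwise limit of its restrictions to closed balls, and a
  density has the same measurable sets as the measure it is taken from.\<close>

lemma set_integrable_imp_lebesgue_measurable:
  fixes b :: "real ^ 'n \<Rightarrow> complex"
  assumes "\<And>K. compact K \<Longrightarrow> set_integrable (dunkl_measure k) K b"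
  shows "b \<in> borel_measurable lebesgue"
proof (rule borel_measurable_LIMSEQ_metric)
  fix i :: nat
  have "set_integrable (dunkl_measure k) (cball 0 (real i)) b"
    by (intro assms) auto
  then have "(\<lambda>x. indicator (cball 0 (real i)) x *\<^sub>R b x) \<in> borel_measurable (dunkl_measure k)"
    unfolding set_integrable_def by (rule borel_measurable_integrable)
  then show "(\<lambda>x. indicator (cball 0 (real i)) x *\<^sub>R b x) \<in> borel_measurable lebesgue"
    by (simp add: dunkl_measure_def)
next
  fix x :: "real ^ 'n"
  obtain j :: nat where "norm x \<le> real j" using real_arch_simple by blast
  then have "\<forall>\<^sub>F i in sequentially. indicator (cball 0 (real i)) x *\<^sub>R b x = b x"
    by (intro eventually_sequentiallyI[of j]) (auto simp: indicator_def)
  then show "(\<lambda>i. indicator (cball 0 (real i)) x *\<^sub>R b x) \<longlonglongrightarrow> b x"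
    by (rule tendsto_eventually)
qed

section \<open>The averaging operator and the constants for a fixed \<open>b\<close>\<close>

locale hardy_commutator = cmo_function blk k m r2 s2 lam2 b N
  for blk :: "'n::finite \<Rightarrow> nat" and k :: "real ^ 'n" and m :: nat and r2 s2 :: "nat \<Rightarrow> real"
    and lam2 :: real and b :: "real ^ 'n \<Rightarrow> complex" and N :: "(real ^ 'n) set" +
  fixes r r1 s s1 :: "nat \<Rightarrow> real" and lam1 :: real and \<phi> \<psi> :: "real \<Rightarrow> real"
  assumes r: "\<forall>i\<in>{1..m}. 1 < r i \<and> 1 < r1 i \<and> 1 / r i = 1 / r1 i + 1 / r2 i"
    and s: "\<forall>i\<in>{1..m}. 1 < s i \<and> 1 < s1 i \<and> 1 / s i = 1 / s1 i + 1 / s2 i"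
    and \<psi> [measurable]: "\<psi> \<in> borel_measurable borel"
    and \<psi>_nonneg: "\<And>t. 0 \<le> \<psi> t" and \<psi>_0: "\<And>t. t \<notin> {0<..1} \<Longrightarrow> \<psi> t = 0"
    and \<phi>: "AE t in lborel. t \<in> {0<..1} \<longrightarrow> \<phi> t = \<psi> t"
    and finite_moment: "(\<integral>\<^sup>+t. ennreal (t powr (hom_dim k * lam1) * \<psi> t) \<partial>lborel) < \<infinity>"
begin

definition \<Phi> :: ennreal where
  "\<Phi> = (\<integral>\<^sup>+t. ennreal (t powr (D * lam1) * \<psi> t) \<partial>lborel)"

text \<open>The Hardy operator for Borel data: the integrand is jointly Borel in \<open>t\<close>
  and \<open>x\<close>, so \<open>H g\<close> is Borel when \<open>g\<close> is.\<close>

definition H :: "(real ^ 'n \<Rightarrow> complex) \<Rightarrow> real ^ 'n \<Rightarrow> complex" where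
  "H g x = (LINT t|lborel. g (t *\<^sub>R x) * complex_of_real (\<psi> t))"

lemma exponents_pos:
  "\<forall>i\<in>{1..m}. 0 < r i \<and> 0 < s i" "\<forall>i\<in>{1..m}. 0 < r1 i \<and> 0 < s1 i"
  using r s by fastforce+

lemma hdim_r: "hdim r = hdim r1 + hdim r2"
proof -
  have "hdim r = (\<Sum>i=1..m. bdim i * (1 / r i))" by (simp add: hdim_def)
  also have "\<dots> = (\<Sum>i=1..m. bdim i * (1 / r1 i + 1 / r2 i))"
    using r by (intro sum.cong) auto
  finally show ?thesis by (simp add: hdim_def distrib_left sum.distrib)
qed

lemma H_measurable [measurable]:
  assumes [measurable]: "g \<in> borel_measurable borel"
  shows "H g \<in> borel_measurable borel"
  unfolding H_def by measurable

text \<open>On the ray through \<open>x\<close> both integrands agree for almost every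
  \<open>t\<close>, and integrals over Borel and completed Lebesgue measure coincide for a Borel
  integrand.\<close>

lemma hardy_eq_H:
  assumes g0 [measurable]: "g0 \<in> borel_measurable borel"
    and eq: "AE t in lborel. t \<in> {0<..1} \<longrightarrow> g (t *\<^sub>R x) = g0 (t *\<^sub>R x)"
    and fin: "(\<integral>\<^sup>+t. ennreal (norm (g0 (t *\<^sub>R x))) * ennreal (\<psi> t) \<partial>lborel) < \<infinity>"
  shows "integrable lborel (\<lambda>t. g0 (t *\<^sub>R x) * complex_of_real (\<psi> t))"
    and "hardy_defined \<phi> g x" and "hardy \<phi> g x = H g0 x"
proof -
  let ?h = "\<lambda>t. g0 (t *\<^sub>R x) * complex_of_real (\<psi> t)"
  let ?k = "\<lambda>t. indicator {0<..1} t *\<^sub>R (g (t *\<^sub>R x) * complex_of_real (\<phi> t))"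
  show int: "integrable lborel ?h"
    using fin \<psi>_nonneg by (intro integrableI_bounded) (auto simp: norm_mult ennreal_mult)
  have "AE t in lborel. ?h t = ?k t"
    using eq \<phi>
  proof eventually_elim
    case (elim t)
    then show ?case using \<psi>_0[of t] by (cases "t \<in> {0<..1}") auto
  qed
  then have ae: "AE t in lebesgue. ?h t = ?k t"
    by (rule AE_completion)
  have h: "?h \<in> borel_measurable lebesgue"
    by (rule measurable_completion) measurable
  have k: "?k \<in> borel_measurable lebesgue"
    using h ae by (rule borel_measurable_AE)
  have "integrable lebesgue ?h"
    using int by (subst integrable_completion) auto
  then show "hardy_defined \<phi> g x"
    unfolding hardy_defined_def set_integrable_def
    using integrable_cong_AE[OF h k ae] by simp
  show "hardy \<phi> g x = H g0 x"
    unfolding hardy_def set_lebesgue_integral_def H_def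
    using integral_cong_AE[OF h k ae] integral_completion[of ?h lborel] by simp
qed

definition f_const :: real where
  "f_const = vol powr lam1 * ball_const r1 s1"

text \<open>\<open>osc_const\<close> belongs to the oscillation at \<open>x\<close>,
  \<open>total_const\<close> to that at \<open>t *\<^sub>R x\<close>, and \<open>f_const\<close> to
  the Morrey bound for \<open>f\<close>.\<close>

definition comm_const :: real where
  "comm_const = (osc_const + total_const) * f_const"

text \<open>The denominator is the normalisation of the target Morrey norm on the unit ball. No
  quantity here depends on \<open>f\<close>, so one constant serves the whole space.\<close>

definition op_const :: real where
  "op_const = enn2real K * comm_const * enn2real \<Phi> / (vol powr (lam1 + lam2) * ball_const r s)"

lemma f_const_nonneg: "0 \<le> f_const"
  by (simp add: f_const_def)

lemma comm_const_nonneg: "0 \<le> comm_const"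
  using f_const_nonneg osc_const_nonneg total_const_nonneg by (simp add: comm_const_def)

text \<open>Minkowski's inequality for the average over \<open>t\<close>. As \<psi> vanishes off
  \<open>{0<..1}\<close>, the bound is required only there, and its power of \<open>t\<close>
  integrates to \<Phi>.\<close>

lemma mixed_average:
  fixes W :: "real \<Rightarrow> real ^ 'n \<Rightarrow> ennreal"
  assumes W [measurable]: "case_prod W \<in> borel_measurable (borel \<Otimes>\<^sub>M borel)"
    and u: "\<forall>i\<in>{1..m}. 1 < u i \<and> 1 < w i"
    and le: "\<And>t. 0 < t \<Longrightarrow> t \<le> 1 \<Longrightarrow> mixed u w (\<lambda>x. W t x * indicator A x) \<le> C * ennreal (t powr (D * lam1))"
    and A [measurable]: "A \<in> sets borel"
  shows "mixed u w (\<lambda>x. (\<integral>\<^sup>+t. W t x * ennreal (\<psi> t) \<partial>lborel) * indicator A x) \<le> C * \<Phi>"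
proof -
  have u0: "\<forall>i\<in>{1..m}. 0 < u i \<and> 0 < w i" using u by fastforce
  have "mixed u w (\<lambda>x. (\<integral>\<^sup>+t. W t x * ennreal (\<psi> t) \<partial>lborel) * indicator A x) =
      mixed u w (\<lambda>x. \<integral>\<^sup>+t. ennreal (\<psi> t) * (W t x * indicator A x) \<partial>lborel)"
    by (intro arg_cong[where f = "mixed u w"] ext) (subst nn_integral_multc[symmetric], auto simp: mult_ac)
  also have "\<dots> \<le> (\<integral>\<^sup>+t. mixed u w (\<lambda>x. ennreal (\<psi> t) * (W t x * indicator A x)) \<partial>lborel)"
    using u by (intro mixed_Minkowski sigma_finite_lborel) auto
  also have "\<dots> \<le> (\<integral>\<^sup>+t. C * ennreal (t powr (D * lam1) * \<psi> t) \<partial>lborel)"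
  proof (rule nn_integral_mono)
    fix t :: real
    have "mixed u w (\<lambda>x. ennreal (\<psi> t) * (W t x * indicator A x)) = ennreal (\<psi> t) * mixed u w (\<lambda>x. W t x * indicator A x)"
      using u0 by (intro mixed_cmult) auto
    also have "\<dots> \<le> ennreal (\<psi> t) * (C * ennreal (t powr (D * lam1)))"
      using le[of t] \<psi>_0[of t] by (cases "t \<in> {0<..1}") (auto intro!: mult_left_mono)
    also have "\<dots> = C * ennreal (t powr (D * lam1) * \<psi> t)"
      using \<psi>_nonneg by (simp add: ennreal_mult mult_ac)
    finally show "mixed u w (\<lambda>x. ennreal (\<psi> t) * (W t x * indicator A x)) \<le> C * ennreal (t powr (D * lam1) * \<psi> t)" .
  qed
  also have "\<dots> = C * \<Phi>"
    unfolding \<Phi>_def by (rule nn_integral_cmult) measurable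
  finally show ?thesis .
qed

end

section \<open>Estimates for a fixed \<open>f\<close>\<close>

locale hardy_commutator_fun = hardy_commutator +
  fixes f :: "real ^ 'a \<Rightarrow> complex" and Nf :: "(real ^ 'a) set"
  assumes f: "f \<in> morrey_space blk k m r1 s1 lam1"
    and Nf: "Nf \<in> null_sets lborel"
    and f_borel: "(\<lambda>x. if x \<in> Nf then 0 else f x) \<in> borel_measurable borel"
begin

definition f0 :: "real ^ 'a \<Rightarrow> complex" where
  "f0 x = (if x \<in> Nf then 0 else f x)"

definition b0 :: "real ^ 'a \<Rightarrow> complex" where
  "b0 x = (if x \<in> N then 0 else b x)"

definition F :: "real ^ 'a \<Rightarrow> ennreal" where
  "F x = ennreal (norm (f0 x))"

definition Kf :: ennreal where
  "Kf = morrey_norm blk k m r1 s1 lam1 f"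

lemma f0_measurable [measurable]: "f0 \<in> borel_measurable borel"
  using f_borel by (simp add: f0_def[abs_def])

lemma b0_measurable [measurable]: "b0 \<in> borel_measurable borel"
  using b_borel by (simp add: b0_def[abs_def])

lemma F_measurable [measurable]: "F \<in> borel_measurable borel"
  unfolding F_def by measurable

lemma Kf_finite: "Kf < \<infinity>"
  using f by (simp add: Kf_def morrey_space_def)

text \<open>The origin of the moment condition: dilation contributes
  \<open>t powr - hdim r1\<close>, the Morrey bound on the ball of radius \<open>t * R\<close>
  contributes \<open>t powr (D * lam1 + hdim r1)\<close>.\<close>

lemma mixed_F_dilate:
  assumes R: "0 < R" and t: "0 < t"
  shows "mixed r1 s1 (\<lambda>x. F (t *\<^sub>R x) * indicator (ball 0 R) x) \<le>
    Kf * ennreal (f_const * R powr (D * lam1 + hdim r1)) * ennreal (t powr (D * lam1))"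
proof -
  let ?B = "ball 0 (t * R) :: (real ^ 'a) set"
  have tR: "0 < t * R" using R t by simp
  have "(\<lambda>x. F (t *\<^sub>R x) * indicator (ball 0 R) x) = (\<lambda>x. F (t *\<^sub>R x) * indicator ?B (t *\<^sub>R x))"
    using t by (auto simp: indicator_def fun_eq_iff)
  then have "mixed r1 s1 (\<lambda>x. F (t *\<^sub>R x) * indicator (ball 0 R) x) =
      ennreal (t powr - hdim r1) * mixed r1 s1 (\<lambda>x. F x * indicator ?B x)"
    using t exponents_pos mixed_dilate[of "\<lambda>x. F x * indicator ?B x" t r1 s1] by simp
  also have "mixed r1 s1 (\<lambda>x. F x * indicator ?B x) \<le> mixed r1 s1 (\<lambda>x. ennreal (norm (f x)) * indicator ?B x)"
    using exponents_pos by (intro mixed_mono) (auto simp: F_def f0_def indicator_def)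
  also have "\<dots> \<le> Kf * ennreal (f_const * (t * R) powr (D * lam1 + hdim r1))"
    using morrey_norm_le_iff[OF exponents_pos(2), of lam1 f Kf] tR by (simp add: Kf_def f_const_def)
  finally have "mixed r1 s1 (\<lambda>x. F (t *\<^sub>R x) * indicator (ball 0 R) x) \<le>
      ennreal (t powr - hdim r1) * (Kf * ennreal (f_const * (t * R) powr (D * lam1 + hdim r1)))"
    by (simp add: mult_left_mono)
  also have "\<dots> = Kf * (ennreal (t powr - hdim r1) * ennreal (f_const * (t * R) powr (D * lam1 + hdim r1)))"
    by (rule mult.left_commute)
  also have "ennreal (t powr - hdim r1) * ennreal (f_const * (t * R) powr (D * lam1 + hdim r1)) =
      ennreal (f_const * R powr (D * lam1 + hdim r1) * t powr (D * lam1))"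
  proof -
    have "t powr - hdim r1 * t powr (D * lam1 + hdim r1) = t powr (D * lam1)"
      by (simp flip: powr_add)
    then have "t powr - hdim r1 * (f_const * (t * R) powr (D * lam1 + hdim r1)) =
        f_const * R powr (D * lam1 + hdim r1) * t powr (D * lam1)"
      using R t by (simp add: powr_mult mult_ac)
    then show ?thesis
      using f_const_nonneg by (simp flip: ennreal_mult)
  qed
  finally show ?thesis
    using f_const_nonneg by (simp add: ennreal_mult mult.assoc)
qed

text \<open>Hoelder puts \<open>f\<close> into the norm with exponents \<open>r1\<close>,
  \<open>s1\<close> and both oscillations into that with \<open>r2\<close>, \<open>s2\<close>; the
  indicator is idempotent, so every factor keeps a copy. Additivity of \<open>hdim\<close> and of
  \<open>lam1\<close>, \<open>lam2\<close> gives the power of \<open>R\<close> of the target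
  space.\<close>

lemma mixed_commutator_dilate:
  assumes R: "0 < R" and t: "0 < t" "t \<le> 1" and c: "c = ball_mean k b R"
  shows "mixed r s (\<lambda>x. (osc c x + osc c (t *\<^sub>R x)) * F (t *\<^sub>R x) * indicator (ball 0 R) x) \<le>
    Kf * K * ennreal (comm_const * R powr (D * (lam1 + lam2) + hdim r)) * ennreal (t powr (D * lam1))"
proof -
  let ?B = "ball 0 R :: (real ^ 'a) set"
  let ?O = "\<lambda>x. osc c x * indicator ?B x + osc c (t *\<^sub>R x) * indicator ?B x"
  have "mixed r s (\<lambda>x. (osc c x + osc c (t *\<^sub>R x)) * F (t *\<^sub>R x) * indicator ?B x) =
      mixed r s (\<lambda>x. F (t *\<^sub>R x) * indicator ?B x * ?O x)"
    by (intro arg_cong[where f = "mixed r s"] ext) (auto simp: indicator_def mult.commute)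
  also have "\<dots> \<le> mixed r1 s1 (\<lambda>x. F (t *\<^sub>R x) * indicator ?B x) * mixed r2 s2 ?O"
    using r s u by (intro mixed_Hoelder) fastforce+
  also have "mixed r2 s2 ?O \<le> mixed r2 s2 (\<lambda>x. osc c x * indicator ?B x) +
      mixed r2 s2 (\<lambda>x. osc c (t *\<^sub>R x) * indicator ?B x)"
    using u by (intro mixed_add) auto
  also have "\<dots> \<le> K * ennreal (osc_const * R powr (D * lam2 + hdim r2)) +
      K * ennreal (total_const * R powr (D * lam2 + hdim r2))"
    unfolding c using R t by (intro add_mono mixed_osc_ball mixed_osc_dilate)
  also have "\<dots> = K * ennreal ((osc_const + total_const) * R powr (D * lam2 + hdim r2))"
    using osc_const_nonneg total_const_nonneg
    by (simp add: distrib_left distrib_right ennreal_plus)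
  finally have "mixed r s (\<lambda>x. (osc c x + osc c (t *\<^sub>R x)) * F (t *\<^sub>R x) * indicator ?B x) \<le>
      mixed r1 s1 (\<lambda>x. F (t *\<^sub>R x) * indicator ?B x) *
      (K * ennreal ((osc_const + total_const) * R powr (D * lam2 + hdim r2)))"
    by (simp add: mult_left_mono)
  also have "\<dots> \<le> (Kf * ennreal (f_const * R powr (D * lam1 + hdim r1)) * ennreal (t powr (D * lam1))) *
      (K * ennreal ((osc_const + total_const) * R powr (D * lam2 + hdim r2)))"
    using R t by (intro mult_right_mono mixed_F_dilate) auto
  also have "\<dots> = Kf * K * (ennreal (f_const * R powr (D * lam1 + hdim r1)) *
      ennreal ((osc_const + total_const) * R powr (D * lam2 + hdim r2))) * ennreal (t powr (D * lam1))"
    by (simp only: mult_ac)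
  also have "ennreal (f_const * R powr (D * lam1 + hdim r1)) *
      ennreal ((osc_const + total_const) * R powr (D * lam2 + hdim r2)) =
      ennreal (comm_const * R powr (D * (lam1 + lam2) + hdim r))"
  proof -
    have "R powr (D * lam1 + hdim r1) * R powr (D * lam2 + hdim r2) = R powr (D * (lam1 + lam2) + hdim r)"
      by (simp add: hdim_r algebra_simps flip: powr_add)
    then have "(f_const * R powr (D * lam1 + hdim r1)) * ((osc_const + total_const) * R powr (D * lam2 + hdim r2)) =
        comm_const * R powr (D * (lam1 + lam2) + hdim r)"
      by (simp add: comm_const_def mult_ac)
    then show ?thesis
      using f_const_nonneg osc_const_nonneg total_const_nonneg by (simp flip: ennreal_mult)
  qed
  finally show ?thesis .
qed

definition Favg :: "real ^ 'a \<Rightarrow> ennreal" where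
  "Favg x = (\<integral>\<^sup>+t. F (t *\<^sub>R x) * ennreal (\<psi> t) \<partial>lborel)"

text \<open>By the triangle inequality through \<open>c\<close> this dominates the commutator almost
  everywhere, whatever \<open>c\<close> is; in norm estimates \<open>c\<close> is the mean over the
  ball considered.\<close>

definition Cavg :: "complex \<Rightarrow> real ^ 'a \<Rightarrow> ennreal" where
  "Cavg c x = (\<integral>\<^sup>+t. (osc c x + osc c (t *\<^sub>R x)) * F (t *\<^sub>R x) * ennreal (\<psi> t) \<partial>lborel)"

lemma Favg_measurable [measurable]: "Favg \<in> borel_measurable borel"
  unfolding Favg_def by measurable

lemma Cavg_measurable [measurable]: "Cavg c \<in> borel_measurable borel"
  unfolding Cavg_def by measurable

lemma \<Phi>_finite: "\<Phi> < \<infinity>"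
  using finite_moment by (simp add: \<Phi>_def)

lemma mixed_Favg_finite: "0 < R \<Longrightarrow> mixed r1 s1 (\<lambda>x. Favg x * indicator (ball 0 R) x) < \<infinity>"
proof -
  assume R: "0 < R"
  have "mixed r1 s1 (\<lambda>x. Favg x * indicator (ball 0 R) x) \<le>
      Kf * ennreal (f_const * R powr (D * lam1 + hdim r1)) * \<Phi>"
    unfolding Favg_def using r s R by (intro mixed_average mixed_F_dilate) auto
  also have "\<dots> < \<infinity>"
    using Kf_finite \<Phi>_finite by (simp add: ennreal_mult_less_top)
  finally show ?thesis .
qed

lemma mixed_Cavg:
  assumes R: "0 < R"
  shows "mixed r s (\<lambda>x. Cavg (ball_mean k b R) x * indicator (ball 0 R) x) \<le>
    Kf * K * ennreal (comm_const * R powr (D * (lam1 + lam2) + hdim r)) * \<Phi>"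
  unfolding Cavg_def using r s R by (intro mixed_average mixed_commutator_dilate) auto

text \<open>Finite mixed norms on countably many balls give finiteness almost everywhere on each,
  and these balls exhaust the space; \<open>c\<close> is the mean over a ball containing
  \<open>x\<close>.\<close>

lemma AE_averages_finite:
  "AE x in lborel. Favg x < \<infinity> \<and> (\<exists>c. Cavg c x < \<infinity>)"
proof -
  have F: "AE x in lborel. Favg x * indicator (ball 0 (real (Suc n))) x < \<infinity>" for n
    using exponents_pos by (intro mixed_less_top_AE[of _ r1 s1] mixed_Favg_finite) auto
  have C: "AE x in lborel. Cavg (ball_mean k b (real (Suc n))) x * indicator (ball 0 (real (Suc n))) x < \<infinity>" for n
  proof (rule mixed_less_top_AE[of _ r s])
    have "mixed r s (\<lambda>x. Cavg (ball_mean k b (real (Suc n))) x * indicator (ball 0 (real (Suc n))) x) \<le>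
        Kf * K * ennreal (comm_const * real (Suc n) powr (D * (lam1 + lam2) + hdim r)) * \<Phi>"
      by (rule mixed_Cavg) simp
    also have "\<dots> < \<infinity>"
      using Kf_finite K_finite \<Phi>_finite by (simp add: ennreal_mult_less_top)
    finally show "mixed r s (\<lambda>x. Cavg (ball_mean k b (real (Suc n))) x * indicator (ball 0 (real (Suc n))) x) < \<infinity>" .
  qed (use exponents_pos in auto)
  have "AE x in lborel. \<forall>n. Favg x * indicator (ball 0 (real (Suc n))) x < \<infinity> \<and>
      Cavg (ball_mean k b (real (Suc n))) x * indicator (ball 0 (real (Suc n))) x < \<infinity>"
    using F C by (auto simp: AE_all_countable)
  then show ?thesis
  proof eventually_elim
    case (elim x)
    obtain n :: nat where "norm x < real n" using reals_Archimedean2 by blast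
    then have "x \<in> ball 0 (real (Suc n))" by simp
    then show ?case using elim[rule_format, of n] by auto
  qed
qed

text \<open>Two constants play different parts: a \<open>c\<close> with finite
  \<open>Cavg c x\<close> makes the Hardy integrals converge, after which the estimate holds with
  any \<open>d\<close>.\<close>

lemma commutator_bound:
  assumes x: "x \<notin> N" and tN: "AE t in lborel. t \<in> {0<..1} \<longrightarrow> t *\<^sub>R x \<notin> N"
    and tNf: "AE t in lborel. t \<in> {0<..1} \<longrightarrow> t *\<^sub>R x \<notin> Nf"
    and fin: "Favg x < \<infinity>" "Cavg c x < \<infinity>"
  shows "commutator_defined \<phi> b f x"
    and "commutator \<phi> b f x = b0 x * H f0 x - H (\<lambda>y. b0 y * f0 y) x"
    and "ennreal (norm (commutator \<phi> b f x)) \<le> Cavg d x"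
proof -
  have eq1: "AE t in lborel. t \<in> {0<..1} \<longrightarrow> f (t *\<^sub>R x) = f0 (t *\<^sub>R x)"
    using tNf by eventually_elim (auto simp: f0_def)
  have eq2: "AE t in lborel. t \<in> {0<..1} \<longrightarrow> b (t *\<^sub>R x) * f (t *\<^sub>R x) = b0 (t *\<^sub>R x) * f0 (t *\<^sub>R x)"
    using tNf tN by eventually_elim (auto simp: f0_def b0_def)
  have fin1: "(\<integral>\<^sup>+t. ennreal (norm (f0 (t *\<^sub>R x))) * ennreal (\<psi> t) \<partial>lborel) < \<infinity>"
    using fin(1) by (simp add: Favg_def F_def)
  \<comment> \<open>From \<open>|b(tx)| <= |b(tx) - c| + |c|\<close>, the integral for the product
    \<open>b f\<close> is controlled by \<open>Cavg c x\<close> and a multiple of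
    \<open>Favg x\<close>.\<close>
  have "(\<integral>\<^sup>+t. ennreal (norm (b0 (t *\<^sub>R x) * f0 (t *\<^sub>R x))) * ennreal (\<psi> t) \<partial>lborel) \<le>
      (\<integral>\<^sup>+t. (osc c x + osc c (t *\<^sub>R x)) * F (t *\<^sub>R x) * ennreal (\<psi> t) +
        ennreal (norm c) * (F (t *\<^sub>R x) * ennreal (\<psi> t)) \<partial>lborel)"
  proof (rule nn_integral_mono_AE)
    show "AE t in lborel. ennreal (norm (b0 (t *\<^sub>R x) * f0 (t *\<^sub>R x))) * ennreal (\<psi> t) \<le>
        (osc c x + osc c (t *\<^sub>R x)) * F (t *\<^sub>R x) * ennreal (\<psi> t) +
        ennreal (norm c) * (F (t *\<^sub>R x) * ennreal (\<psi> t))"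
      using tN
    proof eventually_elim
      case (elim t)
      show ?case
      proof (cases "t \<in> {0<..1}")
        case True
        then have "ennreal (norm (b0 (t *\<^sub>R x))) \<le> osc c (t *\<^sub>R x) + ennreal (norm c)"
          using elim norm_triangle_ineq[of "b (t *\<^sub>R x) - c" c]
          by (simp add: osc_def b0_def ennreal_leI flip: ennreal_plus)
        also have "\<dots> \<le> osc c x + osc c (t *\<^sub>R x) + ennreal (norm c)"
          by (intro add_right_mono) simp
        finally have "ennreal (norm (b0 (t *\<^sub>R x))) * (F (t *\<^sub>R x) * ennreal (\<psi> t)) \<le>
            (osc c x + osc c (t *\<^sub>R x) + ennreal (norm c)) * (F (t *\<^sub>R x) * ennreal (\<psi> t))"
          by (rule mult_right_mono) simp
        then show ?thesis
          by (simp add: norm_mult ennreal_mult F_def distrib_right mult.assoc)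
      qed (use \<psi>_0 in simp)
    qed
  qed
  also have "\<dots> = Cavg c x + ennreal (norm c) * Favg x"
    unfolding Cavg_def Favg_def by (subst nn_integral_add) (auto simp: nn_integral_cmult)
  also have "\<dots> < \<infinity>"
    using fin by (simp add: ennreal_mult_less_top)
  finally have fin2: "(\<integral>\<^sup>+t. ennreal (norm (b0 (t *\<^sub>R x) * f0 (t *\<^sub>R x))) * ennreal (\<psi> t) \<partial>lborel) < \<infinity>" .
  have bf [measurable]: "(\<lambda>y. b0 y * f0 y) \<in> borel_measurable borel" by measurable
  note h1 = hardy_eq_H[OF f0_measurable eq1 fin1]
  note h2 = hardy_eq_H[of "\<lambda>y. b0 y * f0 y" "\<lambda>y. b y * f y" x, OF bf eq2 fin2]
  show "commutator_defined \<phi> b f x"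
    using h1(2) h2(2) by (simp add: commutator_defined_def)
  show eq: "commutator \<phi> b f x = b0 x * H f0 x - H (\<lambda>y. b0 y * f0 y) x"
    using x by (simp add: commutator_def h1(3) h2(3) b0_def)
  \<comment> \<open>Now that both integrals converge, the difference of Hardy integrals is one
    integral containing \<open>b(x) - b(tx)\<close>.\<close>
  let ?c = "\<lambda>t. (b0 x - b0 (t *\<^sub>R x)) * f0 (t *\<^sub>R x) * complex_of_real (\<psi> t)"
  have i1: "integrable lborel (\<lambda>t. b0 x * (f0 (t *\<^sub>R x) * complex_of_real (\<psi> t)))"
    using h1(1) by (rule integrable_mult_right)
  have split: "?c = (\<lambda>t. b0 x * (f0 (t *\<^sub>R x) * complex_of_real (\<psi> t)) -
      b0 (t *\<^sub>R x) * f0 (t *\<^sub>R x) * complex_of_real (\<psi> t))"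
    by (rule ext) (simp add: left_diff_distrib mult.assoc)
  have "commutator \<phi> b f x = (LINT t|lborel. ?c t)"
    unfolding eq H_def split Bochner_Integration.integral_diff[OF i1 h2(1)]
    by (simp only: integral_mult_right_zero)
  moreover have "integrable lborel ?c"
    unfolding split using i1 h2(1) by (rule Bochner_Integration.integrable_diff)
  ultimately have "ennreal (norm (commutator \<phi> b f x)) \<le>
      (\<integral>\<^sup>+t. norm ((b0 x - b0 (t *\<^sub>R x)) * f0 (t *\<^sub>R x) * complex_of_real (\<psi> t)) \<partial>lborel)"
    by (simp only: integral_norm_bound_ennreal)
  also have "\<dots> \<le> Cavg d x"
    unfolding Cavg_def
  proof (rule nn_integral_mono_AE)
    show "AE t in lborel. ennreal (norm ((b0 x - b0 (t *\<^sub>R x)) * f0 (t *\<^sub>R x) * complex_of_real (\<psi> t))) \<le>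
        (osc d x + osc d (t *\<^sub>R x)) * F (t *\<^sub>R x) * ennreal (\<psi> t)"
      using tN
    proof eventually_elim
      case (elim t)
      show ?case
      proof (cases "t \<in> {0<..1}")
        case True
        have "ennreal (norm (b0 x - b0 (t *\<^sub>R x))) \<le> osc d x + osc d (t *\<^sub>R x)"
          using elim x True norm_triangle_ineq4[of "b x - d" "b (t *\<^sub>R x) - d"]
          by (simp add: osc_def b0_def ennreal_leI flip: ennreal_plus)
        then have "ennreal (norm (b0 x - b0 (t *\<^sub>R x))) * (F (t *\<^sub>R x) * ennreal (\<psi> t)) \<le>
            (osc d x + osc d (t *\<^sub>R x)) * (F (t *\<^sub>R x) * ennreal (\<psi> t))"
          by (rule mult_right_mono) simp
        then show ?thesis
          using \<psi>_nonneg[of t] by (simp add: norm_mult ennreal_mult F_def mult.assoc)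
      qed (use \<psi>_0 in simp)
    qed
  qed
  finally show "ennreal (norm (commutator \<phi> b f x)) \<le> Cavg d x" .
qed

lemma AE_commutator:
  "AE x in lborel. commutator_defined \<phi> b f x \<and>
    commutator \<phi> b f x = b0 x * H f0 x - H (\<lambda>y. b0 y * f0 y) x \<and>
    (\<forall>d. ennreal (norm (commutator \<phi> b f x)) \<le> Cavg d x)"
  using AE_averages_finite AE_not_in[OF N] AE_dilate_notin[OF N] AE_dilate_notin[OF Nf]
proof eventually_elim
  case (elim x)
  then obtain c where "Cavg c x < \<infinity>" by blast
  with elim show ?case using commutator_bound[of x c] by blast
qed

lemma commutator_measurable: "commutator \<phi> b f \<in> borel_measurable lebesgue"
proof (rule borel_measurable_AE)
  show "(\<lambda>x. b0 x * H f0 x - H (\<lambda>y. b0 y * f0 y) x) \<in> borel_measurable lebesgue"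
    by (rule measurable_completion) measurable
  show "AE x in lebesgue. b0 x * H f0 x - H (\<lambda>y. b0 y * f0 y) x = commutator \<phi> b f x"
    using AE_completion[OF AE_commutator] by eventually_elim simp
qed

lemma mixed_commutator:
  assumes R: "0 < R"
  shows "mixed r s (\<lambda>x. ennreal (norm (commutator \<phi> b f x)) * indicator (ball 0 R) x) \<le>
    Kf * K * ennreal (comm_const * R powr (D * (lam1 + lam2) + hdim r)) * \<Phi>"
proof -
  let ?B = "ball 0 R :: (real ^ 'a) set"
  define d where "d = ball_mean k b R"
  have "AE x in lborel. ennreal (norm (commutator \<phi> b f x)) \<le> Cavg d x"
    using AE_commutator by eventually_elim blast
  then obtain Z where Z: "Z \<in> null_sets lborel" "\<And>x. x \<notin> Z \<Longrightarrow> ennreal (norm (commutator \<phi> b f x)) \<le> Cavg d x"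
    by (rule AE_lborel_null_setE) blast
  have [measurable]: "Z \<in> sets borel" using Z by auto
  \<comment> \<open>Adding \<open>top\<close> on the null set \<open>Z\<close> turns an almost
    everywhere bound into a Borel majorant at every point, at the cost of a term of norm
    \<open>0\<close>.\<close>
  have "mixed r s (\<lambda>x. ennreal (norm (commutator \<phi> b f x)) * indicator ?B x) \<le>
      mixed r s (\<lambda>x. Cavg d x * indicator ?B x + top * indicator Z x)"
    using exponents_pos Z(2) by (intro mixed_mono) (auto simp: indicator_def)
  also have "\<dots> \<le> mixed r s (\<lambda>x. Cavg d x * indicator ?B x) + mixed r s (\<lambda>x. top * indicator Z x)"
    using r s by (intro mixed_add) auto
  also have "mixed r s (\<lambda>x. top * indicator Z x) = 0"
    using exponents_pos Z(1) by (subst mixed_eq_0_iff) (auto dest: AE_not_in simp: indicator_eq_0_iff)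
  finally show ?thesis
    using mixed_Cavg[OF R] by (simp add: d_def)
qed

lemma morrey_norm_commutator:
  "morrey_norm blk k m r s (lam1 + lam2) (commutator \<phi> b f) \<le> ennreal op_const * Kf"
  unfolding morrey_norm_le_iff[OF exponents_pos(1)]
proof (intro allI impI)
  fix R :: real assume R: "0 < R"
  let ?p = "R powr (D * (lam1 + lam2) + hdim r)"
  let ?v = "vol powr (lam1 + lam2) * ball_const r s"
  have v: "0 < ?v" using vol_pos ball_const_pos[OF exponents_pos(1)] by simp
  have "mixed r s (\<lambda>x. ennreal (norm (commutator \<phi> b f x)) * indicator (ball 0 R) x) \<le>
      Kf * K * ennreal (comm_const * ?p) * \<Phi>"
    using R by (rule mixed_commutator)
  also have "\<dots> = Kf * (ennreal (enn2real K) * ennreal (comm_const * ?p) * ennreal (enn2real \<Phi>))"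
    using K_finite \<Phi>_finite by (simp add: mult.assoc)
  also have "ennreal (enn2real K) * ennreal (comm_const * ?p) * ennreal (enn2real \<Phi>) =
      ennreal (enn2real K * (comm_const * ?p) * enn2real \<Phi>)"
    using comm_const_nonneg by (simp add: ennreal_mult)
  also have "enn2real K * (comm_const * ?p) * enn2real \<Phi> = op_const * (?v * ?p)"
    using vol_pos ball_const_pos[OF exponents_pos(1)] by (simp add: op_const_def)
  also have "Kf * ennreal (op_const * (?v * ?p)) = ennreal op_const * Kf * ennreal (?v * ?p)"
  proof -
    have nonneg: "0 \<le> op_const" "0 \<le> ?v * ?p"
      using comm_const_nonneg v by (simp_all add: op_const_def)
    show ?thesis unfolding ennreal_mult[OF nonneg] by (simp only: mult_ac)
  qed
  finally show "mixed r s (\<lambda>x. ennreal (norm (commutator \<phi> b f x)) * indicator (ball 0 R) x) \<le>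
      ennreal op_const * Kf * ennreal (?v * ?p)" .
qed

end

section \<open>Boundedness of the commutator\<close>

context hardy_commutator
begin

lemma bounded_commutator:
  "bounded_operator (commutator_defined \<phi> b) (commutator \<phi> b)
     (morrey_space blk k m r1 s1 lam1) (morrey_norm blk k m r1 s1 lam1)
     (morrey_space blk k m r s (lam1 + lam2)) (morrey_norm blk k m r s (lam1 + lam2))"
proof -
  have "(AE x in lebesgue. commutator_defined \<phi> b f x) \<and>
      commutator \<phi> b f \<in> morrey_space blk k m r s (lam1 + lam2) \<and>
      morrey_norm blk k m r s (lam1 + lam2) (commutator \<phi> b f) \<le> ennreal op_const * morrey_norm blk k m r1 s1 lam1 f"
    if f: "f \<in> morrey_space blk k m r1 s1 lam1" for f
  proof -
    have "f \<in> borel_measurable lebesgue" using f by (simp add: morrey_space_def)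
    then obtain Nf where "Nf \<in> null_sets lborel" "(\<lambda>x. if x \<in> Nf then 0 else f x) \<in> borel_measurable borel"
      by (rule borel_version_complex)
    with f interpret f: hardy_commutator_fun blk k m r2 s2 lam2 b N r r1 s s1 lam1 \<phi> \<psi> f Nf
      by unfold_locales
    have le: "morrey_norm blk k m r s (lam1 + lam2) (commutator \<phi> b f) \<le> ennreal op_const * f.Kf"
      by (rule f.morrey_norm_commutator)
    also have "\<dots> < \<infinity>"
      using f.Kf_finite by (simp add: ennreal_mult_less_top)
    finally have "commutator \<phi> b f \<in> morrey_space blk k m r s (lam1 + lam2)"
      using f.commutator_measurable by (simp add: morrey_space_def)
    moreover have "AE x in lebesgue. commutator_defined \<phi> b f x"
      using AE_completion[OF f.AE_commutator] by eventually_elim blast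
    ultimately show ?thesis using le by (simp add: f.Kf_def)
  qed
  then show ?thesis unfolding bounded_operator_def by blast
qed

end

theorem theorem4p3:
  fixes blk :: "'n::finite \<Rightarrow> nat" and m :: nat and k :: "real ^ 'n"
    and r r1 r2 s s1 s2 :: "nat \<Rightarrow> real"
    and lam lam1 lam2 :: real and \<phi> :: "real \<Rightarrow> real"
  assumes "CARD('n) \<ge> 2"
    and "range blk = {1..m}"
    and "\<And>j. k $ j \<ge> 0"
    and "\<And>i. i \<in> {1..m} \<Longrightarrow> 1 < r i \<and> r i < r1 i"
    and "\<And>i. i \<in> {1..m} \<Longrightarrow> 1 < s i \<and> s i < s1 i"
    and "\<And>i. i \<in> {1..m} \<Longrightarrow> 1 / r i = 1 / r1 i + 1 / r2 i"
    and "\<And>i. i \<in> {1..m} \<Longrightarrow> 1 / s i = 1 / s1 i + 1 / s2 i"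
    and "- (1 / hom_dim k) * (\<Sum>i=1..m. block_dim blk k i / r i) < lam"
    and "- (1 / hom_dim k) * (\<Sum>i=1..m. block_dim blk k i / r1 i) < lam1"
    and "0 < lam2" and "lam2 < 1 / hom_dim k"
    and "lam = lam1 + lam2"
    and "\<phi> \<in> borel_measurable (lebesgue_on {0<..1})"
    and "\<And>t. t \<in> {0<..1} \<Longrightarrow> \<phi> t \<ge> 0"
    and "(\<integral>\<^sup>+t\<in>{0<..1}. ennreal (t powr (hom_dim k * lam1) * \<phi> t) \<partial>lebesgue) < \<infinity>"
  shows "\<forall>b \<in> cmo_space blk k m r2 s2 lam2.
           bounded_operator (commutator_defined \<phi> b) (commutator \<phi> b)
             (morrey_space blk k m r1 s1 lam1) (morrey_norm blk k m r1 s1 lam1)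
             (morrey_space blk k m r s lam) (morrey_norm blk k m r s lam)"
proof
  fix b assume b: "b \<in> cmo_space blk k m r2 s2 lam2"
  \<comment> \<open>Makes the exponents of \<open>b\<close> exceed 1, as Minkowski's inequality and
    the dual exponents for the ball means require: \<open>1 / q\<close> is a difference lying
    strictly between 0 and 1.\<close>
  have conj: "1 < q" if "1 < p" "p < p1" "1 / p = 1 / p1 + 1 / q" for p p1 q :: real
  proof -
    have "1 / p1 < 1 / p" "1 / p < 1" "0 < 1 / p1"
      using that(1,2) by (auto simp: field_simps)
    then have "0 < 1 / q" "1 / q < 1" using that(3) by linarith+
    then show ?thesis by (simp add: field_simps)
  qed
  have "b \<in> borel_measurable lebesgue"
    using b by (intro set_integrable_imp_lebesgue_measurable[of k]) (auto simp: cmo_space_def)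
  then obtain N where N: "N \<in> null_sets lborel" "(\<lambda>x. if x \<in> N then 0 else b x) \<in> borel_measurable borel"
    by (rule borel_version_complex)
  have Ioc: "{0<..1::real} \<in> sets borel" by simp
  have nonneg: "\<forall>t\<in>{0<..1}. 0 \<le> \<phi> t" using assms(14) by blast
  obtain \<psi> where \<psi>: "\<psi> \<in> borel_measurable borel" "\<forall>t. 0 \<le> \<psi> t" "\<forall>t. t \<notin> {0<..1} \<longrightarrow> \<psi> t = 0"
    "AE t in lborel. t \<in> {0<..1} \<longrightarrow> \<phi> t = \<psi> t"
    by (rule borel_version_nonneg_real[OF assms(13) Ioc nonneg])
  have "(\<integral>\<^sup>+t. ennreal (t powr (hom_dim k * lam1) * \<psi> t) \<partial>lborel) =
      (\<integral>\<^sup>+t\<in>{0<..1}. ennreal (t powr (hom_dim k * lam1) * \<phi> t) \<partial>lborel)"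
  proof (rule nn_integral_cong_AE)
    show "AE t in lborel. ennreal (t powr (hom_dim k * lam1) * \<psi> t) =
        ennreal (t powr (hom_dim k * lam1) * \<phi> t) * indicator {0<..1} t"
      using \<psi>(4)
    proof eventually_elim
      case (elim t)
      then show ?case using \<psi>(3) by (cases "t \<in> {0<..1}") auto
    qed
  qed
  also have "\<dots> < \<infinity>"
    using assms(15) by (simp add: nn_integral_completion)
  finally have moment: "(\<integral>\<^sup>+t. ennreal (t powr (hom_dim k * lam1) * \<psi> t) \<partial>lborel) < \<infinity>" .
  interpret hardy_commutator blk k m r2 s2 lam2 b N r r1 s s1 lam1 \<phi> \<psi>
  proof unfold_locales
    show "1 < r2 i \<and> 1 < s2 i" if "i \<in> {1..m}" for i
      using conj assms(4-7)[OF that] by blast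
    show "\<forall>i\<in>{1..m}. 1 < r i \<and> 1 < r1 i \<and> 1 / r i = 1 / r1 i + 1 / r2 i"
      using assms(4,6) by (meson less_trans)
    show "\<forall>i\<in>{1..m}. 1 < s i \<and> 1 < s1 i \<and> 1 / s i = 1 / s1 i + 1 / s2 i"
      using assms(5,7) by (meson less_trans)
  qed (use assms(2,3,10) b N \<psi> moment in auto)
  show "bounded_operator (commutator_defined \<phi> b) (commutator \<phi> b)
      (morrey_space blk k m r1 s1 lam1) (morrey_norm blk k m r1 s1 lam1)
      (morrey_space blk k m r s lam) (morrey_norm blk k m r s lam)"
    using bounded_commutator by (simp only: assms(12))
qed

end
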